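(* Assume $p$ odd, $p\nmid n$, $\ell\ge2$. Let $\tau$ be an $n$-typical matrix and $\rho$ a $\tau$-regular representation of ${\rm GL}_n(\mathfrak o_\ell)$. Then $\mathrm{End}_{{\rm SL}_n(\mathfrak o_\ell)}\big(\mathrm{Res}^{{\rm GL}_n(\mathfrak o_\ell)}_{{\rm SL}_n(\mathfrak o_\ell)}\rho\big)\cong\mathbb C^{\iota(\tau,q-1)}$; i.e. the restriction is a direct sum of exactly $\iota(\tau,q-1)$ pairwise non-isomorphic irreducible representations.
   Context: $\mathfrak o$: ring of integers of a non-archimedean local field, uniformizer $\varpi$, residue field $\mathbf k=\mathbb F_q$ of characteristic $p$; $\mathfrak o_r=\mathfrak o/\varpi^r\mathfrak o$. $K_\ell^{\ell-1}=\ker({\rm GL}_n(\mathfrak o_\ell)\to{\rm GL}_n(\mathfrak o_{\ell-1}))$; fixing a character $\varphi$ of $(\mathfrak o_\ell,+)$ nontrivial on $\varpi^{\ell-1}\mathfrak o_\ell$, each $x\in M_n(\mathbf k)$ gives a character $\varphi_x(I+\varpi^{\ell-1}y)=\varphi(\varpi^{\ell-1}\mathrm{tr}(\hat xy))$. $x$ is regular if its characteristic polynomial equals its minimal polynomial. A nonnegative integer matrix $\tau=(\tau_{d,e})$ is $n$-typical if $\sum_{d,e}de\,\tau_{d,e}=n$. For regular $x$ with characteristic polynomial $\prod_if_i^{e_i}$ ($f_i$ distinct monic irreducible), $\mathbf m^x_{d,e}=\#\{i:\deg f_i=d,e_i=e\}$; $x$ is $\tau$-regular if $\mathbf m^x=\tau$;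 an irreducible representation is $\tau$-regular if its restriction to $K_\ell^{\ell-1}$ contains $\varphi_x$ for a $\tau$-regular $x$. $\iota(\tau,r)=\gcd(\{e:\exists d,\ \tau_{d,e}\ne0\}\cup\{r\})$. *)

theory Defs
  imports "HOL-Analysis.Analysis" "HOL-Computational_Algebra.Polynomial"
    "HOL-Computational_Algebra.Polynomial_Factorial"
begin

definition is_uniformizer :: "'o::idom \<Rightarrow> bool" where
  "is_uniformizer w \<longleftrightarrow> w \<noteq> 0 \<and> \<not> w dvd 1 \<and>
     (\<forall>x. x \<noteq> 0 \<longrightarrow> (\<exists>u k. u dvd 1 \<and> x = u * w ^ k))"

definition adically_complete :: "'o::idom \<Rightarrow> bool" where
  "adically_complete w \<longleftrightarrow>
     (\<forall>s::nat \<Rightarrow> 'o. (\<forall>k. w ^ k dvd (s (Suc k) - s k)) \<longrightarrow>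
        (\<exists>x. \<forall>k. w ^ k dvd (x - s k)))"

definition is_ring_hom :: "('a::comm_ring_1 \<Rightarrow> 'b::comm_ring_1) \<Rightarrow> bool" where
  "is_ring_hom f \<longleftrightarrow> (\<forall>a b. f (a + b) = f a + f b) \<and> (\<forall>a b. f (a * b) = f a * f b) \<and> f 1 = 1"

definition quotient_map :: "'o::idom \<Rightarrow> nat \<Rightarrow> ('o \<Rightarrow> 'r::comm_ring_1) \<Rightarrow> bool" where
  "quotient_map w r \<pi> \<longleftrightarrow> is_ring_hom \<pi> \<and> surj \<pi> \<and> (\<forall>x. \<pi> x = 0 \<longleftrightarrow> w ^ r dvd x)"

definition matmap :: "('a \<Rightarrow> 'b) \<Rightarrow> 'a^'n^'m \<Rightarrow> 'b^'n^'m" where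
  "matmap f A = (\<chi> i j. f (A $ i $ j))"

definition charpoly :: "'k::field^'n^'n \<Rightarrow> 'k poly" where
  "charpoly A = det (\<chi> i j. (if i = j then [:0, 1:] else 0) - [:A $ i $ j:])"

fun matpow :: "'a::semiring_1^'n^'n \<Rightarrow> nat \<Rightarrow> 'a^'n^'n" where
  "matpow A 0 = mat 1"
| "matpow A (Suc k) = A ** matpow A k"

definition poly_mat :: "'k::field poly \<Rightarrow> 'k^'n^'n \<Rightarrow> 'k^'n^'n" where
  "poly_mat p A = (\<Sum>i\<le>degree p. mat (coeff p i) ** matpow A i)"

definition minpoly :: "'k::field^'n^'n \<Rightarrow> 'k poly" where
  "minpoly A = (THE p. lead_coeff p = 1 \<and> poly_mat p A = 0 \<and> (\<forall>q. poly_mat q A = 0 \<longrightarrow> p dvd q))"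

definition regular_mat :: "'k::field^'n^'n \<Rightarrow> bool" where
  "regular_mat A \<longleftrightarrow> charpoly A = minpoly A"

definition mtype :: "'k::field^'n^'n \<Rightarrow> nat \<Rightarrow> nat \<Rightarrow> nat" where
  "mtype A d e = card {f. lead_coeff f = 1 \<and> irreducible f \<and> degree f = d \<and> f ^ e dvd charpoly A \<and> \<not> f ^ Suc e dvd charpoly A}"

definition typical :: "nat \<Rightarrow> (nat \<Rightarrow> nat \<Rightarrow> nat) \<Rightarrow> bool" where
  "typical n \<tau> \<longleftrightarrow> (\<forall>d e. (d = 0 \<or> e = 0) \<longrightarrow> \<tau> d e = 0) \<and>
      finite {(d, e). \<tau> d e \<noteq> 0} \<and>
      (\<Sum>(d, e)\<in>{(d, e). \<tau> d e \<noteq> 0}. d * e * \<tau> d e) = n"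

definition tau_regular_mat :: "(nat \<Rightarrow> nat \<Rightarrow> nat) \<Rightarrow> 'k::field^'n^'n \<Rightarrow> bool" where
  "tau_regular_mat \<tau> A \<longleftrightarrow> regular_mat A \<and> (\<forall>d\<ge>1. \<forall>e\<ge>1. mtype A d e = \<tau> d e)"

definition iota :: "(nat \<Rightarrow> nat \<Rightarrow> nat) \<Rightarrow> nat \<Rightarrow> nat" where
  "iota \<tau> r = Gcd ({e. \<exists>d. \<tau> d e \<noteq> 0} \<union> {r})"

definition GLn :: "('r::comm_ring_1^'n^'n) set" where
  "GLn = {A. det A dvd 1}"

definition SLn :: "('r::comm_ring_1^'n^'n) set" where
  "SLn = {A. det A = 1}"

definition is_rep :: "('r::comm_ring_1^'n^'n \<Rightarrow> complex^'m^'m) \<Rightarrow> bool" where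
  "is_rep \<rho> \<longleftrightarrow> \<rho> (mat 1) = mat 1 \<and> (\<forall>A\<in>GLn. \<forall>B\<in>GLn. \<rho> (A ** B) = \<rho> A ** \<rho> B)"

definition irreducible_rep :: "('r::comm_ring_1^'n^'n \<Rightarrow> complex^'m^'m) \<Rightarrow> bool" where
  "irreducible_rep \<rho> \<longleftrightarrow> is_rep \<rho> \<and>
     \<not> (\<exists>W. vec.subspace W \<and> W \<noteq> {0} \<and> W \<noteq> UNIV \<and> (\<forall>g\<in>GLn. \<forall>w\<in>W. \<rho> g *v w \<in> W))"

definition good_add_char :: "'o::idom \<Rightarrow> nat \<Rightarrow> ('o \<Rightarrow> 'r::comm_ring_1) \<Rightarrow> ('r \<Rightarrow> complex) \<Rightarrow> bool" where
  "good_add_char w l \<pi> \<psi> \<longleftrightarrow> (\<forall>a b. \<psi> (a + b) = \<psi> a * \<psi> b) \<and> (\<exists>a. \<psi> (\<pi> (w ^ (l - 1) * a)) \<noteq> 1)"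

text \<open>rho restricted to K_l^{l-1} contains phi_x, where x is the residue-field matrix and
  xh a lift of it to M_n(o); elements of K_l^{l-1} are the images of I + w^(l-1) y.\<close>
definition contains_phi :: "'o::idom \<Rightarrow> nat \<Rightarrow> ('o \<Rightarrow> 'r::comm_ring_1) \<Rightarrow> ('o \<Rightarrow> 'k::field) \<Rightarrow>
     ('r \<Rightarrow> complex) \<Rightarrow> ('r^'n^'n \<Rightarrow> complex^'m^'m) \<Rightarrow> 'k^'n^'n \<Rightarrow> bool" where
  "contains_phi w l \<pi> red \<psi> \<rho> x \<longleftrightarrow>
     (\<forall>xh::'o^'n^'n. matmap red xh = x \<longrightarrow>
       (\<exists>v::complex^'m. v \<noteq> 0 \<and>
          (\<forall>y::'o^'n^'n. \<rho> (matmap \<pi> (mat 1 + matmap (\<lambda>t. w ^ (l - 1) * t) y)) *v v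
               = \<psi> (\<pi> (w ^ (l - 1) * trace (xh ** y))) *s v)))"

definition tau_regular_rep :: "'o::idom \<Rightarrow> nat \<Rightarrow> ('o \<Rightarrow> 'r::comm_ring_1) \<Rightarrow> ('o \<Rightarrow> 'k::field) \<Rightarrow>
     ('r \<Rightarrow> complex) \<Rightarrow> (nat \<Rightarrow> nat \<Rightarrow> nat) \<Rightarrow> ('r^'n^'n \<Rightarrow> complex^'m^'m) \<Rightarrow> bool" where
  "tau_regular_rep w l \<pi> red \<psi> \<tau> \<rho> \<longleftrightarrow>
     irreducible_rep \<rho> \<and> (\<exists>x::'k^'n^'n. tau_regular_mat \<tau> x \<and> contains_phi w l \<pi> red \<psi> \<rho> x)"

definition End_SL :: "('r::comm_ring_1^'n^'n \<Rightarrow> complex^'m^'m) \<Rightarrow> (complex^'m^'m) set" where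
  "End_SL \<rho> = {T. \<forall>g\<in>SLn. T ** \<rho> g = \<rho> g ** T}"

definition alg_iso_Cpow :: "(complex^'m^'m) set \<Rightarrow> nat \<Rightarrow> bool" where
  "alg_iso_Cpow E k \<longleftrightarrow> (\<exists>\<phi>. bij_betw \<phi> E {f :: nat \<Rightarrow> complex. \<forall>i\<ge>k. f i = 0} \<and>
     (\<forall>S\<in>E. \<forall>T\<in>E. \<phi> (S + T) = (\<lambda>i. \<phi> S i + \<phi> T i) \<and> \<phi> (S ** T) = (\<lambda>i. \<phi> S i * \<phi> T i)) \<and>
     (\<forall>c. \<forall>T\<in>E. \<phi> (mat c ** T) = (\<lambda>i. c * \<phi> T i)) \<and>
     \<phi> (mat 1) = (\<lambda>i. if i < k then 1 else 0))"

end

(* Let E be the commutant of SL_n on the representation space. Conjugation by GL_n acts on E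
   through the residual determinant: p does not divide n, so principal units are n-th powers and
   hence determinants of scalar matrices. Thus E is graded by the characters of the cyclic group
   k^*, its degree-1 part consists of scalars and nonzero homogeneous elements are invertible, so E
   is the group algebra of the group of those characters chi for which chi(det) tensor rho is
   isomorphic to rho. It remains to see that these are the chi with chi^iota = 1.

   If chi^iota = 1, then chi(det) is trivial on the stabilizer of phi_x, because det f(x) is an
   iota-th power when the characteristic polynomial is one; the chi(det)-weighted orbit sum of the
   projections onto the phi_x-isotypic parts is then a nonzero intertwiner. Conversely, take a
   character of the congruence subgroup of level ceil(l/2) that extends phi_x and occurs in rho. Its
   isotypic part is irreducible under C(Z) K, where Z lifts x, C(Z) consists of the units commuting
   with Z and K is the congruence subgroup of level floor(l/2). An element t of C(Z) of order prime
   to p acts on it with a nonzero K-average, which forces chi(det t) = 1; and every e-th power of k^*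
   with tau_{d,e} nonzero is the residual determinant of such a t, since norms of finite fields are
   surjective. *)

theory Submission
  imports Defs "HOL-Algebra.Algebraic_Closure_Type" "HOL-Algebra.Multiplicative_Group"
begin

(* HOL-Algebra claims these names and symbols for its carrier-based structures. *)
hide_const (open) up_ring.coeff up_ring.monom Module.smult Polynomials.degree Polynomials.lead_coeff
  Divisibility.irreducible Divisibility.prime
no_notation Formal_Power_Series.fps_nth (infixl "$" 75)
no_notation Polynomials.var (\<open>X\<index>\<close>)

section \<open>Units of a finite ring\<close>

text \<open>The converse is the delicate half. For odd \<open>l\<close> the isotypic part can carry
  a Heisenberg-type representation of K, on which an element \<open>t\<close> of C(Z) need not be a
  scalar and could a priori have trace 0. Evaluating that trace is avoided by a coprimality
  argument: those commutators of \<open>t\<close> with K that act on the isotypic part by scalars do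
  so by p-power roots of unity which are also N-th roots of unity, N being an exponent of
  \<open>t\<close>. This is why \<open>t\<close> must have order prime to p; passing to a p-power of
  a given element achieves it and loses nothing, since p is invertible modulo q - 1. The level
  ceil(l/2) is the lowest at which multiplication in the congruence subgroup is addition of
  parameters, and floor(l/2) is the complementary level, whose group fixes all those characters. For
  the other direction level l - 1 suffices, because there only residual determinants of the
  stabilizer matter. Regularity acts through one fact: what commutes with Z modulo a power of the
  uniformizer is a polynomial in Z modulo that power. The commutant is an untwisted group algebra
  because the group of twisting characters is cyclic.\<close>

definition unit_set :: "'a::ring_1 set" where
  "unit_set = {g. \<exists>h. g * h = 1 \<and> h * g = 1}"

text \<open>Arbitrary outside \<open>unit_set\<close>.\<close>

definition uinv :: "'a::ring_1 \<Rightarrow> 'a" where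
  "uinv g = (SOME h. g * h = 1 \<and> h * g = 1)"

lemma unit_setI: "g * h = 1 \<Longrightarrow> h * g = 1 \<Longrightarrow> g \<in> unit_set"
  by (auto simp: unit_set_def)

lemma uinv_right [simp]: "g \<in> unit_set \<Longrightarrow> g * uinv g = 1"
  and uinv_left [simp]: "g \<in> unit_set \<Longrightarrow> uinv g * g = 1"
proof -
  assume "g \<in> unit_set"
  then have "\<exists>h. g * h = 1 \<and> h * g = 1" by (simp add: unit_set_def)
  from someI_ex[OF this] show "g * uinv g = 1" "uinv g * g = 1"
    by (simp_all add: uinv_def)
qed

lemma uinv_cancel [simp]:
  assumes "g \<in> unit_set"
  shows "g * (uinv g * x) = x" "uinv g * (g * x) = x"
  using assms by (simp_all flip: mult.assoc)

lemma uinv_unit [simp]: "g \<in> unit_set \<Longrightarrow> uinv g \<in> unit_set"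
  by (rule unit_setI[of _ g]) simp_all

lemma one_unit [simp]: "1 \<in> unit_set"
  by (rule unit_setI[of _ 1]) simp_all

lemma unit_mult [simp]: "g \<in> unit_set \<Longrightarrow> h \<in> unit_set \<Longrightarrow> g * h \<in> unit_set"
  by (rule unit_setI[of _ "uinv h * uinv g"]) (simp_all add: mult.assoc)

lemma uinv_unique: "g * h = 1 \<Longrightarrow> h * g = 1 \<Longrightarrow> uinv g = h"
  by (metis mult.assoc mult.left_neutral mult.right_neutral uinv_left unit_setI)

lemma uinv_mult: "g \<in> unit_set \<Longrightarrow> h \<in> unit_set \<Longrightarrow> uinv (g * h) = uinv h * uinv g"
  by (rule uinv_unique) (simp_all add: mult.assoc)

lemma uinv_one [simp]: "uinv 1 = 1"
  by (rule uinv_unique) simp_all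

lemma uinv_uinv [simp]: "g \<in> unit_set \<Longrightarrow> uinv (uinv g) = g"
  by (rule uinv_unique) simp_all

lemma uinv_commute:
  assumes "c \<in> unit_set" "c * x = x * c"
  shows "uinv c * x = x * uinv c"
proof -
  have "uinv c * x = uinv c * (x * c) * uinv c"
    using assms(1) by (simp add: mult.assoc)
  also have "\<dots> = uinv c * (c * x) * uinv c" by (simp only: assms(2))
  also have "\<dots> = x * uinv c" using assms(1) by simp
  finally show ?thesis .
qed

lemma unit_conj_eq:
  assumes "g \<in> unit_set" "g * x = y * g"
  shows "g * x * uinv g = y"
  using assms by (simp add: mult.assoc)

lemma unit_power [simp]: "g \<in> unit_set \<Longrightarrow> g ^ n \<in> unit_set"
  by (induction n) simp_all

text \<open>Since \<open>(1 + x) * (1 - x) = 1 - x * x\<close>, passing from \<open>x\<close> to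
  \<open>- (x * x)\<close> halves the nilpotency exponent, so induction on \<open>k\<close> with
  exponent \<open>2 ^ k\<close> replaces the geometric series.\<close>

lemma one_plus_nilpotent_unit:
  fixes x :: "'a::ring_1"
  assumes "x ^ n = 0"
  shows "1 + x \<in> unit_set"
proof -
  have "\<exists>k. n \<le> 2 ^ k" by (rule exI[of _ n]) (simp add: less_imp_le)
  then obtain k where "n \<le> 2 ^ k" by blast
  then have "x ^ (2 ^ k) = 0"
    using assms by (metis le_add_diff_inverse mult_zero_left power_add)
  then show ?thesis
  proof (induction k arbitrary: x)
    case 0
    then show ?case by simp
  next
    case (Suc k)
    \<comment> \<open>The sign disappears in an even power; \<open>2 ^ 0\<close> is odd, so
      \<open>k = 0\<close> is treated apart.\<close>
    have "(- (x * x)) ^ (2 ^ k) = 0 \<or> k = 0 \<and> x * x = 0"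
    proof (cases "k = 0")
      case True
      then show ?thesis using Suc.prems by (simp add: power2_eq_square)
    next
      case False
      have "(- (x * x)) ^ (2 ^ k) = (x * x) ^ (2 ^ k)" using False by simp
      also have "\<dots> = x ^ (2 ^ Suc k)" by (simp flip: power2_eq_square power_mult)
      finally show ?thesis using Suc.prems by simp
    qed
    then have "(- (x * x)) ^ (2 ^ k) = 0" by auto
    from Suc.IH[OF this] have u: "1 - x * x \<in> unit_set" by simp
    have e: "(1 + x) * (1 - x) = 1 - x * x" "(1 - x) * (1 + x) = 1 - x * x"
      by (simp_all add: algebra_simps)
    have c: "(1 - x * x) * (1 - x) = (1 - x) * (1 - x * x)" by (simp add: algebra_simps)
    note c' = uinv_commute[OF u c]
    show ?case
    proof (rule unit_setI)
      show "(1 + x) * ((1 - x) * uinv (1 - x * x)) = 1"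
        using u e by (simp flip: mult.assoc)
      show "((1 - x) * uinv (1 - x * x)) * (1 + x) = 1"
        unfolding c'[symmetric] using u e by (simp add: mult.assoc)
    qed
  qed
qed

lemma finite_unit_order:
  fixes g :: "'a::{ring_1,finite}"
  assumes "g \<in> unit_set"
  obtains n where "n > 0" "g ^ n = 1"
proof -
  have "\<not> inj (\<lambda>n::nat. g ^ n)"
    using finite_imageD[of "\<lambda>n::nat. g ^ n" UNIV] by auto
  then obtain m k where mk: "m < k" "g ^ m = g ^ k"
    unfolding inj_def by (metis linorder_neqE_nat)
  have "g ^ m * g ^ (k - m) = g ^ m * 1" using mk by (metis le_add_diff_inverse less_imp_le mult.right_neutral power_add)
  then have "g ^ (k - m) = 1" using assms by (metis uinv_cancel(2) unit_power)
  with that mk show ?thesis by (metis zero_less_diff)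
qed

text \<open>Binomial expansion to second order in a noncommutative ring; recording that the
  remainder commutes with \<open>x\<close> is what carries the induction.\<close>

lemma one_plus_power_expand:
  fixes x :: "'a::ring_1"
  shows "\<exists>y. (1 + x) ^ n = 1 + of_nat n * x + x * x * y \<and> x * y = y * x"
proof (induction n)
  case 0
  show ?case by (rule exI[of _ 0]) simp
next
  case (Suc n)
  then obtain y where y: "(1 + x) ^ n = 1 + of_nat n * x + x * x * y" "x * y = y * x" by blast
  have xy: "x * (x * y) = x * (y * x)" "x * (y * x) = y * (x * x)"
    using y(2) by (simp_all flip: mult.assoc)
  show ?case
    by (rule exI[of _ "of_nat n + y + x * y"])
      (use y in \<open>simp add: algebra_simps xy mult_of_nat_commute\<close>)
qed

text \<open>Each \<open>p\<close>-th power deepens the \<open>w\<close>-adic level by one: in the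
  expansion of \<open>(1 + w ^ Suc k * z) ^ p\<close> the linear term gains a factor
  \<open>w\<close> from \<open>p\<close>, and the remaining term has level \<open>2 * k + 2\<close>.
  So the congruence subgroup has exponent dividing \<open>p ^ l\<close>.\<close>

lemma one_plus_prime_power:
  fixes w :: "'a::ring_1"
  assumes cent: "\<And>x. w * x = x * w" and nil: "w ^ l = 0" and p: "of_nat p = w * c"
  shows "(1 + w * y) ^ (p ^ l) = 1"
proof -
  have "\<exists>z. (1 + w * y) ^ (p ^ k) = 1 + w ^ Suc k * z" for k
  proof (induction k)
    case 0
    then show ?case by auto
  next
    case (Suc k)
    then obtain z where z: "(1 + w * y) ^ (p ^ k) = 1 + w ^ Suc k * z" by blast
    obtain v where v: "(1 + w ^ Suc k * z) ^ p = 1 + of_nat p * (w ^ Suc k * z) + (w ^ Suc k * z) * (w ^ Suc k * z) * v"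
      using one_plus_power_expand by blast
    have wc: "x * w ^ j = w ^ j * x" for x :: 'a and j
      using cent by (metis power_commuting_commutes)
    have a: "of_nat p * (w ^ Suc k * z) = w ^ Suc (Suc k) * (c * z)"
      unfolding p by (metis mult.assoc power_Suc wc)
    have b: "(w ^ Suc k * z) * (w ^ Suc k * z) * v = w ^ Suc (Suc k) * (w ^ k * z * z * v)"
    proof -
      have "(w ^ Suc k * z) * (w ^ Suc k * z) * v = (w ^ Suc k * w ^ Suc k) * (z * z * v)"
        by (metis mult.assoc wc)
      also have "w ^ Suc k * w ^ Suc k = w ^ Suc (Suc k) * w ^ k" by (simp flip: power_add power_Suc)
      finally show ?thesis by (simp add: mult.assoc)
    qed
    have "(1 + w * y) ^ (p ^ Suc k) = (1 + w ^ Suc k * z) ^ p"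
      unfolding power_Suc2[of p] power_mult z ..
    also have "\<dots> = 1 + w ^ Suc (Suc k) * (c * z + w ^ k * z * z * v)"
      unfolding v a b by (simp add: distrib_left)
    finally show ?case by blast
  qed
  then obtain z where "(1 + w * y) ^ (p ^ l) = 1 + w ^ Suc l * z" by blast
  then show ?thesis using nil by simp
qed


section \<open>Isotypic projections for congruence subgroups of the unit group of a finite
  ring\<close>

locale complex_scalars =
  fixes scl :: "complex \<Rightarrow> 'e::ring_1 \<Rightarrow> 'e" (infixr "\<odot>" 75)
  assumes scl_mult_left [simp]: "(c \<odot> A) * B = c \<odot> (A * B)"
    and scl_mult_right [simp]: "A * (c \<odot> B) = c \<odot> (A * B)"
    and scl_scl [simp]: "c \<odot> d \<odot> A = (c * d) \<odot> A"
    and scl_one [simp]: "1 \<odot> A = A"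
    and scl_add_left: "(c + d) \<odot> A = c \<odot> A + d \<odot> A"
    and scl_add_right: "c \<odot> (A + B) = c \<odot> A + c \<odot> B"
begin

lemma scl_zero_right [simp]: "c \<odot> 0 = 0"
  using scl_add_right[of c 0 0] by simp

lemma scl_zero_left [simp]: "0 \<odot> A = 0"
  using scl_add_left[of 0 0 A] by simp

lemma scl_sum_right: "c \<odot> (\<Sum>x\<in>S. f x) = (\<Sum>x\<in>S. c \<odot> f x)"
  by (induction S rule: infinite_finite_induct) (simp_all add: scl_add_right)

lemma scl_sum_left: "(\<Sum>x\<in>S. f x) \<odot> A = (\<Sum>x\<in>S. f x \<odot> A)"
  by (induction S rule: infinite_finite_induct) (simp_all add: scl_add_left)

lemma scl_of_nat: "of_nat n \<odot> A = of_nat n * A"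
  by (induction n) (simp_all add: scl_add_left distrib_right)

lemma sum_const_scl: "(\<Sum>x\<in>S. A) = of_nat (card S) \<odot> A"
  by (simp add: scl_of_nat)

lemma scl_cancel: "c \<odot> A = c \<odot> B \<Longrightarrow> c \<noteq> 0 \<Longrightarrow> A = B"
  by (metis left_inverse scl_one scl_scl)

lemma scl_eq_0: "c \<odot> A = 0 \<longleftrightarrow> c = 0 \<or> A = 0"
  by (metis scl_cancel scl_zero_left scl_zero_right)

lemma scl_diff_left: "(c - d) \<odot> A = c \<odot> A - d \<odot> A"
  by (metis add_diff_cancel_right' diff_add_cancel scl_add_left)

lemma scl_eq_imp: "c \<odot> A = d \<odot> A \<Longrightarrow> c \<noteq> d \<Longrightarrow> A = 0"
  by (metis eq_iff_diff_eq_0 scl_diff_left scl_eq_0)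

lemma scl_power: "(c \<odot> A) ^ n = c ^ n \<odot> A ^ n"
  by (induction n) (simp_all add: mult.commute)

end

text \<open>In the application \<open>'a\<close> is the ring of n by n matrices over o_l,
  \<open>'e\<close> the endomorphism ring of the representation space, \<open>tau\<close> the
  additive character composed with the trace and \<open>w\<close> the scalar uniformizer.
  Irreducibility enters as Schur's lemma, which keeps vectors and traces of the representation space
  out of the argument.\<close>

locale unit_rep = complex_scalars scl
  for rho :: "'a::{ring_1,finite} \<Rightarrow> 'e::ring_1"
    and scl :: "complex \<Rightarrow> 'e \<Rightarrow> 'e" (infixr "\<odot>" 75)
    and tau :: "'a \<Rightarrow> complex" and w :: 'a and l :: nat +
  assumes rho_one [simp]: "rho 1 = 1"
    and rho_mult: "g \<in> unit_set \<Longrightarrow> h \<in> unit_set \<Longrightarrow> rho (g * h) = rho g * rho h"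
    and schur: "(\<And>g. g \<in> unit_set \<Longrightarrow> B * rho g = rho g * B) \<Longrightarrow> \<exists>c. B = c \<odot> 1"
    and tau_add: "tau (X + Y) = tau X * tau Y"
    and tau_zero [simp]: "tau 0 = 1"
    and tau_comm: "tau (X * Y) = tau (Y * X)"
    and tau_nondeg: "(\<And>Y. tau (X * Y) = 1) \<Longrightarrow> X = 0"
    and w_central: "w * X = X * w"
    and w_nil: "w ^ l = 0"
begin

lemma tau_neg: "tau (- X) * tau X = 1" "tau X * tau (- X) = 1"
  using tau_add[of "-X" X] tau_add[of X "-X"] by simp_all

lemma tau_nonzero [simp]: "tau X \<noteq> 0"
  using tau_neg[of X] by auto

lemma sum_tau:
  assumes "X \<noteq> 0"
  shows "(\<Sum>Y\<in>UNIV. tau (X * Y)) = 0"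
proof -
  obtain Y0 where Y0: "tau (X * Y0) \<noteq> 1" using tau_nondeg assms by blast
  have "(\<Sum>Y\<in>UNIV. tau (X * Y)) = (\<Sum>Y\<in>UNIV. tau (X * (Y0 + Y)))"
    by (rule sum.reindex_bij_witness[of _ "\<lambda>Y. Y0 + Y" "\<lambda>Y. Y - Y0"]) auto
  also have "\<dots> = tau (X * Y0) * (\<Sum>Y\<in>UNIV. tau (X * Y))"
    by (simp add: distrib_left tau_add sum_distrib_left)
  finally show ?thesis using Y0 by auto
qed

lemma w_pow_central: "X * w ^ a = w ^ a * X"
  using w_central by (metis power_commuting_commutes)

lemma w_pow_mult: "X * (w ^ a * Y) = w ^ a * (X * Y)"
  by (metis mult.assoc w_pow_central)

lemma w_pow_left: "NO_MATCH (w ^ c) X \<Longrightarrow> X * (w ^ a * Y) = w ^ a * (X * Y)"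
  by (rule w_pow_mult)

lemma w_pow_fold: "w ^ a * (w ^ b * X) = w ^ (a + b) * X"
  by (simp add: power_add mult.assoc)

lemmas w_pow_simps = w_pow_left w_pow_fold

lemma w_pow_ge: "l \<le> j \<Longrightarrow> w ^ j = 0"
  using w_nil by (metis le_add_diff_inverse mult_zero_left power_add)

lemma w_pow_mult_zero: "l \<le> a + b \<Longrightarrow> w ^ a * X * (w ^ b * Y) = 0"
  by (metis mult.assoc mult_zero_left power_add w_pow_ge w_pow_mult)

lemma congruence_unit:
  assumes "b \<ge> 1"
  shows "1 + w ^ b * Y \<in> unit_set"
proof -
  have "(w * X) ^ n = w ^ n * X ^ n" for X and n
  proof (induction n)
    case (Suc n)
    have "w * X * (w ^ n * X ^ n) = w * (w ^ n * (X * X ^ n))"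
      by (simp only: mult.assoc w_pow_mult)
    with Suc show ?case by (simp add: mult.assoc)
  qed simp
  then have "(w * (w ^ (b - 1) * Y)) ^ l = 0" by (simp add: w_nil)
  with one_plus_nilpotent_unit[of "w * (w ^ (b - 1) * Y)" l] show ?thesis
    using assms by (simp add: power_eq_if mult.assoc)
qed

text \<open>For \<open>l \<le> 2 a\<close> the congruence subgroup \<open>1 + w^a R\<close> is abelian, and this is the projection
  onto the isotypic part of its character \<open>1 + w^a Y \<mapsto> tau (w^a X Y)\<close>.\<close>

definition iso_proj :: "nat \<Rightarrow> 'a \<Rightarrow> 'e" where
  "iso_proj a X = (1 / of_nat CARD('a)) \<odot> (\<Sum>Y\<in>UNIV. tau (- (w ^ a * X * Y)) \<odot> rho (1 + w ^ a * Y))"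

lemma congruence_mult:
  assumes "l \<le> 2 * a"
  shows "(1 + w ^ a * Y) * (1 + w ^ a * Z) = 1 + w ^ a * (Y + Z)"
  using assms w_pow_mult_zero[of a a Y Z] by (simp add: algebra_simps)

lemma iso_proj_rho_left:
  assumes "l \<le> 2 * a" "a \<ge> 1"
  shows "rho (1 + w ^ a * Y) * iso_proj a X = tau (w ^ a * X * Y) \<odot> iso_proj a X"
proof -
  have "(\<Sum>Z\<in>UNIV. tau (- (w ^ a * X * Z)) \<odot> rho (1 + w ^ a * (Y + Z)))
      = (\<Sum>Z\<in>UNIV. tau (- (w ^ a * X * (Z - Y))) \<odot> rho (1 + w ^ a * Z))"
    by (rule sum.reindex_bij_witness[of _ "\<lambda>Z. Z - Y" "\<lambda>Z. Y + Z"]) auto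
  also have "\<dots> = (\<Sum>Z\<in>UNIV. tau (w ^ a * X * Y) \<odot> tau (- (w ^ a * X * Z)) \<odot> rho (1 + w ^ a * Z))"
    by (simp add: right_diff_distrib tau_add[symmetric])
  finally have eq: "(\<Sum>Z\<in>UNIV. tau (- (w ^ a * X * Z)) \<odot> rho (1 + w ^ a * (Y + Z)))
      = (\<Sum>Z\<in>UNIV. tau (w ^ a * X * Y) \<odot> tau (- (w ^ a * X * Z)) \<odot> rho (1 + w ^ a * Z))" .
  have "rho (1 + w ^ a * Y) * rho (1 + w ^ a * Z) = rho (1 + w ^ a * (Y + Z))" for Z
    using assms by (metis congruence_mult congruence_unit rho_mult)
  then have "rho (1 + w ^ a * Y) * iso_proj a X = (1 / of_nat CARD('a)) \<odot>
      (\<Sum>Z\<in>UNIV. tau (- (w ^ a * X * Z)) \<odot> rho (1 + w ^ a * (Y + Z)))"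
    by (simp add: iso_proj_def sum_distrib_left)
  also have "\<dots> = tau (w ^ a * X * Y) \<odot> iso_proj a X"
    unfolding eq by (simp add: iso_proj_def scl_sum_right)
  finally show ?thesis .
qed

lemma iso_proj_rho_right:
  assumes "l \<le> 2 * a" "a \<ge> 1"
  shows "iso_proj a X * rho (1 + w ^ a * Y) = tau (w ^ a * X * Y) \<odot> iso_proj a X"
proof -
  have "rho (1 + w ^ a * Z) * rho (1 + w ^ a * Y) = rho (1 + w ^ a * Y) * rho (1 + w ^ a * Z)" for Z
    using assms by (simp add: congruence_mult congruence_unit add.commute flip: rho_mult)
  then have "iso_proj a X * rho (1 + w ^ a * Y) = rho (1 + w ^ a * Y) * iso_proj a X"
    by (simp add: iso_proj_def sum_distrib_left sum_distrib_right)
  then show ?thesis by (simp add: iso_proj_rho_left[OF assms])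
qed

lemma iso_proj_fixed:
  assumes "\<And>Y. rho (1 + w ^ a * Y) * v = tau (w ^ a * X * Y) \<odot> v"
  shows "iso_proj a X * v = v"
  by (simp add: iso_proj_def sum_distrib_right assms tau_neg sum_const_scl del: sum_constant)

lemma iso_proj_idem:
  assumes "l \<le> 2 * a" "a \<ge> 1"
  shows "iso_proj a X * iso_proj a X = iso_proj a X"
  by (rule iso_proj_fixed) (rule iso_proj_rho_left[OF assms])

lemma iso_proj_orth:
  assumes "l \<le> 2 * a" "a \<ge> 1" "w ^ a * (X - X') \<noteq> 0"
  shows "iso_proj a X * iso_proj a X' = 0"
proof -
  obtain Y where Y: "tau (w ^ a * (X - X') * Y) \<noteq> 1" using tau_nondeg assms(3) by blast
  have eq: "tau (w ^ a * X * Y) = tau (w ^ a * (X - X') * Y) * tau (w ^ a * X' * Y)"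
    by (simp add: algebra_simps flip: tau_add)
  have "tau (w ^ a * X * Y) \<odot> (iso_proj a X * iso_proj a X')
      = iso_proj a X * (rho (1 + w ^ a * Y) * iso_proj a X')"
    using iso_proj_rho_right[OF assms(1,2), of X Y] by (simp flip: mult.assoc)
  also have "\<dots> = tau (w ^ a * X' * Y) \<odot> (iso_proj a X * iso_proj a X')"
    by (simp add: iso_proj_rho_left[OF assms(1,2)])
  finally show ?thesis by (rule scl_eq_imp) (use Y eq in auto)
qed

lemma rho_uinv [simp]:
  assumes "g \<in> unit_set"
  shows "rho g * rho (uinv g) = 1" "rho (uinv g) * rho g = 1"
  using assms by (simp_all flip: rho_mult)

lemma rho_uinv_cancel [simp]:
  assumes "g \<in> unit_set"
  shows "rho g * (rho (uinv g) * A) = A" "rho (uinv g) * (rho g * A) = A"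
  using assms by (simp_all flip: mult.assoc)

lemma rho_conj_congruence:
  assumes "g \<in> unit_set" "a \<ge> 1"
  shows "rho g * rho (1 + w ^ a * Y) * rho (uinv g) = rho (1 + w ^ a * (g * Y * uinv g))"
proof -
  have "g * (1 + w ^ a * Y) * uinv g = 1 + w ^ a * (g * Y * uinv g)"
    using assms by (simp add: distrib_left distrib_right w_pow_simps mult.assoc)
  then show ?thesis using assms by (metis congruence_unit rho_mult uinv_unit unit_mult)
qed

text \<open>\<open>tau\<close> is invariant under conjugation, so conjugating the projection
  conjugates its parameter. Hence the stabilizer of the character consists of the \<open>g\<close>
  with \<open>w ^ a * (g * X - X * g) = 0\<close>.\<close>

lemma iso_proj_conj:
  assumes "g \<in> unit_set" "a \<ge> 1"
  shows "rho g * iso_proj a X * rho (uinv g) = iso_proj a (g * X * uinv g)"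
proof -
  have t: "tau (- (w ^ a * X * Y)) = tau (- (w ^ a * (g * X * uinv g) * (g * Y * uinv g)))" for Y
  proof -
    have "tau (- (w ^ a * (g * X * uinv g) * (g * Y * uinv g))) = tau (g * (- (w ^ a * X * Y) * uinv g))"
      using assms(1) by (simp add: mult.assoc w_pow_simps)
    also have "\<dots> = tau (- (w ^ a * X * Y))"
      using assms(1) by (subst tau_comm) (simp add: mult.assoc)
    finally show ?thesis by simp
  qed
  have "rho g * iso_proj a X * rho (uinv g) =
     (1 / of_nat CARD('a)) \<odot> (\<Sum>Y\<in>UNIV. tau (- (w ^ a * X * Y)) \<odot> (rho g * rho (1 + w ^ a * Y) * rho (uinv g)))"
    by (simp add: iso_proj_def sum_distrib_left sum_distrib_right)
  also have "\<dots> = (1 / of_nat CARD('a)) \<odot> (\<Sum>Y\<in>UNIV. tau (- (w ^ a * (g * X * uinv g) * (g * Y * uinv g))) \<odot> rho (1 + w ^ a * (g * Y * uinv g)))"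
    by (simp only: rho_conj_congruence[OF assms] t)
  also have "\<dots> = iso_proj a (g * X * uinv g)"
    unfolding iso_proj_def
    by (rule arg_cong[where f = "\<lambda>A. _ \<odot> A"],
        rule sum.reindex_bij_witness[of _ "\<lambda>Y. uinv g * Y * g" "\<lambda>Y. g * Y * uinv g"])
      (use assms(1) in \<open>simp_all add: mult.assoc\<close>)
  finally show ?thesis .
qed

lemma iso_proj_sandwich:
  assumes "l \<le> 2 * a" "a \<ge> 1" "g \<in> unit_set" "w ^ a * (g * X - X * g) \<noteq> 0"
  shows "iso_proj a X * rho g * iso_proj a X = 0"
proof -
  have "w ^ a * (X - g * X * uinv g) \<noteq> 0"
  proof
    assume "w ^ a * (X - g * X * uinv g) = 0"
    then have "w ^ a * (X - g * X * uinv g) * g = 0" by simp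
    then have "w ^ a * (g * X - X * g) = 0" using assms(3) by (simp add: algebra_simps)
    with assms(4) show False by simp
  qed
  from iso_proj_orth[OF assms(1,2) this]
  have "iso_proj a X * (rho g * iso_proj a X * rho (uinv g)) * rho g = 0"
    unfolding iso_proj_conj[OF assms(3,2)] by simp
  then show ?thesis using assms(3) by (simp add: mult.assoc)
qed

lemma iso_proj_cong: "w ^ a * X = w ^ a * X' \<Longrightarrow> iso_proj a X = iso_proj a X'"
  by (simp add: iso_proj_def)

lemma iso_proj_commute:
  assumes "a \<ge> 1" "g \<in> unit_set" "w ^ a * (g * X - X * g) = 0"
  shows "rho g * iso_proj a X = iso_proj a X * rho g"
proof -
  have "w ^ a * (g * X * uinv g) = w ^ a * (g * X) * uinv g" by (simp add: mult.assoc)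
  also have "w ^ a * (g * X) = w ^ a * (X * g)" using assms(3) by (simp add: algebra_simps)
  also have "\<dots> * uinv g = w ^ a * X" using assms(2) by (simp add: mult.assoc)
  finally have "iso_proj a (g * X * uinv g) = iso_proj a X" by (rule iso_proj_cong)
  then have "rho g * iso_proj a X * rho (uinv g) * rho g = iso_proj a X * rho g"
    unfolding iso_proj_conj[OF assms(2,1)] by simp
  then show ?thesis using assms(2) by (simp add: mult.assoc)
qed

text \<open>Here \<open>X\<close> runs over all parameters, so each character is counted once for
  every \<open>X\<close> with the same \<open>w ^ a * X\<close>, and \<open>n\<close> is the size of
  the annihilator of \<open>w ^ a\<close>. Summing over \<open>X\<close> first leaves, by
  orthogonality, only the \<open>Y\<close> with \<open>w ^ a * Y = 0\<close>, whose group element is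
  1.\<close>

lemma iso_proj_sum:
  obtains n where "n > 0" "(\<Sum>X\<in>UNIV. iso_proj a X) = of_nat n \<odot> 1"
proof
  let ?S = "{Y. w ^ a * Y = 0}"
  show "card ?S > 0" by (auto simp: card_gt_0_iff intro!: exI[of _ 0])
  have inner: "(\<Sum>X\<in>UNIV. tau (- (w ^ a * X * Y))) = (if Y \<in> ?S then of_nat CARD('a) else 0)" for Y
  proof -
    have "tau (- (w ^ a * X * Y)) = tau (- (w ^ a * Y) * X)" for X
    proof -
      have "tau (- (w ^ a * X * Y)) = tau ((w ^ a * - X) * Y)" by simp
      also have "\<dots> = tau (Y * (w ^ a * - X))" by (rule tau_comm)
      also have "Y * (w ^ a * - X) = - (w ^ a * Y) * X" by (simp add: w_pow_simps mult.assoc)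
      finally show ?thesis .
    qed
    then have "(\<Sum>X\<in>UNIV. tau (- (w ^ a * X * Y))) = (\<Sum>X\<in>UNIV. tau (- (w ^ a * Y) * X))" by simp
    then show ?thesis using sum_tau[of "- (w ^ a * Y)"] by auto
  qed
  have "(\<Sum>X\<in>UNIV. iso_proj a X) =
     (1 / of_nat CARD('a)) \<odot> (\<Sum>Y\<in>UNIV. (\<Sum>X\<in>UNIV. tau (- (w ^ a * X * Y))) \<odot> rho (1 + w ^ a * Y))"
    unfolding iso_proj_def scl_sum_right[symmetric]
    by (subst sum.swap) (simp add: scl_sum_left)
  also have "\<dots> = (1 / of_nat CARD('a)) \<odot> (\<Sum>Y\<in>?S. of_nat CARD('a) \<odot> 1)"
    unfolding inner
    by (rule arg_cong[where f = "\<lambda>A. _ \<odot> A"], rule sum.mono_neutral_cong_right) auto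
  also have "\<dots> = of_nat (card ?S) \<odot> 1"
    by (simp add: sum_const_scl del: sum_constant)
  finally show "(\<Sum>X\<in>UNIV. iso_proj a X) = of_nat (card ?S) \<odot> 1" .
qed


text \<open>The image of the projection is irreducible under the stabilizer of the character: averaging \<open>B\<close>
  over the group gives a scalar, and compressing the average by the projection gives back a multiple
  of \<open>B\<close>.\<close>

lemma schur_corner:
  assumes a: "l \<le> 2 * a" "a \<ge> 1"
    and B: "B = iso_proj a Z * B" "B = B * iso_proj a Z"
    and comm: "\<And>g. g \<in> unit_set \<Longrightarrow> w ^ a * (g * Z - Z * g) = 0 \<Longrightarrow> rho g * B = B * rho g"
  obtains c where "B = c \<odot> iso_proj a Z"
    and "\<exists>N>0. (\<Sum>g\<in>unit_set. rho g * B * rho (uinv g)) = (of_nat N * c) \<odot> 1"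
proof -
  let ?P = "iso_proj a Z"
  let ?A = "\<Sum>g\<in>unit_set. rho g * B * rho (uinv g)"
  let ?I = "{g \<in> unit_set. w ^ a * (g * Z - Z * g) = 0}"
  have "?A * rho h = rho h * ?A" if h: "h \<in> unit_set" for h
  proof -
    have "rho h * ?A = (\<Sum>g\<in>unit_set. rho (h * g) * B * rho (uinv (h * g)) * rho h)"
      using h by (simp add: sum_distrib_left mult.assoc rho_mult uinv_mult cong: sum.cong)
    also have "\<dots> = (\<Sum>g\<in>unit_set. rho g * B * rho (uinv g) * rho h)"
      by (rule sum.reindex_bij_witness[of _ "\<lambda>g. uinv h * g" "\<lambda>g. h * g"]) (use h in auto)
    finally show ?thesis by (simp add: sum_distrib_right)
  qed
  then obtain c where c: "?A = c \<odot> 1" using schur by blast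
  \<comment> \<open>The stabilizer fixes \<open>B\<close> under conjugation, while every other
    \<open>g\<close> moves the isotypic part to an orthogonal one.\<close>
  have trm: "?P * (rho g * B * rho (uinv g)) * ?P = (if g \<in> ?I then B else 0)"
    if "g \<in> unit_set" for g
  proof (cases "g \<in> ?I")
    case True
    then have "rho g * B * rho (uinv g) = B" using that comm by (simp add: mult.assoc)
    then show ?thesis using True B by (metis mult.assoc)
  next
    case False
    with that have "w ^ a * (g * Z - Z * g) \<noteq> 0" by simp
    from iso_proj_sandwich[OF a that this] have "?P * rho g * ?P * B * rho (uinv g) * ?P = 0" by simp
    then have "?P * (rho g * (?P * B) * rho (uinv g)) * ?P = 0" by (simp add: mult.assoc)
    then show ?thesis using False B(1)[symmetric] by auto
  qed
  have "?P * ?A * ?P = (\<Sum>g\<in>unit_set. ?P * (rho g * B * rho (uinv g)) * ?P)"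
    by (simp add: sum_distrib_left sum_distrib_right)
  also have "\<dots> = (\<Sum>g\<in>unit_set. if g \<in> ?I then B else 0)" using trm by simp
  also have "\<dots> = (\<Sum>g\<in>?I. B)" by (rule sum.mono_neutral_cong_right) auto
  also have "\<dots> = of_nat (card ?I) \<odot> B" by (rule sum_const_scl)
  finally have e: "c \<odot> ?P = of_nat (card ?I) \<odot> B" by (simp add: c iso_proj_idem[OF a])
  define n where "n = card ?I"
  have "1 \<in> ?I" by simp
  then have n: "n > 0" unfolding n_def by (metis card_gt_0_iff empty_iff finite)
  note e = e[folded n_def]
  have "B = (1 / of_nat n) \<odot> of_nat n \<odot> B" using n by simp
  also have "\<dots> = (c / of_nat n) \<odot> ?P" unfolding e[symmetric] by simp
  finally have 1: "B = (c / of_nat n) \<odot> ?P" .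
  have 2: "\<exists>N>0. ?A = (of_nat N * (c / of_nat n)) \<odot> 1"
    by (rule exI[of _ n]) (use c n in simp)
  show ?thesis by (rule that[OF 1 2])
qed

text \<open>Reindexing the weighted sum of conjugates gives the twisted commutation. It does not
  vanish: multiplying by the projection kills every conjugate except those from the stabilizer, and
  each of these contributes the projection itself with weight 1, so nothing cancels.\<close>

lemma twisted_intertwiner:
  fixes ch :: "'a \<Rightarrow> complex"
  assumes a: "l \<le> 2 * a" "a \<ge> 1"
    and X: "iso_proj a X \<noteq> 0"
    and ch: "\<And>g h. g \<in> unit_set \<Longrightarrow> h \<in> unit_set \<Longrightarrow> ch (g * h) = ch g * ch h"
    and triv: "\<And>g. g \<in> unit_set \<Longrightarrow> w ^ a * (g * X - X * g) = 0 \<Longrightarrow> ch g = 1"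
  obtains M where "M \<noteq> 0" "\<And>g. g \<in> unit_set \<Longrightarrow> ch g \<odot> (rho g * M) = M * rho g"
proof
  let ?P = "iso_proj a X"
  let ?I = "{g \<in> unit_set. w ^ a * (g * X - X * g) = 0}"
  let ?M = "\<Sum>g\<in>unit_set. ch g \<odot> (rho g * ?P * rho (uinv g))"
  show "ch h \<odot> (rho h * ?M) = ?M * rho h" if h: "h \<in> unit_set" for h
  proof -
    have "ch h \<odot> (rho h * ?M) = (\<Sum>g\<in>unit_set. ch (h * g) \<odot> (rho (h * g) * ?P * rho (uinv (h * g)) * rho h))"
      using h by (simp add: sum_distrib_left scl_sum_right mult.assoc rho_mult uinv_mult ch cong: sum.cong)
    also have "\<dots> = (\<Sum>g\<in>unit_set. ch g \<odot> (rho g * ?P * rho (uinv g) * rho h))"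
      by (rule sum.reindex_bij_witness[of _ "\<lambda>g. uinv h * g" "\<lambda>g. h * g"]) (use h in auto)
    finally show ?thesis by (simp add: sum_distrib_right)
  qed
  have trm: "ch g \<odot> (rho g * ?P * rho (uinv g)) * ?P = (if g \<in> ?I then ?P else 0)"
    if g: "g \<in> unit_set" for g
  proof (cases "g \<in> ?I")
    case True
    then have c: "rho g * ?P = ?P * rho g" using iso_proj_commute a by blast
    have "rho g * ?P * rho (uinv g) = ?P" unfolding c using g by (simp add: mult.assoc)
    moreover have "ch g = 1" using True triv by blast
    ultimately show ?thesis using True iso_proj_idem[OF a] by simp
  next
    case False
    have "w ^ a * (g * X * uinv g - X) \<noteq> 0"
    proof
      assume "w ^ a * (g * X * uinv g - X) = 0"
      then have "w ^ a * (g * X * uinv g - X) * g = 0" by simp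
      then have "w ^ a * (g * X - X * g) = 0" using g by (simp add: algebra_simps)
      with False g show False by simp
    qed
    from iso_proj_orth[OF a this] show ?thesis
      using False by (auto simp add: iso_proj_conj[OF g a(2)])
  qed
  have "?M * ?P = (\<Sum>g\<in>unit_set. if g \<in> ?I then ?P else 0)"
    by (simp add: sum_distrib_right trm del: scl_mult_left cong: sum.cong)
  also have "\<dots> = (\<Sum>g\<in>?I. ?P)" by (rule sum.mono_neutral_cong_right) auto
  also have "\<dots> = of_nat (card ?I) \<odot> ?P" by (rule sum_const_scl)
  finally have e: "?M * ?P = of_nat (card ?I) \<odot> ?P" .
  have "1 \<in> ?I" by simp
  then have "card ?I \<noteq> 0" by (metis card_0_eq empty_iff finite)
  then have "?M * ?P \<noteq> 0" unfolding e scl_eq_0 of_nat_eq_0_iff using X by blast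
  then show "?M \<noteq> 0" by (metis mult_zero_left)
qed

text \<open>Some character of the larger group of level \<open>a\<close> survives on
  \<open>v\<close>, because the projections add up to a nonzero scalar. Letting the smaller group of
  level \<open>a'\<close> act on the surviving component in two ways shows that this character
  extends the given one.\<close>

lemma iso_proj_refine:
  assumes "a \<le> a'" and v: "v \<noteq> 0" "\<And>Y. rho (1 + w ^ a' * Y) * v = tau (w ^ a' * X * Y) \<odot> v"
    and a: "l \<le> 2 * a" "a \<ge> 1"
  obtains Z where "w ^ a' * (Z - X) = 0" "iso_proj a Z \<noteq> 0"
proof -
  obtain n where n: "n > 0" "(\<Sum>Z\<in>UNIV. iso_proj a Z) = of_nat n \<odot> 1" by (rule iso_proj_sum)
  have "(\<Sum>Z\<in>UNIV. iso_proj a Z) * v \<noteq> 0" unfolding n(2) using n v by (simp add: scl_eq_0)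
  then obtain Z where Z: "iso_proj a Z * v \<noteq> 0" by (metis sum.neutral sum_distrib_right)
  have "w ^ a' * (Z - X) = 0"
  proof (rule tau_nondeg)
    fix Y
    have aa: "w ^ a' * Q = w ^ a * (w ^ (a' - a) * Q)" for Q
      using assms(1) by (metis le_add_diff_inverse mult.assoc power_add)
    have "tau (w ^ a' * Z * Y) \<odot> (iso_proj a Z * v) = tau (w ^ a * Z * (w ^ (a' - a) * Y)) \<odot> iso_proj a Z * v"
    proof -
      have "w ^ a' * Z * Y = w ^ a * Z * (w ^ (a' - a) * Y)"
        by (metis mult.assoc aa w_pow_mult)
      then show ?thesis by simp
    qed
    also have "\<dots> = iso_proj a Z * rho (1 + w ^ a' * Y) * v"
      unfolding aa iso_proj_rho_right[OF a] ..
    also have "\<dots> = tau (w ^ a' * X * Y) \<odot> (iso_proj a Z * v)"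
      by (simp add: mult.assoc v(2))
    finally have "tau (w ^ a' * Z * Y) = tau (w ^ a' * X * Y)" using Z scl_eq_imp by blast
    then show "tau (w ^ a' * (Z - X) * Y) = 1"
      using tau_neg(2)[of "w ^ a' * X * Y"] tau_add[of "w ^ a' * Z * Y" "- (w ^ a' * X * Y)"]
      by (simp add: algebra_simps)
  qed
  then show ?thesis using Z that by force
qed


section \<open>Conjugation in the congruence subgroup of level floor(l/2) and the commutator
  pairing\<close>

lemma rho_uinv_commute:
  assumes "g \<in> unit_set" "rho g * A = A * rho g"
  shows "rho (uinv g) * A = A * rho (uinv g)"
proof -
  have "rho (uinv g) * A = rho (uinv g) * (A * rho g) * rho (uinv g)"
    using assms(1) by (simp add: mult.assoc)
  also have "\<dots> = rho (uinv g) * (rho g * A) * rho (uinv g)" unfolding assms(2) ..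
  also have "\<dots> = A * rho (uinv g)" using assms(1) by simp
  finally show ?thesis .
qed

lemma rho_power_commute:
  assumes "g \<in> unit_set" "rho g * A = th \<odot> A"
  shows "rho (g ^ n) * A = th ^ n \<odot> A"
proof (induction n)
  case (Suc n)
  have "rho (g ^ Suc n) * A = rho g * (rho (g ^ n) * A)"
    using assms(1) by (simp add: rho_mult mult.assoc)
  then show ?case by (simp add: Suc assms(2) mult.commute)
qed simp

text \<open>\<open>g\<close> permutes the elements \<open>c A\<close> by conjugation, through
  \<open>f\<close>. It is applied to the conjugates of \<open>t\<close> under the congruence
  subgroup, with \<open>f\<close> a conjugation or a left translation of the parameter.\<close>

lemma conj_sum_commute:
  fixes f :: "'a \<Rightarrow> 'a"
  assumes g: "g \<in> unit_set" "rho g * P = P * rho g"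
    and c: "\<And>A. c A \<in> unit_set" "\<And>A. g * c A = c (f A) * g" and f: "bij f"
  shows "rho g * (\<Sum>A\<in>UNIV. rho (c A) * P) = (\<Sum>A\<in>UNIV. rho (c A) * P) * rho g"
proof -
  have "rho g * (rho (c A) * P) = rho (c (f A)) * P * rho g" for A
  proof -
    have "rho g * (rho (c A) * P) = rho (g * c A) * P" using g(1) c(1) by (simp add: rho_mult mult.assoc)
    also have "\<dots> = rho (c (f A)) * (rho g * P)" unfolding c(2) using g(1) c(1) by (simp add: rho_mult mult.assoc)
    finally show ?thesis by (simp add: g(2) mult.assoc)
  qed
  then have "rho g * (\<Sum>A\<in>UNIV. rho (c A) * P) = (\<Sum>A\<in>UNIV. rho (c (f A)) * P * rho g)"
    by (simp add: sum_distrib_left)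
  also have "\<dots> = (\<Sum>A\<in>UNIV. rho (c A) * P * rho g)"
    using sum.reindex_bij_betw[OF f] by simp
  finally show ?thesis by (simp add: sum_distrib_right)
qed

text \<open>Below half level parameters no longer add: left translation in the congruence subgroup
  is an affine map of the parameter.\<close>

lemma congruence_mult_general:
  "(1 + w ^ b * X) * (1 + w ^ b * Y) = 1 + w ^ b * (X + (1 + w ^ b * X) * Y)"
  by (simp add: algebra_simps w_pow_simps mult.assoc)

lemma congruence_conj:
  "g \<in> unit_set \<Longrightarrow> g * (1 + w ^ b * A) = (1 + w ^ b * (g * A * uinv g)) * g"
  by (simp add: algebra_simps w_pow_simps mult.assoc)

lemma congruence_uinv:
  assumes "b \<ge> 1"
  shows "uinv (1 + w ^ b * A) = 1 + w ^ b * (- (uinv (1 + w ^ b * A) * A))"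
proof -
  have "uinv (1 + w ^ b * A) * (1 + w ^ b * A) = 1" using congruence_unit[OF assms] by simp
  then show ?thesis by (simp add: distrib_left w_pow_simps algebra_simps)
qed

text \<open>\<open>a\<close> and \<open>b\<close> are l/2 rounded up and down, and \<open>D\<close>
  will be the ring of polynomials in \<open>Z\<close>. The assumption \<open>centralizer\<close> is
  used for two values of \<open>j\<close>: \<open>a\<close>, which describes the stabilizer of the
  character, and \<open>2 * b\<close>, which describes the radical of the commutator
  pairing.\<close>

context
  fixes a b :: nat and Z :: 'a and D :: "'a set"
  assumes ab: "a + b = l" "b \<le> a" "a \<le> b + 1" "b \<ge> 1"
    and proj_nonzero: "iso_proj a Z \<noteq> 0"
    and D_comm: "\<And>d e. d \<in> D \<Longrightarrow> e \<in> D \<Longrightarrow> d * e = e * d"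
    and D_Z: "\<And>d. d \<in> D \<Longrightarrow> d * Z = Z * d"
    and centralizer: "\<And>g j. j \<le> l \<Longrightarrow> w ^ j * (g * Z - Z * g) = 0 \<Longrightarrow> \<exists>d\<in>D. \<exists>Y. g = d + w ^ (l - j) * Y"
begin

abbreviation (input) "P \<equiv> iso_proj a Z"
abbreviation (input) "k A \<equiv> 1 + w ^ b * A"

lemma a_bounds: "l \<le> 2 * a" "a \<ge> 1"
  using ab by auto

lemma k_unit [simp]: "k A \<in> unit_set"
  using ab by (simp add: congruence_unit)

lemma k_commute_P: "rho (k A) * P = P * rho (k A)"
proof (rule iso_proj_commute)
  have "w ^ a * (k A * Z - Z * k A) = w ^ a * (w ^ b * (A * Z - Z * A))"
    by (simp add: algebra_simps w_pow_simps)
  also have "\<dots> = 0" using w_pow_mult_zero[of a b 1] ab by simp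
  finally show "w ^ a * (k A * Z - Z * k A) = 0" .
qed (use a_bounds in auto)

lemma D_commute_P: "d \<in> D \<Longrightarrow> d \<in> unit_set \<Longrightarrow> rho d * P = P * rho d"
  using a_bounds by (simp add: iso_proj_commute D_Z)

text \<open>Commuting with \<open>Z\<close> after multiplication by \<open>w ^ a\<close> puts
  \<open>g\<close> into \<open>D\<close> up to level \<open>b\<close>, and a perturbation of level
  \<open>b\<close> of a unit is a factor from the congruence subgroup. So the stabilizer is the
  product of the units of \<open>D\<close> with that subgroup.\<close>

lemma stabilizer_decomp:
  assumes "g \<in> unit_set" "w ^ a * (g * Z - Z * g) = 0"
  obtains d Y where "d \<in> D" "d \<in> unit_set" "g = d * k Y"
proof -
  obtain d Y where d: "d \<in> D" "g = d + w ^ b * Y"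
    using centralizer[of a g] assms(2) ab by auto
  have "g * k (- (uinv g * Y)) = g - w ^ b * (g * (uinv g * Y))"
    by (simp add: algebra_simps w_pow_simps)
  also have "\<dots> = d" unfolding uinv_cancel(1)[OF assms(1)] using d(2) by simp
  finally have "d = g * k (- (uinv g * Y))" ..
  then have u: "d \<in> unit_set" using assms(1) k_unit unit_mult by metis
  have "g = d * k (uinv d * Y)" using d u by (simp add: algebra_simps w_pow_simps)
  with d u that show ?thesis by blast
qed

lemma stabilizer_commute:
  assumes D: "\<And>d. d \<in> D \<Longrightarrow> d \<in> unit_set \<Longrightarrow> rho d * B = B * rho d"
    and K: "\<And>A. rho (k A) * B = B * rho (k A)"
    and g: "g \<in> unit_set" "w ^ a * (g * Z - Z * g) = 0"
  shows "rho g * B = B * rho g"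
proof -
  obtain d Y where d: "d \<in> D" "d \<in> unit_set" "g = d * k Y" using stabilizer_decomp g by blast
  have "rho g * B = rho d * (rho (k Y) * B)" using d by (simp add: rho_mult mult.assoc)
  also have "\<dots> = rho d * B * rho (k Y)" unfolding K by (simp add: mult.assoc)
  also have "\<dots> = B * rho g" using d D by (simp add: rho_mult mult.assoc)
  finally show ?thesis .
qed

text \<open>Terms of third order vanish, because \<open>l \<le> 2 * b + 1\<close> and
  \<open>b \<ge> 1\<close> give \<open>l \<le> 3 * b\<close>; only the second-order commutator is
  left.\<close>

lemma k_conj:
  "k C * k Y * uinv (k C) = k Y * (1 + w ^ (2 * b) * (C * Y - Y * C))"
proof (rule unit_conj_eq)
  have w0: "w ^ (b + (b + b)) = 0" "w ^ (b + (b + (b + b))) = 0" "w ^ (b * 2) = w ^ (b + b)"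
    using ab by (auto intro: w_pow_ge simp: mult_2_right)
  show "k C * k Y = k Y * (1 + w ^ (2 * b) * (C * Y - Y * C)) * k C"
    by (simp add: algebra_simps w_pow_simps mult_2 w0)
qed simp

text \<open>The commutator has level \<open>2 * b \<ge> a\<close>, so it acts on \<open>P\<close>
  through the character. Cyclic invariance of \<open>tau\<close> moves \<open>C\<close> to the end
  and exhibits the pairing of \<open>Y\<close> with \<open>C\<close>; by nondegeneracy its radical
  is given by \<open>w ^ (2 * b) * (Y * Z - Z * Y) = 0\<close>.\<close>

lemma k_conj_P:
  "rho (k C * k Y * uinv (k C)) * P = tau (w ^ (2 * b) * (Y * Z - Z * Y) * C) \<odot> (rho (k Y) * P)"
proof -
  let ?V = "C * Y - Y * C"
  have e: "w ^ (2 * b) * X = w ^ a * (w ^ (2 * b - a) * X)" for X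
    using ab by (simp add: w_pow_fold)
  have u: "1 + w ^ (2 * b) * ?V \<in> unit_set" using ab by (intro congruence_unit) auto
  have "tau (w ^ a * Z * (w ^ (2 * b - a) * ?V)) = tau (w ^ (2 * b) * (Y * Z - Z * Y) * C)"
  proof -
    have "w ^ a * Z * (w ^ (2 * b - a) * ?V) = w ^ (2 * b) * (Z * ?V)"
      by (metis e mult.assoc w_pow_mult)
    also have "\<dots> = (w ^ (2 * b) * Z * C) * Y + - (w ^ (2 * b) * Z * Y * C)"
      by (simp add: algebra_simps)
    finally have eq: "w ^ a * Z * (w ^ (2 * b - a) * ?V) =
        (w ^ (2 * b) * Z * C) * Y + - (w ^ (2 * b) * Z * Y * C)" .
    have "tau (w ^ a * Z * (w ^ (2 * b - a) * ?V)) =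
        tau (Y * (w ^ (2 * b) * Z * C)) * tau (- (w ^ (2 * b) * Z * Y * C))"
      unfolding eq tau_add by (subst tau_comm) (rule refl)
    also have "\<dots> = tau (w ^ (2 * b) * (Y * Z - Z * Y) * C)"
      by (simp add: algebra_simps w_pow_simps flip: tau_add)
    finally show ?thesis .
  qed
  then have "rho (1 + w ^ (2 * b) * ?V) * P = tau (w ^ (2 * b) * (Y * Z - Z * Y) * C) \<odot> P"
    unfolding e by (simp only: iso_proj_rho_left[OF a_bounds])
  then show ?thesis unfolding k_conj using u by (simp add: rho_mult mult.assoc)
qed

text \<open>Elements of the radical of the commutator pairing act on the image of the projection by scalars;
  the others average to zero over conjugation.\<close>

lemma radical_scalar:
  assumes "w ^ (2 * b) * (Y * Z - Z * Y) = 0"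
  obtains th where "rho (k Y) * P = th \<odot> P"
proof -
  have "2 * b \<le> l" using ab by simp
  with centralizer assms obtain d Y' where d: "d \<in> D" "Y = d + w ^ (l - 2 * b) * Y'" by blast
  \<comment> \<open>The two exponents add up to \<open>a\<close>: replacing \<open>Y\<close> by
    \<open>d\<close> changes \<open>k Y\<close> by a factor of level \<open>a\<close>, which acts on
    \<open>P\<close> by a scalar.\<close>
  have wa: "w ^ b * (w ^ (l - 2 * b) * X) = w ^ a * X" for X
  proof -
    have "b + (l - 2 * b) = a" using ab by simp
    then show ?thesis by (metis mult.assoc power_add)
  qed
  have kY: "k Y = k d * (1 + w ^ a * (uinv (k d) * Y'))"
  proof -
    have "k d * (1 + w ^ a * (uinv (k d) * Y')) = k d + w ^ a * (k d * (uinv (k d) * Y'))"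
      by (metis (no_types, opaque_lifting) distrib_left mult.right_neutral w_pow_mult)
    then show ?thesis using d(2) by (simp add: wa distrib_left)
  qed
  have rkY: "rho (k Y) * P = tau (w ^ a * Z * (uinv (k d) * Y')) \<odot> (rho (k d) * P)"
    unfolding kY using a_bounds
    by (simp add: rho_mult congruence_unit mult.assoc iso_proj_rho_left)
  have 1: "rho (k Y) * P = P * (rho (k Y) * P)"
    using k_commute_P[of Y] iso_proj_idem[OF a_bounds, of Z] by (metis mult.assoc)
  have 2: "rho (k Y) * P = (rho (k Y) * P) * P"
    using iso_proj_idem[OF a_bounds, of Z] by (simp add: mult.assoc)
  have 3: "rho g * (rho (k Y) * P) = (rho (k Y) * P) * rho g"
    \<comment> \<open>Commutation with \<open>D\<close> is inherited from \<open>k d\<close>, as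
      \<open>D\<close> is commutative; commutation with the congruence subgroup is the radical
      condition.\<close>
    if "g \<in> unit_set" "w ^ a * (g * Z - Z * g) = 0" for g
  proof (rule stabilizer_commute[OF _ _ that])
    fix e assume e: "e \<in> D" "e \<in> unit_set"
    have "e * k d = k d * e" using D_comm[OF e(1) d(1)] by (simp add: algebra_simps w_pow_simps)
    then have "rho e * rho (k d) = rho (k d) * rho e" using e by (metis k_unit rho_mult)
    then have "rho e * (rho (k d) * P) = rho (k d) * P * rho e"
      using D_commute_P[OF e] by (metis mult.assoc)
    then show "rho e * (rho (k Y) * P) = rho (k Y) * P * rho e" unfolding rkY by simp
  next
    fix C
    have "rho (k C * k Y * uinv (k C)) * P = rho (k Y) * P"
      unfolding k_conj_P assms by simp
    then have "rho (k C) * rho (k Y) * rho (uinv (k C)) * P * rho (k C) = rho (k Y) * P * rho (k C)"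
      by (simp add: rho_mult)
    moreover have "rho (uinv (k C)) * P = P * rho (uinv (k C))"
      by (rule rho_uinv_commute) (simp_all add: k_commute_P)
    ultimately show "rho (k C) * (rho (k Y) * P) = rho (k Y) * P * rho (k C)"
      by (simp add: mult.assoc)
  qed
  from schur_corner[OF a_bounds 1 2 3] that show ?thesis by blast
qed

lemma nonradical_sum:
  assumes "w ^ (2 * b) * (Y * Z - Z * Y) \<noteq> 0"
  shows "(\<Sum>C\<in>UNIV. rho (k C * k Y * uinv (k C)) * P) = 0"
  unfolding k_conj_P scl_sum_left[symmetric] sum_tau[OF assms] by simp

text \<open>If the average vanished, so would its double conjugation average, in which only the radical
  commutators \<open>h = [t^-1, k]\<close> survive. Their scalars \<open>\<theta>\<close> satisfy \<open>\<theta>^N = 1\<close> because \<open>\<theta>\<close> is invariant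
  under \<open>t\<close>, and \<open>\<theta>^(p^l) = 1\<close> because congruence subgroups are \<open>p\<close>-groups; hence \<open>\<theta> = 1\<close> and
  nothing cancels.\<close>

lemma conj_average_nonzero:
  assumes p: "of_nat p = w * c0" and N: "coprime N (p ^ l)"
    and t: "t \<in> D" "t \<in> unit_set" "t ^ N = 1"
  shows "(\<Sum>A\<in>UNIV. rho (k A * t * uinv (k A)) * P) \<noteq> 0"
proof
  assume zero: "(\<Sum>A\<in>UNIV. rho (k A * t * uinv (k A)) * P) = 0"
  define s where "s = uinv t"
  have s: "s \<in> unit_set" "uinv s = t" using t by (simp_all add: s_def)
  have sN: "s ^ N = 1"
  proof -
    have "t ^ n * s ^ n = 1" for n
    proof (induction n)
      case (Suc n)
      have "t ^ Suc n * s ^ Suc n = t ^ n * (t * s) * s ^ n"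
        by (simp add: power_Suc2 mult.assoc del: power_Suc) (simp add: power_commutes)
      with Suc t show ?case by (simp add: s_def)
    qed simp
    then show ?thesis using t(3) by (metis mult.left_neutral)
  qed
  have rs: "rho s * P = P * rho s"
    unfolding s_def using D_commute_P[OF t(1,2)] t(2) by (rule rho_uinv_commute[rotated])
  \<comment> \<open>The commutator of \<open>s = uinv t\<close> with \<open>k A\<close>; conjugation
    by \<open>s\<close> preserves the congruence subgroup, so \<open>h A\<close> lies in it.\<close>
  define h where "h A = s * k A * t * uinv (k A)" for A
  have h_unit: "h A \<in> unit_set" for A using s(1) t(2) by (simp add: h_def)
  have sk: "s * k A * t = k (s * A * t)" for A
  proof -
    have "s * k A = k (s * A * uinv s) * s" by (rule congruence_conj[OF s(1)])
    then have "s * k A * t = k (s * A * t) * (s * t)" using s by (simp add: mult.assoc)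
    then show ?thesis using t(2) by (simp add: s_def)
  qed
  have h_form: "\<exists>Y. h A = k Y" for A
  proof -
    have "h A = k (s * A * t) * k (- (uinv (k A) * A))"
      unfolding h_def sk congruence_uinv[OF ab(4), symmetric] ..
    then show ?thesis unfolding congruence_mult_general by blast
  qed
  define S where "S A = (\<Sum>C\<in>UNIV. rho (k C * h A * uinv (k C)) * P)" for A
  have S_val: "S A = 0 \<or> S A = of_nat CARD('a) \<odot> P" for A
  proof (cases "\<exists>Y. h A = k Y \<and> w ^ (2 * b) * (Y * Z - Z * Y) = 0")
    case False
    with h_form[of A] obtain Y where Y: "h A = k Y" "w ^ (2 * b) * (Y * Z - Z * Y) \<noteq> 0" by blast
    then show ?thesis using nonradical_sum[OF Y(2)] by (simp only: S_def simp_thms)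
  next
    case True
    then obtain Y where Y: "h A = k Y" "w ^ (2 * b) * (Y * Z - Z * Y) = 0" by blast
    obtain th where th: "rho (h A) * P = th \<odot> P" using radical_scalar[OF Y(2)] Y(1) by auto
    have hp: "h A ^ (p ^ l) = 1"
    proof -
      have "h A = 1 + w * (w ^ (b - 1) * Y)"
        unfolding Y(1) using ab(4) by (simp add: power_eq_if mult.assoc)
      then show ?thesis using one_plus_prime_power[OF w_central w_nil p] by simp
    qed
    have thp: "th ^ (p ^ l) = 1"
    proof (rule ccontr)
      assume ne: "th ^ (p ^ l) \<noteq> 1"
      have "th ^ (p ^ l) \<odot> P = 1 \<odot> P"
        using rho_power_commute[OF h_unit th, of "p ^ l"] hp by simp
      from scl_eq_imp[OF this ne] proj_nonzero show False by simp
    qed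
    have thN: "th ^ N = 1"
    proof (rule ccontr)
      assume ne: "th ^ N \<noteq> 1"
      \<comment> \<open>Moving \<open>k A\<close> past \<open>s ^ i\<close> produces a product
        \<open>H\<close> of \<open>i\<close> conjugates of \<open>h A\<close> by powers of
        \<open>s\<close>. Each acts on \<open>P\<close> by \<open>th\<close>, since \<open>s\<close>
        commutes with \<open>P\<close>. At \<open>i = N\<close> the power of \<open>s\<close> is 1,
        which forces \<open>H = 1\<close>.\<close>
      have "\<exists>H. H \<in> unit_set \<and> s ^ i * k A = H * k A * s ^ i \<and> rho H * P = th ^ i \<odot> P" for i
      proof (induction i)
        case 0
        show ?case by (rule exI[of _ 1]) simp
      next
        case (Suc i)
        then obtain H where H: "H \<in> unit_set" "s ^ i * k A = H * k A * s ^ i" "rho H * P = th ^ i \<odot> P"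
          by blast
        let ?H = "s * H * t * h A"
        have "s ^ Suc i * k A = s * (H * k A) * s ^ i" using H(2) by (simp add: mult.assoc)
        also have "s * (H * k A) = ?H * k A * s"
          using s(1) t(2) by (simp add: h_def mult.assoc s_def)
        finally have e: "s ^ Suc i * k A = ?H * k A * s ^ Suc i" by (simp add: mult.assoc)
        have "rho ?H * P = rho s * rho H * rho t * (rho (h A) * P)"
          using s(1) H(1) t(2) h_unit by (simp add: rho_mult mult.assoc)
        also have "\<dots> = th \<odot> (rho s * rho H * (rho t * P))" by (simp add: th mult.assoc)
        also have "rho t * P = P * rho t" by (rule D_commute_P[OF t(1,2)])
        also have "rho s * rho H * (P * rho t) = rho s * (rho H * P) * rho t" by (simp add: mult.assoc)
        also have "\<dots> = th ^ i \<odot> (rho s * P * rho t)" by (simp add: H(3))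
        also have "rho s * P * rho t = P" unfolding rs using t(2) by (simp add: s_def mult.assoc)
        finally have "rho ?H * P = th ^ Suc i \<odot> P" by simp
        moreover have "?H \<in> unit_set" using s(1) H(1) t(2) h_unit by simp
        ultimately show ?case using e by blast
      qed
      then obtain H where H: "H \<in> unit_set" "s ^ N * k A = H * k A * s ^ N" "rho H * P = th ^ N \<odot> P"
        by blast
      have "H * k A = 1 * k A" using H(2) sN by simp
      then have "H = 1" by (metis k_unit mult.assoc mult.right_neutral uinv_right)
      then have "th ^ N \<odot> P = 1 \<odot> P" using H(3) by simp
      from scl_eq_imp[OF this ne] proj_nonzero show False by simp
    qed
    have "th = 1"
    proof -
      \<comment> \<open>\<open>bezout_nat\<close> wants a nonzero first argument; if
        \<open>p ^ l\<close> were 0, coprimality would make \<open>N\<close> equal to 1.\<close>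
      have "p ^ l \<noteq> 0 \<or> N = 1" using N by (cases "p ^ l = 0") auto
      then show ?thesis
      proof
        assume "p ^ l \<noteq> 0"
        then obtain x y where xy: "p ^ l * x = N * y + gcd (p ^ l) N"
          using bezout_nat by blast
        moreover have "gcd (p ^ l) N = 1" using N by (simp add: coprime_iff_gcd_eq_1 gcd.commute)
        ultimately have "th ^ (p ^ l * x) = th ^ (N * y + 1)" by simp
        then show ?thesis using thp thN by (simp add: power_mult power_add)
      qed (use thN in simp)
    qed
    moreover have "rho (k C * h A * uinv (k C)) * P = rho (h A) * P" for C
      unfolding Y(1) k_conj_P Y(2) by simp
    ultimately show ?thesis unfolding S_def using th by (simp add: sum_const_scl del: sum_constant)
  qed
  have S_0: "S 0 = of_nat CARD('a) \<odot> P"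
  proof -
    have "h 0 = 1" using t(2) by (simp add: h_def s_def)
    then show ?thesis unfolding S_def by (simp add: sum_const_scl del: sum_constant)
  qed
  \<comment> \<open>\<open>h A\<close> is \<open>s\<close> times the conjugate of \<open>t\<close>
    by \<open>k A\<close>, so after interchanging the sums the inner one is built from the average
    assumed to vanish.\<close>
  have "(\<Sum>A\<in>UNIV. S A) = (\<Sum>C\<in>UNIV. \<Sum>A\<in>UNIV. rho (k C * h A * uinv (k C)) * P)"
    unfolding S_def by (rule sum.swap)
  also have "\<dots> = (\<Sum>C\<in>UNIV. rho (k C) * (rho s * (\<Sum>A\<in>UNIV. rho (k A * t * uinv (k A)) * P)) * rho (uinv (k C)))"
  proof (rule sum.cong[OF refl])
    fix C
    have "rho (k C * h A * uinv (k C)) * P = rho (k C) * (rho s * (rho (k A * t * uinv (k A)) * P)) * rho (uinv (k C))" for A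
    proof -
      have kP: "rho (uinv (k C)) * P = P * rho (uinv (k C))"
        by (rule rho_uinv_commute) (simp_all add: k_commute_P)
      have "h A = s * (k A * t * uinv (k A))" by (simp add: h_def mult.assoc)
      then have "rho (k C * h A * uinv (k C)) = rho (k C) * (rho s * rho (k A * t * uinv (k A))) * rho (uinv (k C))"
        using s(1) t(2) by (simp only: rho_mult unit_mult k_unit uinv_unit)
      then show ?thesis by (simp add: mult.assoc kP)
    qed
    then show "(\<Sum>A\<in>UNIV. rho (k C * h A * uinv (k C)) * P)
      = rho (k C) * (rho s * (\<Sum>A\<in>UNIV. rho (k A * t * uinv (k A)) * P)) * rho (uinv (k C))"
      by (simp add: sum_distrib_left sum_distrib_right)
  qed
  also have "\<dots> = 0" unfolding zero by simp
  finally have sum0: "(\<Sum>A\<in>UNIV. S A) = 0" .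
  \<comment> \<open>All nonzero \<open>S A\<close> are the same positive multiple of
    \<open>P\<close>, so a zero total leaves none of them, against the value of
    \<open>S 0\<close>.\<close>
  have "(\<Sum>A\<in>UNIV. S A) = (\<Sum>A | S A \<noteq> 0. of_nat CARD('a) \<odot> P)"
    by (rule sum.mono_neutral_cong_right) (use S_val in auto)
  also have "\<dots> = of_nat (card {A. S A \<noteq> 0}) \<odot> of_nat CARD('a) \<odot> P"
    by (rule sum_const_scl)
  finally have "of_nat (card {A. S A \<noteq> 0}) \<odot> of_nat CARD('a) \<odot> P = 0" using sum0 by simp
  then have "card {A. S A \<noteq> 0} = 0" using proj_nonzero by (simp only: scl_eq_0) simp
  then have "S 0 = 0" by simp
  moreover have "of_nat CARD('a) \<odot> P \<noteq> 0" unfolding scl_eq_0 using proj_nonzero by simp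
  ultimately show False using S_0 by metis
qed

text \<open>The average of \<open>t\<close> over \<open>1 + w^b R\<close> is a nonzero scalar on the image of the projection, so it
  commutes with \<open>M\<close> there, while \<open>M\<close> commutes with it only up to \<open>ch t\<close>.\<close>

lemma commuting_character_trivial:
  fixes M :: 'e and ch :: "'a \<Rightarrow> complex"
  assumes p: "of_nat p = w * c0" and N: "coprime N (p ^ l)"
    and t: "t \<in> D" "t \<in> unit_set" "t ^ N = 1"
    and M: "M \<noteq> 0" "\<And>g. g \<in> unit_set \<Longrightarrow> M * rho g = ch g \<odot> (rho g * M)"
    and ch: "\<And>Y. ch (1 + w * Y) = 1"
  shows "ch t = 1"
proof -
  let ?c = "\<lambda>A. k A * t * uinv (k A)"
  let ?B = "\<Sum>A\<in>UNIV. rho (?c A) * P"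
  have MK: "M * rho (1 + w ^ j * A) = rho (1 + w ^ j * A) * M" if "j \<ge> 1" for j A
  proof -
    have "ch (1 + w ^ j * A) = 1" using ch[of "w ^ (j - 1) * A"] that by (simp add: power_eq_if mult.assoc)
    then show ?thesis using M(2)[OF congruence_unit[OF that]] by simp
  qed
  have MP: "M * P = P * M"
    using a_bounds(2) MK[of a] by (simp add: iso_proj_def sum_distrib_left sum_distrib_right)
  have Mk': "M * rho (uinv (k A)) = rho (uinv (k A)) * M" for A
    using rho_uinv_commute[of "k A" M] MK[OF ab(4)] by simp
  have cu: "?c A \<in> unit_set" for A using t(2) by simp
  have cP: "rho (?c A) * P = P * rho (?c A)" for A
  proof -
    have "rho (uinv (k A)) * P = P * rho (uinv (k A))"
      by (rule rho_uinv_commute) (simp_all add: k_commute_P)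
    note U = this
    have e: "rho (?c A) = rho (k A) * rho t * rho (uinv (k A))" using t(2) by (simp add: rho_mult)
    have "rho (?c A) * P = rho (k A) * (rho t * (rho (uinv (k A)) * P))" unfolding e by (simp add: mult.assoc)
    also have "\<dots> = rho (k A) * (rho t * P) * rho (uinv (k A))" unfolding U by (simp add: mult.assoc)
    also have "\<dots> = (rho (k A) * P) * rho t * rho (uinv (k A))"
      unfolding D_commute_P[OF t(1,2)] by (simp add: mult.assoc)
    also have "\<dots> = P * rho (?c A)" unfolding k_commute_P e by (simp add: mult.assoc)
    finally show ?thesis .
  qed
  have 1: "?B = P * ?B" "?B = ?B * P"
  proof -
    have PP: "P * (P * X) = P * X" for X using iso_proj_idem[OF a_bounds, of Z] by (metis mult.assoc)
    show "?B = P * ?B" by (simp only: sum_distrib_left cP PP)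
    show "?B = ?B * P" by (simp only: sum_distrib_right mult.assoc iso_proj_idem[OF a_bounds])
  qed
  \<comment> \<open>Conjugation by a unit \<open>d\<close> of \<open>D\<close>, which commutes with
    \<open>t\<close>, and left translation by \<open>k X\<close> both permute the conjugates
    \<open>?c A\<close>. As these elements generate the stabilizer, the average is a scalar on the
    image of \<open>P\<close>.\<close>
  have comm: "rho g * ?B = ?B * rho g" if "g \<in> unit_set" "w ^ a * (g * Z - Z * g) = 0" for g
  proof (rule stabilizer_commute[OF _ _ that])
    fix d assume d: "d \<in> D" "d \<in> unit_set"
    show "rho d * ?B = ?B * rho d"
    proof (rule conj_sum_commute[where f = "\<lambda>A. d * A * uinv d"])
      show "d * ?c A = ?c (d * A * uinv d) * d" for A
      proof -
        let ?k' = "k (d * A * uinv d)"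
        have e: "d * k A = ?k' * d" by (rule congruence_conj[OF d(2)])
        have "uinv (k A) = uinv d * uinv ?k' * d"
        proof (rule uinv_unique)
          have "k A = uinv d * (d * k A)" using d by simp
          then have e2: "k A = uinv d * ?k' * d" unfolding e by (simp add: mult.assoc)
          show "k A * (uinv d * uinv ?k' * d) = 1"
            unfolding e2 using d k_unit[of "d * A * uinv d"] by (simp add: mult.assoc del: k_unit)
          show "uinv d * uinv ?k' * d * k A = 1"
            unfolding e2 using d k_unit[of "d * A * uinv d"] by (simp add: mult.assoc del: k_unit)
        qed
        then have "d * ?c A = (d * k A) * t * (uinv d * uinv ?k' * d)" by (simp add: mult.assoc)
        also have "\<dots> = ?k' * (d * t) * (uinv d * uinv ?k' * d)" unfolding e by (simp add: mult.assoc)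
        also have "d * t = t * d" by (rule D_comm[OF d(1) t(1)])
        finally show ?thesis using d by (simp add: mult.assoc)
      qed
      show "bij (\<lambda>A. d * A * uinv d)"
        by (rule bij_betw_byWitness[where f' = "\<lambda>A. uinv d * A * d"]) (use d in \<open>auto simp: mult.assoc\<close>)
    qed (use d D_commute_P cu in auto)
  next
    fix X
    show "rho (k X) * ?B = ?B * rho (k X)"
    proof (rule conj_sum_commute[where f = "\<lambda>A. X + k X * A"])
      show "k X * ?c A = ?c (X + k X * A) * k X" for A
        unfolding congruence_mult_general[symmetric] by (simp add: uinv_mult mult.assoc)
      show "bij (\<lambda>A. X + k X * A)"
        by (rule bij_betw_byWitness[where f' = "\<lambda>A. uinv (k X) * (A - X)"]) auto
    qed (use k_commute_P cu in auto)
  qed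
  from schur_corner[OF a_bounds 1 comm] obtain c where c: "?B = c \<odot> P" by blast
  have c0: "c \<noteq> 0" using conj_average_nonzero[OF p N t] c by (metis scl_zero_left)
  \<comment> \<open>If \<open>M\<close> killed \<open>P\<close> it would kill all conjugates of
    \<open>P\<close>, since it intertwines up to scalars; but these conjugates add up to a nonzero
    scalar, by the second conclusion of \<open>schur_corner\<close> for
    \<open>B = P\<close>.\<close>
  have MPn: "M * P \<noteq> 0"
  proof
    assume z: "M * P = 0"
    have PP: "P = P * P" using iso_proj_idem[OF a_bounds] by simp
    have Pc: "rho g * P = P * rho g" if "g \<in> unit_set" "w ^ a * (g * Z - Z * g) = 0" for g
      using iso_proj_commute a_bounds that by blast
    from schur_corner[OF a_bounds PP PP Pc] obtain c' n where c': "P = c' \<odot> P" "n > 0"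
      "(\<Sum>g\<in>unit_set. rho g * P * rho (uinv g)) = (of_nat n * c') \<odot> 1" by blast
    have "c' = 1" using c'(1) scl_eq_imp[of 1 P c'] proj_nonzero by auto
    have "M * (rho g * P * rho (uinv g)) = 0" if "g \<in> unit_set" for g
    proof -
      have "M * (rho g * P * rho (uinv g)) = (M * rho g) * P * rho (uinv g)" by (simp add: mult.assoc)
      also have "\<dots> = ch g \<odot> (rho g * (M * P) * rho (uinv g))" unfolding M(2)[OF that] by (simp add: mult.assoc)
      finally show ?thesis by (simp add: z)
    qed
    then have "M * (\<Sum>g\<in>unit_set. rho g * P * rho (uinv g)) = 0" by (simp add: sum_distrib_left)
    then have "of_nat n \<odot> M = 0" unfolding c'(3) \<open>c' = 1\<close> by simp
    then show False using c'(2) M(1) by (simp only: scl_eq_0) simp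
  qed
  have Mc: "M * rho (?c A) = ch t \<odot> (rho (?c A) * M)" for A
  proof -
    have "M * rho (?c A) = (M * rho (k A)) * rho t * rho (uinv (k A))"
      using t(2) by (simp add: rho_mult mult.assoc)
    also have "\<dots> = rho (k A) * (M * rho t) * rho (uinv (k A))" unfolding MK[OF ab(4)] by (simp add: mult.assoc)
    also have "\<dots> = ch t \<odot> (rho (k A) * rho t * (M * rho (uinv (k A))))"
      unfolding M(2)[OF t(2)] by (simp add: mult.assoc)
    also have "\<dots> = ch t \<odot> (rho (?c A) * M)" unfolding Mk' using t(2) by (simp add: rho_mult mult.assoc)
    finally show ?thesis .
  qed
  have "M * ?B = ch t \<odot> (?B * M)"
  proof -
    have "M * (rho (?c A) * P) = ch t \<odot> (rho (?c A) * P * M)" for A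
      unfolding mult.assoc[symmetric] Mc by (simp add: mult.assoc MP)
    then show ?thesis by (simp add: sum_distrib_left sum_distrib_right scl_sum_right)
  qed
  then have "c \<odot> (M * P) = ch t \<odot> c \<odot> (M * P)"
    by (simp only: c MP scl_mult_left scl_mult_right)
  then have "c \<odot> (M * P) = c \<odot> ch t \<odot> (M * P)" by (metis scl_scl mult.commute)
  then have "1 \<odot> (M * P) = ch t \<odot> (M * P)" using c0 scl_cancel by (metis scl_one)
  then show ?thesis using scl_eq_imp MPn by metis
qed

end

end

section \<open>Square matrices as a ring type\<close>

text \<open>A separate type is needed because the ring operations of \<^typ>\<open>'a ^ 'n ^ 'n\<close> are componentwise.\<close>

typedef ('a, 'n) sq = "UNIV :: ('a ^ 'n ^ 'n) set"
  morphisms of_sq to_sq by simp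

lemma of_sq_to_sq [simp]: "of_sq (to_sq A) = A"
  by (simp add: to_sq_inverse)

lemma to_sq_of_sq [simp]: "to_sq (of_sq A) = A"
  by (rule of_sq_inverse)

lemma sq_eq_iff: "A = B \<longleftrightarrow> of_sq A = of_sq B"
  by (simp add: of_sq_inject)

lemma matrix_add_rdistrib: "(A + B) ** C = A ** C + B ** (C :: 'a::semiring_1 ^ 'n ^ 'm)"
  by (vector matrix_matrix_mult_def sum.distrib distrib_right)

instantiation sq :: (ring_1, finite) ring_1
begin
definition "0 = to_sq 0"
definition "1 = to_sq (mat 1)"
definition "A + B = to_sq (of_sq A + of_sq B)"
definition "A - B = to_sq (of_sq A - of_sq B)"
definition "- A = to_sq (- of_sq A)"
definition "A * B = to_sq (of_sq A ** of_sq B)"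
instance
proof
  show "(0 :: ('a, 'b) sq) \<noteq> 1"
  proof
    assume "(0 :: ('a, 'b) sq) = 1"
    then have "(0 :: 'a ^ 'b ^ 'b) = mat 1"
      by (simp add: zero_sq_def one_sq_def sq_eq_iff)
    then have "0 $ i $ i = (mat 1 :: 'a ^ 'b ^ 'b) $ i $ i" for i by (simp only:)
    then show False by (simp add: mat_def)
  qed
qed (simp_all add: zero_sq_def one_sq_def plus_sq_def minus_sq_def uminus_sq_def times_sq_def
    sq_eq_iff matrix_mul_assoc matrix_add_ldistrib matrix_add_rdistrib)
end

instance sq :: (finite, finite) finite
proof
  have "(UNIV :: ('a, 'b) sq set) = to_sq ` UNIV"
    by (metis UNIV_eq_I rangeI to_sq_of_sq)
  then show "finite (UNIV :: ('a, 'b) sq set)" by (metis finite_class.finite_UNIV finite_imageI)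
qed

lemma of_sq_simps [simp]:
  "of_sq 0 = 0" "of_sq 1 = mat 1" "of_sq (A + B) = of_sq A + of_sq B"
  "of_sq (A - B) = of_sq A - of_sq B" "of_sq (- A) = - of_sq A" "of_sq (A * B) = of_sq A ** of_sq B"
  by (simp_all add: zero_sq_def one_sq_def plus_sq_def minus_sq_def uminus_sq_def times_sq_def)

lemma of_sq_sum: "of_sq (sum f S) = (\<Sum>x\<in>S. of_sq (f x))"
  by (induction S rule: infinite_finite_induct) simp_all

lemma of_sq_power: "of_sq (A ^ n) = matpow (of_sq A) n"
  by (induction n) simp_all

definition smat :: "'a::ring_1 \<Rightarrow> ('a, 'n::finite) sq" where
  "smat c = to_sq (mat c)"

definition sdet :: "('a::comm_ring_1, 'n::finite) sq \<Rightarrow> 'a" where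
  "sdet A = det (of_sq A)"

definition smap :: "('a \<Rightarrow> 'b) \<Rightarrow> ('a, 'n::finite) sq \<Rightarrow> ('b, 'n) sq" where
  "smap f A = to_sq (matmap f (of_sq A))"

lemma of_sq_smat [simp]: "of_sq (smat c) = mat c"
  by (simp add: smat_def)

lemma of_sq_smap_nth [simp]: "of_sq (smap f A) $ i $ j = f (of_sq A $ i $ j)"
  by (simp add: smap_def matmap_def)

lemma sq_eqI: "(\<And>i j. of_sq A $ i $ j = of_sq B $ i $ j) \<Longrightarrow> A = B"
  by (simp add: sq_eq_iff vec_eq_iff)

lemma of_sq_mult_nth: "of_sq (A * B) $ i $ j = (\<Sum>k\<in>UNIV. of_sq A $ i $ k * of_sq B $ k $ j)"
  by (simp add: matrix_matrix_mult_def)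

lemma smat_mult_nth [simp]:
  fixes A :: "('a::comm_ring_1, 'n::finite) sq"
  shows "of_sq (smat c * A) $ i $ j = c * of_sq A $ i $ j"
  by (simp add: of_sq_mult_nth mat_def if_distrib[of "\<lambda>x. x * _"] del: of_sq_simps(6) cong: if_cong)

lemma smat_add: "smat (a + b) = smat a + smat b"
  by (rule sq_eqI) (simp add: mat_def)

lemma smat_mult: "smat (a * b) = smat a * (smat b :: ('a::comm_ring_1, 'n::finite) sq)"
  by (rule sq_eqI) (simp add: mat_def del: of_sq_simps)

lemma smat_0 [simp]: "smat 0 = 0"
  by (rule sq_eqI) (simp add: mat_def)

lemma smat_1 [simp]: "smat 1 = 1"
  by (rule sq_eqI) simp

lemma smat_central:
  fixes A :: "('a::comm_ring_1, 'n::finite) sq"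
  shows "smat c * A = A * smat c"
proof (rule sq_eqI)
  fix i j
  have "of_sq (A * smat c) $ i $ j = (\<Sum>k\<in>UNIV. if k = j then of_sq A $ i $ k * c else 0)"
    unfolding of_sq_mult_nth by (rule sum.cong) (auto simp: mat_def)
  then show "of_sq (smat c * A) $ i $ j = of_sq (A * smat c) $ i $ j"
    by (simp add: mult.commute del: of_sq_simps)
qed

lemma smat_left_commute:
  fixes A :: "('a::comm_ring_1, 'n::finite) sq"
  shows "A * (smat c * B) = smat c * (A * B)"
  by (subst (1 2) mult.assoc[symmetric]) (simp only: smat_central)

lemma smat_power: "smat (c ^ n) = (smat c :: ('a::comm_ring_1, 'n::finite) sq) ^ n"
  by (induction n) (simp_all add: smat_mult)

lemma of_nat_sq: "(of_nat n :: ('a::comm_ring_1, 'n::finite) sq) = smat (of_nat n)"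
  by (induction n) (simp_all add: smat_add)

lemma sdet_mult: "sdet (A * B) = sdet A * sdet B"
  by (simp add: sdet_def det_mul)

lemma sdet_1 [simp]: "sdet 1 = 1"
  by (simp add: sdet_def)

lemma sdet_power: "sdet (A ^ n) = sdet A ^ n"
  by (induction n) (simp_all add: sdet_mult)

lemma sdet_smat: "sdet (smat c :: ('a::comm_ring_1, 'n::finite) sq) = c ^ CARD('n)"
  unfolding sdet_def of_sq_smat by (subst det_diagonal) (simp_all add: mat_def)

lemma is_ring_homD:
  assumes "is_ring_hom f"
  shows "f (a + b) = f a + f b" "f (a * b) = f a * f b" "f 1 = 1" "f 0 = 0" "f (- a) = - f a" "f (a - b) = f a - f b"
proof -
  show add: "f (a + b) = f a + f b" "f (a * b) = f a * f b" "f 1 = 1" for a b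
    using assms by (auto simp: is_ring_hom_def)
  from add(1)[of 0 0] show 0: "f 0 = 0" by simp
  show neg: "f (- a) = - f a" for a using add(1)[of a "- a"] 0 by (simp add: eq_neg_iff_add_eq_0 add.commute)
  show "f (a - b) = f a - f b" using add(1)[of a "- b"] neg by simp
qed

lemma is_ring_hom_sum: "is_ring_hom f \<Longrightarrow> f (sum g S) = (\<Sum>x\<in>S. f (g x))"
  by (induction S rule: infinite_finite_induct) (simp_all add: is_ring_homD)

lemma is_ring_hom_prod: "is_ring_hom f \<Longrightarrow> f (prod g S) = (\<Prod>x\<in>S. f (g x))"
  by (induction S rule: infinite_finite_induct) (simp_all add: is_ring_homD)

lemma is_ring_hom_power: "is_ring_hom f \<Longrightarrow> f (a ^ n) = f a ^ n"
  by (induction n) (simp_all add: is_ring_homD)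

lemma is_ring_hom_of_nat: "is_ring_hom f \<Longrightarrow> f (of_nat n) = of_nat n"
  by (induction n) (simp_all add: is_ring_homD)

lemma det_matmap:
  assumes "is_ring_hom f"
  shows "det (matmap f A) = f (det A)"
proof -
  have "f (of_int (sign p)) = of_int (sign p)" for p :: "'c \<Rightarrow> 'c"
    by (cases p rule: sign_cases) (simp_all add: is_ring_homD[OF assms])
  then show ?thesis
    by (simp add: det_def matmap_def is_ring_hom_sum[OF assms] is_ring_hom_prod[OF assms] is_ring_homD[OF assms])
qed

lemma smap_hom:
  assumes "is_ring_hom f"
  shows "smap f (A + B) = smap f A + smap f B" "smap f (A * B) = smap f A * smap f B"
    "smap f 1 = 1" "smap f 0 = 0" "smap f (- A) = - smap f A" "smap f (A - B) = smap f A - smap f B"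
    "smap f (smat c) = smat (f c)"
  by (rule sq_eqI; simp add: is_ring_homD[OF assms] is_ring_hom_sum[OF assms] of_sq_mult_nth mat_def del: of_sq_simps(6))+

lemma sdet_smap: "is_ring_hom f \<Longrightarrow> sdet (smap f A) = f (sdet A)"
  by (simp add: sdet_def smap_def det_matmap)

subsection \<open>Polynomials in a matrix\<close>

text \<open>Horner evaluation over an arbitrary commutative ring: the same polynomial has to be
  evaluated over the chain ring, the residue field and its algebraic closure, whereas
  \<open>poly_mat\<close> is stated over fields.\<close>

definition peval :: "'a::comm_ring_1 poly \<Rightarrow> ('a, 'n::finite) sq \<Rightarrow> ('a, 'n) sq" where
  "peval p A = fold_coeffs (\<lambda>a B. smat a + A * B) p 0"

lemma peval_0 [simp]: "peval 0 A = 0"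
  by (simp add: peval_def)

lemma peval_pCons [simp]: "peval (pCons a p) A = smat a + A * peval p A"
  by (cases "p = 0 \<and> a = 0") (auto simp: peval_def)

lemma peval_add: "peval (p + q) A = peval p A + peval q A"
proof (induction p arbitrary: q)
  case (pCons a p)
  then show ?case by (cases q) (simp add: smat_add algebra_simps)
qed simp

lemma peval_smult: "peval (smult c p) A = smat c * peval p A"
proof (induction p)
  case (pCons a p)
  have sc: "A * (smat c * peval p A) = smat c * (A * peval p A)"
    by (rule smat_left_commute)
  show ?case by (simp add: pCons.IH smat_mult distrib_left sc)
qed simp

lemma peval_mult: "peval (p * q) A = peval p A * peval q A"
  by (induction p) (simp_all add: peval_add peval_smult algebra_simps)

lemma peval_1 [simp]: "peval 1 A = 1"
  by (simp add: one_pCons)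

lemma peval_uminus: "peval (- p) A = - peval p A"
  using peval_add[of p "- p" A] by (simp add: eq_neg_iff_add_eq_0 add.commute)

lemma peval_diff: "peval (p - q) A = peval p A - peval q A"
  using peval_add[of p "- q" A] by (simp add: peval_uminus)

lemma peval_power: "peval (p ^ n) A = peval p A ^ n"
  by (induction n) (simp_all add: peval_mult)

lemma peval_commute_base: "peval p A * A = A * peval p A"
proof (induction p)
  case (pCons a p)
  then show ?case by (simp add: distrib_left distrib_right mult.assoc smat_central)
qed simp

lemma peval_commute: "peval p A * peval q A = peval q A * peval p A"
  by (metis mult.commute peval_mult)

lemma commute_peval: "B * A = A * B \<Longrightarrow> B * peval p A = peval p A * B"
proof (induction p)
  case (pCons a p)
  have "B * (A * peval p A) = A * (peval p A * B)"
    by (metis mult.assoc pCons.IH pCons.prems)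
  then show ?case by (simp add: distrib_left distrib_right mult.assoc smat_central)
qed simp

lemma smap_peval:
  assumes "is_ring_hom f"
  shows "smap f (peval p A) = peval (map_poly f p) (smap f A)"
proof (induction p)
  case (pCons a p)
  then show ?case by (simp add: smap_hom[OF assms] map_poly_pCons is_ring_homD[OF assms])
qed (simp add: smap_hom[OF assms])

lemma peval_altdef: "peval p A = (\<Sum>i\<le>degree p. smat (coeff p i) * A ^ i)"
proof -
  have "peval p A = (\<Sum>i\<le>n. smat (coeff p i) * A ^ i)" if "degree p \<le> n" for n
    using that
  proof (induction p arbitrary: n)
    case (pCons a p)
    show ?case
    proof (cases n)
      case 0
      then have "p = 0" using pCons.prems by (metis bot_nat_0.extremum_uniqueI degree_pCons_eq nat.distinct(1))
      then show ?thesis using 0 by simp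
    next
      case (Suc m)
      then have "degree p \<le> m" using pCons.prems by (cases "p = 0") auto
      then have "A * peval p A = (\<Sum>i\<le>m. A * (smat (coeff p i) * A ^ i))"
        by (simp add: pCons.IH sum_distrib_left)
      also have "\<dots> = (\<Sum>i\<le>m. smat (coeff p i) * A ^ Suc i)"
        by (metis (no_types, opaque_lifting) mult.assoc power_Suc smat_central)
      finally show ?thesis unfolding Suc sum.atMost_Suc_shift by simp
    qed
  qed simp
  then show ?thesis by blast
qed

lemma poly_mat_eq_peval: "poly_mat p A = of_sq (peval p (to_sq A))"
  by (simp add: poly_mat_def peval_altdef of_sq_sum of_sq_power)

lemma sdet_linear:
  fixes A :: "('a::field, 'n::finite) sq"
  shows "sdet (smat b - A) = poly (charpoly (of_sq A)) b"
proof -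
  have h: "is_ring_hom (\<lambda>p. poly p b)" by (simp add: is_ring_hom_def)
  have "of_sq (smat b - A) = matmap (\<lambda>p. poly p b) (\<chi> i j. (if i = j then [:0, 1:] else 0) - [:of_sq A $ i $ j:])"
    by (auto simp: vec_eq_iff matmap_def mat_def)
  then show ?thesis unfolding sdet_def charpoly_def by (simp add: det_matmap[OF h])
qed

lemma is_ring_hom_map_poly: "is_ring_hom f \<Longrightarrow> is_ring_hom (map_poly f)"
  unfolding is_ring_hom_def[of "map_poly f"]
proof (intro conjI allI)
  assume f: "is_ring_hom f"
  note h = is_ring_homD[OF f]
  show "map_poly f 1 = 1" by (simp add: h one_pCons map_poly_pCons)
  show "map_poly f (p + q) = map_poly f p + map_poly f q" for p q
    by (rule poly_eqI) (simp add: coeff_map_poly h)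
  show "map_poly f (p * q) = map_poly f p * map_poly f q" for p q
    by (rule poly_eqI) (simp add: coeff_map_poly coeff_mult h is_ring_hom_sum[OF f])
qed

lemma charpoly_matmap:
  fixes f :: "'a::field \<Rightarrow> 'b::field"
  assumes "is_ring_hom f"
  shows "charpoly (matmap f A) = map_poly f (charpoly A)"
proof -
  note h = is_ring_homD[OF assms]
  have "(\<chi> i j. (if i = j then [:0, 1:] else 0) - [:matmap f A $ i $ j:])
      = matmap (map_poly f) (\<chi> i j. (if i = j then [:0, 1:] else 0) - [:A $ i $ j:])"
    by (auto simp: vec_eq_iff matmap_def map_poly_pCons h is_ring_homD[OF is_ring_hom_map_poly[OF assms]])
  then show ?thesis unfolding charpoly_def by (simp add: det_matmap[OF is_ring_hom_map_poly[OF assms]])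
qed

text \<open>In the Leibniz expansion every permutation other than the identity uses a constant
  off-diagonal entry, so its term has degree below n; the identity gives a product of n monic linear
  factors.\<close>

lemma charpoly_monic: "degree (charpoly (A :: 'a::field ^ 'n ^ 'n)) = CARD('n) \<and> lead_coeff (charpoly A) = 1"
proof -
  let ?M = "(\<chi> i j. (if i = j then [:0, 1:] else 0) - [:A $ i $ j:]) :: 'a poly ^ 'n ^ 'n"
  let ?t = "\<lambda>p. of_int (sign p) * (\<Prod>i\<in>UNIV. ?M $ i $ p i)"
  let ?PU = "{p. p permutes (UNIV :: 'n set)}"
  have deg: "degree (?t p) < CARD('n)" if p: "p \<in> ?PU - {id}" for p
  proof -
    from p obtain i where i: "p i \<noteq> i" by (metis DiffD2 eq_id_iff singletonI)
    have "degree (of_int (sign p) * q) \<le> degree q" for q :: "'a poly"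
      by (cases p rule: sign_cases) simp_all
    then have "degree (?t p) \<le> degree (\<Prod>i\<in>UNIV. ?M $ i $ p i)" .
    also have "\<dots> \<le> (\<Sum>j\<in>UNIV. degree (?M $ j $ p j))" using degree_prod_sum_le[of UNIV "\<lambda>i. ?M $ i $ p i"] by (simp add: o_def)
    also have "\<dots> \<le> (\<Sum>j\<in>UNIV. if j = i then 0 else 1)"
      by (rule sum_mono) (use i in auto)
    also have "\<dots> < CARD('n)"
    proof -
      have "(\<Sum>j\<in>UNIV. if j = i then 0 else 1::nat) = (\<Sum>j\<in>UNIV - {i}. 1)"
        by (rule sum.mono_neutral_cong_right) auto
      also have "\<dots> = CARD('n) - 1" by simp
      finally show ?thesis by simp
    qed
    finally show ?thesis .
  qed
  have fin: "finite ?PU" by simp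
  have "charpoly A = (\<Sum>p\<in>?PU. ?t p)" by (simp add: charpoly_def det_def)
  also have "\<dots> = ?t id + (\<Sum>p\<in>?PU - {id}. ?t p)"
    by (rule sum.remove[OF fin]) (simp add: permutes_id)
  finally have e: "charpoly A = (\<Prod>i\<in>UNIV. [:- (A $ i $ i), 1:]) + (\<Sum>p\<in>?PU - {id}. ?t p)"
    by (simp add: sign_id)
  have lt: "degree (\<Sum>p\<in>?PU - {id}. ?t p) < CARD('n)"
    by (rule degree_sum_less) (use deg in auto)
  have d1: "degree (\<Prod>i\<in>(UNIV::'n set). [:- (A $ i $ i), 1:]) = CARD('n)"
    by (subst degree_prod_eq_sum_degree) auto
  have d2: "lead_coeff (\<Prod>i\<in>(UNIV::'n set). [:- (A $ i $ i), 1:]) = 1"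
    by (simp add: lead_coeff_prod)
  have d: "degree (charpoly A) = CARD('n)"
    unfolding e d1[symmetric] by (rule degree_add_eq_left) (use lt d1 in simp)
  have "coeff (charpoly A) CARD('n) = 1"
    unfolding e coeff_add using d2 coeff_eq_0[OF lt] by (simp add: d1)
  then show ?thesis using d by simp
qed

section \<open>Regular matrices over a finite field\<close>

lemma poly_ideal_principal:
  fixes I :: "'k::field poly set"
  assumes p: "p \<in> I" "p \<noteq> 0"
    and add: "\<And>a b. a \<in> I \<Longrightarrow> b \<in> I \<Longrightarrow> a + b \<in> I" and mult: "\<And>a c. a \<in> I \<Longrightarrow> c * a \<in> I"
  obtains g where "g \<in> I" "lead_coeff g = 1" "\<And>a. a \<in> I \<Longrightarrow> g dvd a"
proof -
  obtain g0 where g0: "g0 \<in> I \<and> g0 \<noteq> 0" "\<And>a. a \<in> I \<and> a \<noteq> 0 \<Longrightarrow> degree g0 \<le> degree a"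
    using ex_has_least_nat[of "\<lambda>a. a \<in> I \<and> a \<noteq> 0" p degree] p by blast
  let ?g = "smult (inverse (lead_coeff g0)) g0"
  have g: "?g \<in> I" "?g \<noteq> 0" "lead_coeff ?g = 1" "degree ?g = degree g0"
    using g0(1) mult[of g0 "[:inverse (lead_coeff g0):]"] by auto
  have "?g dvd a" if "a \<in> I" for a
  proof -
    have "a mod ?g = a + - (a div ?g) * ?g" by (metis add_uminus_conv_diff minus_div_mult_eq_mod mult_minus_left)
    then have "a mod ?g \<in> I" using add mult that g(1) by metis
    moreover have "degree (a mod ?g) < degree ?g \<or> a mod ?g = 0"
      using degree_mod_less[OF g(2)] by blast
    ultimately have "a mod ?g = 0" using g0(2)[of "a mod ?g"] g(4) by fastforce
    then show ?thesis by (simp only: dvd_eq_mod_eq_0)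
  qed
  then show ?thesis using that g by blast
qed

lemma monic_dvd_antisym:
  fixes p q :: "'k::field poly"
  assumes "lead_coeff p = 1" "lead_coeff q = 1" "p dvd q" "q dvd p"
  shows "p = q"
proof -
  obtain r where r: "q = p * r" using assms(3) by (auto simp: dvd_def)
  have nz: "p \<noteq> 0" "q \<noteq> 0" using assms(1,2) by auto
  have "degree p = degree q" using assms(3,4) nz by (simp add: dvd_imp_degree_le order_antisym)
  moreover have "r \<noteq> 0" using r nz by auto
  ultimately have "degree r = 0" using r nz by (simp add: degree_mult_eq)
  then obtain c where c: "r = [:c:]" by (rule degree_eq_zeroE)
  have "lead_coeff q = lead_coeff p * lead_coeff r" unfolding r by (rule lead_coeff_mult)
  then have "c = 1" using assms c by simp
  then show ?thesis using r c by (simp add: one_pCons[symmetric])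
qed

lemma prime_power_cancel:
  fixes f :: "'a::idom"
  assumes "prime_elem f" "\<not> f dvd d" "f ^ e dvd d * c"
  shows "f ^ e dvd c"
  using assms(3)
proof (induction e arbitrary: c)
  case (Suc e)
  then have "f dvd d * c" by (metis dvd_mult_left power_Suc)
  then obtain c' where c': "c = f * c'" using assms(1,2) by (auto simp: prime_elem_dvd_mult_iff)
  obtain r where "d * c = f ^ Suc e * r" using Suc.prems by (rule dvdE)
  then have "f * (d * c') = f * (f ^ e * r)" unfolding c' by (simp add: ac_simps)
  moreover have "f \<noteq> 0" using assms(1) by (auto simp: prime_elem_def)
  ultimately have "d * c' = f ^ e * r" using mult_left_cancel by blast
  then have "f ^ e dvd d * c'" by simp
  then have "f ^ e dvd c'" by (rule Suc.IH)
  then show ?case unfolding c' power_Suc by (rule mult_dvd_mono[OF dvd_refl])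
qed simp

lemma monic_irreducible_dvd_prod:
  fixes f :: "'k::field poly"
  assumes "finite S" "lead_coeff f = 1" "irreducible f"
    and "\<And>g. g \<in> S \<Longrightarrow> lead_coeff g = 1 \<and> irreducible g" "f \<notin> S"
  shows "\<not> f dvd (\<Prod>g\<in>S. g ^ e g)"
proof
  assume d: "f dvd (\<Prod>g\<in>S. g ^ e g)"
  have pr: "prime_elem f" using assms by (simp add: field_poly_irreducible_imp_prime)
  from assms(1) d have "\<exists>g\<in>S. f dvd g ^ e g"
  proof (induction S rule: finite_induct)
    case empty
    then show ?case using pr by (simp add: prime_elem_def)
  next
    case (insert g S)
    then show ?case using pr by (auto simp: prime_elem_dvd_mult_iff)
  qed
  then obtain g where g: "g \<in> S" "f dvd g ^ e g" by blast
  then have fg: "f dvd g" using pr prime_elem_dvd_power by blast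
  have "irreducible g" using g assms by blast
  moreover have "\<not> is_unit f" using pr by (simp add: prime_elem_def)
  ultimately have "g dvd f" using fg irreducibleD' by blast
  then have "f = g" using fg g assms by (intro monic_dvd_antisym) auto
  then show False using g assms by simp
qed

lemma monic_poly_factorization:
  fixes p :: "'k::field poly"
  assumes "lead_coeff p = 1"
  obtains F e where "finite F" "\<And>f. f \<in> F \<Longrightarrow> lead_coeff f = 1 \<and> irreducible f \<and> e f > 0"
    "p = (\<Prod>f\<in>F. f ^ e f)"
proof -
  have p0: "p \<noteq> 0" using assms by auto
  have "\<exists>M. (\<forall>f. f \<in># M \<longrightarrow> prime_elem f) \<and> prod_mset M = p"
    using field_poly_prod_mset_prime_factorization[OF p0] field_poly_in_prime_factorization_imp_prime[of _ p] assms
    by auto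
  then obtain M where M: "\<And>f. f \<in># M \<Longrightarrow> prime_elem f" "prod_mset M = p" by blast
  define nrm where "nrm f = smult (inverse (lead_coeff f)) f" for f :: "'k poly"
  have nrm: "lead_coeff (nrm f) = 1 \<and> irreducible (nrm f)" if "prime_elem f" for f
  proof -
    have f0: "f \<noteq> 0" using that by (auto simp: prime_elem_def)
    have "nrm f = [:inverse (lead_coeff f):] * f" by (simp add: nrm_def)
    moreover have "is_unit [:inverse (lead_coeff f):]" using f0 by (auto simp: is_unit_const_poly_iff intro!: dvd_field_iff[THEN iffD2])
    ultimately have "prime_elem (nrm f)" using that prime_elem_mult_unit_left by metis
    then have "irreducible (nrm f)" by (rule prime_elem_imp_irreducible)
    moreover have "lead_coeff (nrm f) = 1" using f0 by (simp add: nrm_def)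
    ultimately show ?thesis by blast
  qed
  let ?N = "image_mset nrm M"
  have "\<exists>c. prod_mset M = smult c (prod_mset ?N) \<and> lead_coeff (prod_mset ?N) = 1"
    using M(1)
  proof (induction M)
    case empty
    then show ?case by (intro exI[of _ 1]) simp
  next
    case (add f M)
    then obtain c where c: "prod_mset M = smult c (prod_mset (image_mset nrm M))"
      "lead_coeff (prod_mset (image_mset nrm M)) = 1" by auto
    have f: "prime_elem f" using add.prems by simp
    then have "f = smult (lead_coeff f) (nrm f)" by (auto simp: nrm_def prime_elem_def)
    then have "prod_mset (add_mset f M) = smult (lead_coeff f * c) (prod_mset (image_mset nrm (add_mset f M)))"
    proof -
      have "prod_mset (add_mset f M) = smult (lead_coeff f) (nrm f) * smult c (prod_mset (image_mset nrm M))"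
        using c(1) \<open>f = _\<close> by simp
      then show ?thesis by (simp add: mult.commute)
    qed
    moreover have "lead_coeff (prod_mset (image_mset nrm (add_mset f M))) = 1"
      using c(2) nrm[OF f] by (simp add: lead_coeff_mult)
    ultimately show ?case by blast
  qed
  then obtain c where c: "p = smult c (prod_mset ?N)" "lead_coeff (prod_mset ?N) = 1" unfolding M(2) by blast
  then have "lead_coeff p = c * 1" by (metis lead_coeff_smult)
  then have "c = 1" using assms by simp
  then have "p = prod_mset ?N" using c(1) by (simp only: smult_1_left)
  then have e: "p = (\<Prod>f\<in>set_mset ?N. f ^ count ?N f)" by (simp add: prod_mset_multiplicity)
  have "lead_coeff f = 1 \<and> irreducible f \<and> count ?N f > 0" if "f \<in># ?N" for f
  proof -
    have c: "count ?N f > 0" using that by simp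
    have "f \<in> nrm ` set_mset M" using that by simp
    then obtain g where "g \<in># M" "f = nrm g" by blast
    then show ?thesis using nrm M(1) c by blast
  qed
  with e show ?thesis by (intro that[of "set_mset ?N" "count ?N"]) auto
qed

lemma monic_irreducible_degree_pos:
  fixes f :: "'k::field poly"
  assumes "lead_coeff f = 1" "irreducible f"
  shows "degree f > 0"
proof (rule ccontr)
  assume "\<not> degree f > 0"
  then have "f = [:1:]" using assms(1) by (metis degree_eq_zeroE lead_coeff_pCons(2) neq0_conv)
  then show False using assms(2) by (simp add: one_pCons[symmetric])
qed

subsection \<open>Cyclic vectors\<close>

definition act :: "('k::field, 'n::finite) sq \<Rightarrow> 'k poly \<Rightarrow> 'k ^ 'n \<Rightarrow> 'k ^ 'n" where
  "act X p v = of_sq (peval p X) *v v"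

lemma act_add: "act X (p + q) v = act X p v + act X q v"
  by (simp add: act_def peval_add matrix_vector_mult_add_rdistrib)

lemma act_mult: "act X (p * q) v = act X p (act X q v)"
  by (simp add: act_def peval_mult matrix_vector_mul_assoc)

lemma act_mult': "act X (p * q) v = act X q (act X p v)"
  by (metis act_mult mult.commute)

lemma act_right_add: "act X p (v + w) = act X p v + act X p w"
  by (simp add: act_def matrix_vector_right_distrib)

lemma act_zero [simp]: "act X p 0 = 0" "act X 0 v = 0" "act X 1 v = v"
  by (simp_all add: act_def)

lemma act_diff: "act X (p - q) v = act X p v - act X q v"
  using act_add[of X "p - q" q v] by simp

lemma exists_annihilator:
  fixes X :: "('k::{field,finite}, 'n::finite) sq"
  obtains p where "p \<noteq> 0" "peval p X = 0"
proof -
  have "\<not> inj (\<lambda>n::nat. X ^ n)"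
    using finite_imageD[of "\<lambda>n::nat. X ^ n" UNIV] by auto
  then obtain i j where ij: "i < j" "X ^ i = X ^ j"
    unfolding inj_def by (metis linorder_neqE_nat)
  have x: "peval ([:0, 1:] ^ n) X = X ^ n" for n by (simp add: peval_power)
  let ?p = "[:0, 1:] ^ j - [:0, 1:] ^ i :: 'k poly"
  have "peval ?p X = 0" using ij by (simp only: peval_diff x) simp
  moreover have "?p \<noteq> 0"
  proof
    assume "?p = 0"
    then have "degree ([:0, 1:] ^ j :: 'k poly) = degree ([:0, 1:] ^ i :: 'k poly)" by simp
    then show False using ij by (simp add: degree_power_eq)
  qed
  ultimately show ?thesis using that by blast
qed

text \<open>\<open>minpoly\<close> is a definite description, so a witness is needed: the monic
  generator of the ideal of annihilating polynomials. The ideal is nonzero because a matrix over a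
  finite field has two equal powers.\<close>

lemma minpoly_properties:
  fixes X :: "('k::{field,finite}, 'n::finite) sq"
  shows "lead_coeff (minpoly (of_sq X)) = 1" "peval (minpoly (of_sq X)) X = 0"
    "peval q X = 0 \<Longrightarrow> minpoly (of_sq X) dvd q"
proof -
  let ?Q = "\<lambda>p. lead_coeff p = 1 \<and> poly_mat p (of_sq X) = 0 \<and> (\<forall>q. poly_mat q (of_sq X) = 0 \<longrightarrow> p dvd q)"
  have pm: "poly_mat p (of_sq X) = 0 \<longleftrightarrow> peval p X = 0" for p
    by (simp add: poly_mat_eq_peval sq_eq_iff)
  obtain p where p: "p \<noteq> 0" "peval p X = 0" by (rule exists_annihilator)
  obtain g where g: "g \<in> {q. peval q X = 0}" "lead_coeff g = 1" "\<And>a. a \<in> {q. peval q X = 0} \<Longrightarrow> g dvd a"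
    by (rule poly_ideal_principal[of p "{q. peval q X = 0}"]) (use p in \<open>auto simp: peval_add peval_mult\<close>)
  have "?Q (minpoly (of_sq X))"
    unfolding minpoly_def
  proof (rule theI)
    show "?Q g" using g by (simp add: pm)
    show "h = g" if "?Q h" for h using that g by (intro monic_dvd_antisym) (auto simp: pm)
  qed
  then show "lead_coeff (minpoly (of_sq X)) = 1" "peval (minpoly (of_sq X)) X = 0"
    "peval q X = 0 \<Longrightarrow> minpoly (of_sq X) dvd q" by (simp_all add: pm)
qed

text \<open>\<open>d\<close> generates the annihilator of \<open>v\<close> in the polynomial ring
  acting through \<open>X\<close>, in analogy with the order of an element of an abelian
  group.\<close>

definition has_order :: "('k::field, 'n::finite) sq \<Rightarrow> 'k ^ 'n \<Rightarrow> 'k poly \<Rightarrow> bool" where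
  "has_order X v d \<longleftrightarrow> (\<forall>q. act X q v = 0 \<longleftrightarrow> d dvd q)"

text \<open>A vector \<open>w\<close> not killed by the minimal polynomial with one factor
  \<open>f\<close> removed has an annihilator divisible by \<open>f ^ e\<close>; applying
  \<open>Q\<close> to it strips the part prime to \<open>f\<close>.\<close>

lemma has_order_prime_power:
  fixes X :: "('k::{field,finite}, 'n::finite) sq"
  assumes m: "minpoly (of_sq X) = f ^ e * Q" and f: "prime_elem f" "\<not> f dvd Q" and e: "e > 0"
  obtains v where "has_order X v (f ^ e)"
proof -
  let ?m = "minpoly (of_sq X)"
  have m0: "?m \<noteq> 0" using minpoly_properties(1)[of X] by auto
  then have nz: "f \<noteq> 0" "Q \<noteq> 0" using f(1) m by (auto simp: prime_elem_def)
  obtain e' where e': "e = Suc e'" using e by (cases e) auto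
  have "\<not> ?m dvd f ^ e' * Q"
  proof
    assume "?m dvd f ^ e' * Q"
    then have "f * (f ^ e' * Q) dvd 1 * (f ^ e' * Q)" by (simp add: m e' mult.assoc)
    then have "f dvd 1" using nz by (subst (asm) dvd_mult_cancel_right) auto
    then show False using f(1) by (auto simp: prime_elem_def)
  qed
  then have "peval (f ^ e' * Q) X \<noteq> 0" using minpoly_properties(3) by blast
  then obtain w where w: "act X (f ^ e' * Q) w \<noteq> 0"
    unfolding act_def by (metis matrix_eq matrix_vector_mult_0 of_sq_simps(1) sq_eq_iff)
  let ?v = "act X Q w"
  obtain d where d: "d \<in> {q. act X q w = 0}" "lead_coeff d = 1" "\<And>a. a \<in> {q. act X q w = 0} \<Longrightarrow> d dvd a"
  proof (rule poly_ideal_principal[of ?m "{q. act X q w = 0}"])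
    show "?m \<in> {q. act X q w = 0}" using minpoly_properties(2)[of X] by (simp add: act_def)
  qed (use m0 in \<open>auto simp: act_add act_mult\<close>)
  have "d dvd ?m" using d(3) minpoly_properties(2)[of X] by (simp add: act_def)
  then obtain c where c: "f ^ e * Q = d * c" unfolding m by (auto simp: dvd_def)
  have "\<not> f dvd c"
  proof
    assume "f dvd c"
    then obtain c' where "c = f * c'" by (auto simp: dvd_def)
    then have "f * (f ^ e' * Q) = f * (c' * d)" using c e' by (simp add: algebra_simps)
    then have "f ^ e' * Q = c' * d" using nz by simp
    then have "act X (f ^ e' * Q) w = act X c' (act X d w)" by (simp add: act_mult)
    then show False using w d(1) by simp
  qed
  then have fd: "f ^ e dvd d" using prime_power_cancel[OF f(1), of c e d] c by (metis dvd_triv_left mult.commute)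
  have "has_order X ?v (f ^ e)"
    unfolding has_order_def
  proof (intro allI iffI)
    fix q assume "act X q ?v = 0"
    then have "d dvd Q * q" using d(3)[of "Q * q"] by (simp add: act_mult')
    then have "f ^ e dvd Q * q" using fd dvd_trans by blast
    then show "f ^ e dvd q" using prime_power_cancel f by blast
  next
    fix q assume "f ^ e dvd q"
    then obtain r where "q = f ^ e * r" by (auto simp: dvd_def)
    then have "q * Q = r * ?m" by (simp add: m algebra_simps)
    then have "act X q ?v = act X (r * ?m) w" by (metis act_mult)
    then show "act X q ?v = 0" using minpoly_properties(2)[of X] by (simp add: act_mult) (simp add: act_def)
  qed
  then show ?thesis using that by blast
qed

text \<open>Coprime orders multiply: multiplying a relation for the sum by one order isolates the
  other summand.\<close>

lemma has_order_add:
  assumes 1: "has_order X v1 d" and 2: "has_order X v2 (f ^ e)" and f: "prime_elem f" "\<not> f dvd d"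
    and d: "d \<noteq> 0"
  shows "has_order X (v1 + v2) (f ^ e * d)"
  unfolding has_order_def
proof (intro allI iffI)
  fix q assume q: "act X q (v1 + v2) = 0"
  have fv: "act X (f ^ e) v2 = 0" and dv: "act X d v1 = 0" using 1 2 by (auto simp: has_order_def)
  have "act X (f ^ e * q) (v1 + v2) = 0" "act X (d * q) (v1 + v2) = 0"
    using q by (simp_all add: act_mult)
  then have "act X (f ^ e * q) v1 = 0" "act X (d * q) v2 = 0"
    using fv dv by (simp_all add: act_right_add act_mult'[of X "f ^ e"] act_mult'[of X d])
  then have dd: "d dvd f ^ e * q" and "f ^ e dvd d * q" using 1 2 by (auto simp: has_order_def)
  from dd obtain c where c: "f ^ e * q = d * c" by (auto simp: dvd_def)
  then have "f ^ e dvd c" using prime_power_cancel[OF f, of e c] by (metis dvd_triv_left)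
  then obtain c' where c': "c = f ^ e * c'" by (auto simp: dvd_def)
  have "f ^ e \<noteq> 0" using f by (auto simp: prime_elem_def)
  moreover have "f ^ e * q = f ^ e * (d * c')" using c c' by (simp add: algebra_simps)
  ultimately have q': "q = d * c'" by (metis mult_left_cancel)
  have "f ^ e dvd c'" using \<open>f ^ e dvd d * q\<close> f prime_power_cancel q' by blast
  then show "f ^ e * d dvd q" unfolding q' by (metis mult.commute mult_dvd_mono dvd_refl)
next
  fix q assume "f ^ e * d dvd q"
  then have "d dvd q" "f ^ e dvd q" by (auto elim: dvd_mult_left dvd_mult_right)
  then have "act X q v1 = 0" "act X q v2 = 0" using 1 2 by (simp_all add: has_order_def)
  then show "act X q (v1 + v2) = 0" by (simp add: act_right_add)
qed

lemma exists_minpoly_order: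
  fixes X :: "('k::{field,finite}, 'n::finite) sq"
  obtains v where "has_order X v (minpoly (of_sq X))"
proof -
  obtain F e where F: "finite F" "\<And>f. f \<in> F \<Longrightarrow> lead_coeff f = 1 \<and> irreducible f \<and> e f > 0"
    and m: "minpoly (of_sq X) = (\<Prod>f\<in>F. f ^ e f)"
    using monic_poly_factorization[OF minpoly_properties(1)[of X]] by metis
  have "\<exists>v. has_order X v (\<Prod>f\<in>G. f ^ e f)" if "G \<subseteq> F" for G
    using finite_subset[OF that F(1)] that
  proof (induction G rule: finite_induct)
    case empty
    then show ?case by (intro exI[of _ 0]) (simp add: has_order_def)
  next
    case (insert f G)
    then obtain v1 where v1: "has_order X v1 (\<Prod>f\<in>G. f ^ e f)" by blast
    have pr: "prime_elem f" using F(2) insert.prems by (auto intro: field_poly_irreducible_imp_prime)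
    have "minpoly (of_sq X) = f ^ e f * (\<Prod>f\<in>F - {f}. f ^ e f)"
      unfolding m using F(1) insert.prems by (intro prod.remove) auto
    moreover have "\<not> f dvd (\<Prod>f\<in>F - {f}. f ^ e f)"
      using F insert.prems by (intro monic_irreducible_dvd_prod) auto
    ultimately obtain v2 where v2: "has_order X v2 (f ^ e f)"
      using has_order_prime_power pr F(2) insert.prems by (metis insert_subset)
    have nd: "\<not> f dvd (\<Prod>f\<in>G. f ^ e f)"
      using F insert by (intro monic_irreducible_dvd_prod) auto
    then have "(\<Prod>f\<in>G. f ^ e f) \<noteq> 0" by auto
    from has_order_add[OF v1 v2 pr nd this] show ?case using insert.hyps by auto
  qed
  from this[of F] m that show ?thesis by auto
qed

lemma bij_betw_Poly:
  assumes "n > 0"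
  shows "bij_betw (Poly :: 'k::zero list \<Rightarrow> _) {xs. length xs = n} {p. degree p < n}"
  unfolding bij_betw_def
proof (intro conjI inj_onI equalityI subsetI)
  fix xs ys :: "'k list" assume "xs \<in> {xs. length xs = n}" "ys \<in> {xs. length xs = n}" "Poly xs = Poly ys"
  then show "xs = ys" by (metis (mono_tags) coeff_Poly_eq mem_Collect_eq nth_default_nth nth_equalityI)
next
  fix p :: "'k poly" assume "p \<in> Poly ` {xs. length xs = n}"
  then obtain xs where xs: "length xs = n" "p = Poly xs" by auto
  have "degree p \<le> n - 1" unfolding xs(2)
    by (rule degree_le) (use xs(1) in \<open>auto simp: coeff_Poly_eq nth_default_def\<close>)
  then show "p \<in> {p. degree p < n}" using assms by simp
next
  fix p :: "'k poly" assume p: "p \<in> {p. degree p < n}"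
  have "Poly (map (coeff p) [0..<n]) = p"
    by (rule poly_eqI) (use p in \<open>auto simp: coeff_Poly_eq nth_default_def intro!: coeff_eq_0\<close>)
  then show "p \<in> Poly ` {xs. length xs = n}" by (metis (mono_tags, lifting) diff_zero image_eqI length_map length_upt mem_Collect_eq)
qed

lemma card_polys_degree_less:
  assumes "n > 0"
  shows "card {p :: 'k::{zero,finite} poly. degree p < n} = CARD('k) ^ n" "finite {p :: 'k poly. degree p < n}"
proof -
  have "{xs :: 'k list. length xs = n} = {xs. set xs \<subseteq> UNIV \<and> length xs = n}" by auto
  then have "card {xs :: 'k list. length xs = n} = CARD('k) ^ n" "finite {xs :: 'k list. length xs = n}"
    by (simp_all only: card_lists_length_eq finite_lists_length_eq finite)
  then show "card {p :: 'k::{zero,finite} poly. degree p < n} = CARD('k) ^ n" "finite {p :: 'k poly. degree p < n}"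
    using bij_betw_same_card[OF bij_betw_Poly[OF assms]] bij_betw_finite[OF bij_betw_Poly[OF assms]] by metis+
qed

text \<open>A counting argument: regularity makes the minimal polynomial have degree n, so the
  \<open>q ^ n\<close> polynomials of smaller degree act injectively on a vector of that order and
  reach all \<open>q ^ n\<close> vectors.\<close>

lemma regular_cyclic:
  fixes X :: "('k::{field,finite}, 'n::finite) sq"
  assumes "regular_mat (of_sq X)"
  obtains v where "\<And>w. \<exists>p. w = act X p v"
proof -
  obtain v where v: "has_order X v (minpoly (of_sq X))" by (rule exists_minpoly_order)
  have deg: "degree (minpoly (of_sq X)) = CARD('n)"
    using assms charpoly_monic by (metis regular_mat_def)
  let ?S = "{p :: 'k poly. degree p < CARD('n)}"
  have n: "CARD('n) > 0" by simp
  have inj: "inj_on (\<lambda>p. act X p v) ?S"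
  proof (rule inj_onI)
    fix p q assume pq: "p \<in> ?S" "q \<in> ?S" "act X p v = act X q v"
    then have "act X (p - q) v = 0" by (simp add: act_diff)
    then have "minpoly (of_sq X) dvd p - q" using v by (simp add: has_order_def)
    moreover have "degree (p - q) < CARD('n)" using pq by (simp add: degree_diff_less)
    ultimately have "p - q = 0" using deg by (metis dvd_imp_degree_le leD)
    then show "p = q" by simp
  qed
  have "card ((\<lambda>p. act X p v) ` ?S) = CARD('k ^ 'n)"
    using card_image[OF inj] card_polys_degree_less(1)[OF n, where 'k = 'k] by simp
  then have "(\<lambda>p. act X p v) ` ?S = UNIV" by (metis card_subset_eq finite subset_UNIV)
  then show ?thesis using that by (metis (no_types, lifting) UNIV_I imageE)
qed

text \<open>A matrix commuting with \<open>X\<close> is determined by its value at a cyclic vector,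
  where it agrees with some polynomial in \<open>X\<close>.\<close>

lemma regular_centralizer:
  fixes X :: "('k::{field,finite}, 'n::finite) sq"
  assumes "regular_mat (of_sq X)" and comm: "y * X = X * y"
  obtains p where "y = peval p X"
proof -
  obtain v where v: "\<And>w. \<exists>p. w = act X p v" using regular_cyclic[OF assms(1)] by blast
  then obtain p where p: "of_sq y *v v = act X p v" by blast
  have "of_sq y *v w = of_sq (peval p X) *v w" for w
  proof -
    obtain r where r: "w = act X r v" using v by blast
    have "of_sq y *v w = of_sq (y * peval r X) *v v"
      by (simp add: r act_def matrix_vector_mul_assoc)
    also have "y * peval r X = peval r X * y" by (rule commute_peval[OF comm])
    also have "of_sq (peval r X * y) *v v = act X r (act X p v)"
      using p by (simp add: act_def matrix_vector_mul_assoc[symmetric])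
    also have "\<dots> = act X p (act X r v)" by (metis act_mult act_mult')
    finally show ?thesis by (simp add: r act_def)
  qed
  then have "of_sq y = of_sq (peval p X)" by (simp add: matrix_eq)
  then show ?thesis using that sq_eq_iff by blast
qed

subsection \<open>The Frobenius of the algebraic closure\<close>

lemma prime_CHAR_finite: "prime CHAR('k::{field,finite})"
  using finite_imp_CHAR_pos[where 'a = 'k] prime_CHAR_semidom[where 'a = 'k] by simp

lemma card_finite_field_ge_2: "CARD('k::{field,finite}) \<ge> 2"
proof -
  have "card {0, 1 :: 'k} \<le> CARD('k)" by (intro card_mono) auto
  then show ?thesis by simp
qed

text \<open>An additive subgroup of largest characteristic-power order is the whole field, since
  adjoining the multiples of a missing element multiplies the order by the characteristic. The
  result makes the \<open>q\<close>-power map an iterate of the Frobenius, hence additive.\<close>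

lemma card_finite_field_power_CHAR:
  obtains s where "CARD('k::{field,finite}) = CHAR('k) ^ s"
proof -
  let ?p = "CHAR('k)"
  define Q where "Q H \<longleftrightarrow> 0 \<in> H \<and> (\<forall>a\<in>H. \<forall>b\<in>H. a - b \<in> H) \<and> (\<exists>s. card H = ?p ^ s)" for H :: "'k set"
  have "Q {0}" by (auto simp: Q_def intro: exI[of _ 0])
  then have "\<exists>H. Q H \<and> (\<forall>H'. Q H' \<longrightarrow> card H' \<le> card H)"
    by (rule ex_has_greatest_nat[of Q "{0}" card "Suc CARD('k)"]) (auto simp: card_mono less_Suc_eq_le le_SucI)
  then obtain H where QH: "Q H" and max: "\<And>H'. Q H' \<Longrightarrow> card H' \<le> card H" by blast
  note H = QH[unfolded Q_def]
  have neg: "- a \<in> H" if "a \<in> H" for a using H that by (metis diff_0)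
  then have add: "a + b \<in> H" if "a \<in> H" "b \<in> H" for a b using H that by (metis diff_minus_eq_add)
  have mul: "of_nat n * a \<in> H" if "a \<in> H" for n a
    by (induction n) (use H add that in \<open>auto simp: distrib_right\<close>)
  have p1: "?p > 1" using prime_CHAR_finite[where 'k = 'k] prime_gt_1_nat by blast
  have "H = UNIV"
  proof (rule ccontr)
    assume "H \<noteq> UNIV"
    then obtain x where x: "x \<notin> H" by blast
    have x': "i = j" if "i < ?p" "j < ?p" "of_nat i * x - of_nat j * x \<in> H" for i j
    proof -
      \<comment> \<open>If two multiples of \<open>x\<close> agreed modulo \<open>H\<close>, a
        Bezout inverse of \<open>i - j\<close> modulo the characteristic would put \<open>x\<close>
        itself into \<open>H\<close>.\<close>
      have *: "\<not> j < i" if ij: "i < ?p" "j < ?p" "of_nat i * x - of_nat j * x \<in> H" for i j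
      proof
        assume lt: "j < i"
        have "\<not> ?p dvd i - j" using lt ij(1) by (auto dest: dvd_imp_le)
        then have "coprime ?p (i - j)" using prime_CHAR_finite[where 'k = 'k] prime_imp_coprime by blast
        moreover have "i - j \<noteq> 0" using lt by simp
        ultimately obtain a b where "(i - j) * a = ?p * b + 1"
          using bezout_nat[of "i - j" ?p] by (auto simp: coprime_iff_gcd_eq_1 gcd.commute)
        then have "of_nat ((i - j) * a) = (of_nat (?p * b + 1) :: 'k)" by (rule arg_cong)
        then have "of_nat ((i - j) * a) = (1 :: 'k)" by (simp only: of_nat_add of_nat_mult of_nat_CHAR) simp
        then have "x = of_nat ((i - j) * a) * x" by simp
        then have "x = of_nat a * ((of_nat i - of_nat j) * x)" using lt by (simp add: of_nat_diff mult_ac)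
        then have "x = of_nat a * (of_nat i * x - of_nat j * x)" by (simp add: left_diff_distrib)
        then show False using mul ij(3) x by metis
      qed
      have "of_nat j * x - of_nat i * x \<in> H" using neg[OF that(3)] by simp
      then show ?thesis using *[of i j] *[of j i] that by auto
    qed
    let ?g = "\<lambda>(h, i). h + of_nat i * x"
    let ?H' = "?g ` (H \<times> {..<?p})"
    have inj: "inj_on ?g (H \<times> {..<?p})"
    proof (rule inj_onI, clarify)
      fix h i h' j assume h: "h \<in> H" "h' \<in> H" "i < ?p" "j < ?p" "h + of_nat i * x = h' + of_nat j * x"
      then have "of_nat i * x - of_nat j * x = h' - h" by (simp add: algebra_simps)
      then have "i = j" using x'[of i j] h H by metis
      then show "h = h' \<and> i = j" using h by simp
    qed
    have "card ?H' = card H * ?p" using card_image[OF inj] by (simp add: card_cartesian_product)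
    moreover have "Q ?H'"
      unfolding Q_def
    proof (intro conjI ballI)
      show "0 \<in> ?H'" using H p1 by (auto intro!: image_eqI[of _ _ "(0, 0)"])
      show "\<exists>s. card ?H' = ?p ^ s" using H \<open>card ?H' = _\<close> by (metis mult.commute power_Suc)
      fix a b assume "a \<in> ?H'" "b \<in> ?H'"
      then obtain h i h' j where ab: "h \<in> H" "h' \<in> H" "i < ?p" "j < ?p" "a = h + of_nat i * x" "b = h' + of_nat j * x"
        by auto
      have md: "(of_nat (n mod ?p) :: 'k) = of_nat n" for n
      proof -
        have "(of_nat n :: 'k) = of_nat (?p * (n div ?p) + n mod ?p)" by simp
        then show ?thesis by (simp only: of_nat_add of_nat_mult of_nat_CHAR) simp
      qed
      have "(of_nat ((i + (?p - j)) mod ?p) :: 'k) = of_nat (i + (?p - j))" by (rule md)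
      also have "\<dots> = of_nat i - of_nat j" using ab(4) by (simp add: of_nat_diff)
      finally have mm: "(of_nat ((i + (?p - j)) mod ?p) :: 'k) = of_nat i - of_nat j" .
      have "a - b = ?g (h - h', (i + (?p - j)) mod ?p)"
        by (simp add: ab(5,6) mm left_diff_distrib)
      moreover have "h - h' \<in> H" "(i + (?p - j)) mod ?p < ?p" using H ab p1 by auto
      ultimately show "a - b \<in> ?H'" by blast
    qed
    ultimately have "card H * ?p \<le> card H" using max by metis
    moreover have "card H > 0" using H by (auto simp: card_gt_0_iff)
    ultimately show False using p1 by simp
  qed
  then show ?thesis using H that by blast
qed

lemma finite_field_power_card:
  fixes c :: "'k::{field,finite}"
  shows "c \<noteq> 0 \<Longrightarrow> c ^ (CARD('k) - 1) = 1" "c ^ CARD('k) = c"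
proof -
  show 1: "c ^ (CARD('k) - 1) = 1" if "c \<noteq> 0" for c :: 'k
  proof -
    have "(\<Prod>x\<in>UNIV - {0}. x) = (\<Prod>x\<in>UNIV - {0 :: 'k}. c * x)"
      by (rule prod.reindex_bij_witness[of _ "\<lambda>x. c * x" "\<lambda>x. x / c"]) (use that in auto)
    also have "\<dots> = c ^ (CARD('k) - 1) * (\<Prod>x\<in>UNIV - {0}. x)"
      by (simp add: prod.distrib card_Diff_singleton)
    finally show ?thesis by simp
  qed
  have "CARD('k) = Suc (CARD('k) - 1)" using card_finite_field_ge_2[where 'k = 'k] by simp
  then show "c ^ CARD('k) = c" using 1[of c] by (metis mult.right_neutral mult_zero_left power_Suc)
qed

lemma frobenius_add:
  fixes x y :: "'k::{field,finite} alg_closure"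
  shows "(x + y) ^ (CARD('k) ^ i) = x ^ (CARD('k) ^ i) + y ^ (CARD('k) ^ i)"
proof -
  obtain s where "CARD('k) = CHAR('k) ^ s" by (rule card_finite_field_power_CHAR)
  then have "CARD('k) ^ i = CHAR('k alg_closure) ^ (s * i)" by (simp add: power_mult)
  moreover have "prime CHAR('k alg_closure)" using prime_CHAR_finite[where 'k = 'k] by simp
  ultimately show ?thesis using freshmans_dream' by blast
qed

lemma to_ac_power_card: "to_ac (c :: 'k::{field,finite}) ^ (CARD('k) ^ i) = to_ac c"
  by (induction i) (simp_all add: power_mult finite_field_power_card(2) flip: to_ac_power)

lemma is_ring_hom_frobenius: "is_ring_hom (\<lambda>x :: 'k::{field,finite} alg_closure. x ^ (CARD('k) ^ i))"
  by (simp add: is_ring_hom_def frobenius_add power_mult_distrib)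

lemma is_ring_hom_to_ac: "is_ring_hom to_ac"
  by (simp add: is_ring_hom_def)

lemma frobenius_inj:
  fixes x y :: "'k::{field,finite} alg_closure"
  assumes "x ^ (CARD('k) ^ i) = y ^ (CARD('k) ^ i)"
  shows "x = y"
proof -
  have "(x - y) ^ (CARD('k) ^ i) = 0"
    using is_ring_homD(6)[OF is_ring_hom_frobenius[where 'k = 'k, of i], of x y] assms by simp
  then show ?thesis by simp
qed

lemma fixed_points_card:
  fixes S :: "'a::field set"
  assumes "n > 1" "\<And>x. x \<in> S \<Longrightarrow> x ^ n = x"
  shows "finite S" "card S \<le> n"
proof -
  let ?p = "monom 1 n - monom 1 1 :: 'a poly"
  have d: "degree ?p = n"
    unfolding diff_conv_add_uminus using assms(1) by (subst degree_add_eq_left) (simp_all add: degree_monom_eq)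
  then have nz: "?p \<noteq> 0" using assms(1) by auto
  have sub: "S \<subseteq> {x. poly ?p x = 0}" using assms(2) by (auto simp: poly_monom)
  show "finite S" by (rule finite_subset[OF sub poly_roots_finite[OF nz]])
  show "card S \<le> n"
    using card_mono[OF poly_roots_finite[OF nz] sub] card_poly_roots_bound[OF nz] d by simp
qed

text \<open>The fixed points are roots of a polynomial of degree \<open>q\<close>, and the elements
  of the base field already account for \<open>q\<close> of them.\<close>

lemma frobenius_fixed:
  fixes x :: "'k::{field,finite} alg_closure"
  assumes "x ^ CARD('k) = x"
  obtains c :: 'k where "x = to_ac c"
proof -
  let ?S = "insert x (range (to_ac :: 'k \<Rightarrow> _))"
  have "CARD('k) > 1" using card_finite_field_ge_2[where 'k = 'k] by simp
  then have "card ?S \<le> CARD('k)"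
    by (rule fixed_points_card) (use assms to_ac_power_card[where i = 1] in auto)
  moreover have "card (range (to_ac :: 'k \<Rightarrow> _)) = CARD('k)" by (rule card_image[OF inj_to_ac])
  ultimately have "x \<in> range to_ac"
    by (metis card_insert_disjoint finite finite_imageI not_less_eq_eq order_refl)
  then show ?thesis using that by blast
qed

abbreviation ac_poly :: "'k::field poly \<Rightarrow> 'k alg_closure poly" where
  "ac_poly \<equiv> map_poly to_ac"

lemma ac_poly_simps [simp]: "ac_poly (p * q) = ac_poly p * ac_poly q" "ac_poly (p + q) = ac_poly p + ac_poly q"
  "ac_poly 1 = 1" "ac_poly 0 = 0" "ac_poly (p ^ n) = ac_poly p ^ n"
  using is_ring_homD[OF is_ring_hom_map_poly[OF is_ring_hom_to_ac]]
    is_ring_hom_power[OF is_ring_hom_map_poly[OF is_ring_hom_to_ac]] by metis+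

lemma degree_ac_poly [simp]: "degree (ac_poly p) = degree p"
  by (rule degree_map_poly) simp

lemma lead_coeff_ac_poly [simp]: "lead_coeff (ac_poly p) = to_ac (lead_coeff p)"
  by (simp add: coeff_map_poly)

lemma poly_ac_poly_frobenius:
  fixes h :: "'k::{field,finite} poly"
  shows "poly (ac_poly h) (x ^ (CARD('k) ^ i)) = poly (ac_poly h) x ^ (CARD('k) ^ i)"
proof (induction h)
  case (pCons a h)
  then show ?case
    by (simp add: map_poly_pCons frobenius_add to_ac_power_card power_mult_distrib)
qed simp

lemma proots_prod_linear: "proots (\<Prod>x\<in>#B. [:-x, 1:]) = (B :: 'a::idom multiset)"
proof (induction B)
  case (add b B)
  have "(\<Prod>x\<in>#B. [:-x, 1:]) \<noteq> 0" by (auto simp: prod_mset_zero_iff)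
  then show ?case using add by (simp add: proots_mult del: mult_pCons_left)
qed simp

lemma poly_eq_prod_proots:
  fixes p :: "'a::alg_closed_field poly"
  assumes "lead_coeff p = 1"
  shows "p = (\<Prod>x\<in>#proots p. [:-x, 1:])" "size (proots p) = degree p"
proof -
  have "p \<noteq> 0" using assms by auto
  then obtain A where A: "size A = degree p" "p = smult (lead_coeff p) (\<Prod>x\<in>#A. [:-x, 1:])"
    using alg_closed_imp_factorization by blast
  then have e: "p = (\<Prod>x\<in>#A. [:-x, 1:])" using assms by simp
  have "proots p = A" unfolding e by (rule proots_prod_linear)
  then show "p = (\<Prod>x\<in>#proots p. [:-x, 1:])" "size (proots p) = degree p" using e A by simp_all
qed

text \<open>The Frobenius fixes the coefficients, so applying it to the linear factors permutes the
  roots with their multiplicities.\<close>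

lemma proots_ac_poly_frobenius:
  fixes P :: "'k::{field,finite} poly"
  assumes "lead_coeff P = 1"
  shows "image_mset (\<lambda>x. x ^ CARD('k)) (proots (ac_poly P)) = proots (ac_poly P)"
proof -
  let ?fr = "\<lambda>x :: 'k alg_closure. x ^ CARD('k)"
  have h: "is_ring_hom ?fr" using is_ring_hom_frobenius[where 'k = 'k, of 1] by simp
  note hh = is_ring_hom_map_poly[OF h]
  have l: "lead_coeff (ac_poly P) = 1" using assms by (simp add: coeff_map_poly)
  have "map_poly ?fr (ac_poly P) = ac_poly P"
    using to_ac_power_card[where 'k = 'k and i = 1] by (intro poly_eqI) (simp add: coeff_map_poly card_gt_0_iff)
  moreover have "map_poly ?fr (\<Prod>x\<in>#A. [:-x, 1:]) = (\<Prod>x\<in>#image_mset ?fr A. [:-x, 1:])" for A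
  proof (induction A)
    case empty
    then show ?case by (simp add: is_ring_homD(3)[OF hh])
  next
    case (add a A)
    have "map_poly ?fr [:-a, 1:] = [:- (?fr a), 1:]"
      by (simp add: map_poly_pCons is_ring_homD(5)[OF h])
    then show ?case using add by (simp add: is_ring_homD(2)[OF hh] del: mult_pCons_left)
  qed
  ultimately have "(\<Prod>x\<in>#image_mset ?fr (proots (ac_poly P)). [:-x, 1:]) = ac_poly P"
    using poly_eq_prod_proots(1)[OF l] by metis
  then show ?thesis using proots_prod_linear by metis
qed

subsection \<open>Determinants of polynomials in a matrix\<close>

lemma prod_mset_minus_swap:
  "(\<Prod>a\<in>#A. b - a) = (- 1) ^ size A * (\<Prod>a\<in>#A. a - (b :: 'a::comm_ring_1))"
  by (induction A) (simp_all add: algebra_simps)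

lemma prod_mset_image_mult:
  "(\<Prod>a\<in>#A. f a * g a) = (\<Prod>a\<in>#A. f a) * (\<Prod>a\<in>#A. g a :: 'a::comm_monoid_mult)"
  by (induction A) (simp_all add: mult_ac)

lemma prod_mset_image_power:
  "(\<Prod>a\<in>#A. f a) ^ n = (\<Prod>a\<in>#A. f a ^ n :: 'a::comm_monoid_mult)"
  by (induction A) (simp_all add: power_mult_distrib)

lemma prod_mset_repeat:
  "(\<Prod>a\<in>#repeat_mset n A. f a) = (\<Prod>a\<in>#A. f a :: 'a::comm_monoid_mult) ^ n"
  by (induction n) simp_all

text \<open>Both sides are multiplicative in \<open>F\<close>, and \<open>F\<close> is a product of
  a constant and linear factors; for a linear factor the claim is the value of the characteristic
  polynomial at a point. This avoids triangularization.\<close>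

lemma sdet_peval_closed:
  fixes X :: "('a::alg_closed_field, 'n::finite) sq"
  shows "sdet (peval F X) = (\<Prod>a\<in>#proots (charpoly (of_sq X)). poly F a)"
proof -
  let ?A = "proots (charpoly (of_sq X))"
  have mon: "lead_coeff (charpoly (of_sq X)) = 1" and deg: "degree (charpoly (of_sq X)) = CARD('n)"
    using charpoly_monic[of "of_sq X"] by auto
  note cp = poly_eq_prod_proots[OF mon]
  have size: "size ?A = CARD('n)" using cp(2) deg by simp
  have const: "sdet (peval [:c:] X) = (\<Prod>a\<in>#?A. poly [:c:] a)" for c
    by (simp add: sdet_smat size prod_mset_constant)
  have lin: "sdet (peval [:-b, 1:] X) = (\<Prod>a\<in>#?A. poly [:-b, 1:] a)" for b
  proof -
    have "sdet (peval [:-b, 1:] X) = sdet (smat (-1) * (smat b - X))"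
    proof -
      have "smat (-1) * (smat b - X) = smat (-b) + X"
        by (rule sq_eqI) (simp add: mat_def del: of_sq_simps(6))
      then show ?thesis by simp
    qed
    also have "\<dots> = (-1) ^ CARD('n) * poly (charpoly (of_sq X)) b"
      by (simp add: sdet_mult sdet_smat sdet_linear)
    also have "poly (charpoly (of_sq X)) b = (\<Prod>a\<in>#?A. b - a)"
    proof -
      have "poly (\<Prod>a\<in>#A. [:-a, 1:]) b = (\<Prod>a\<in>#A. b - a)" for A
        by (induction A) (simp_all add: left_diff_distrib)
      then show ?thesis using cp(1) by metis
    qed
    also have "\<dots> = (-1) ^ CARD('n) * (\<Prod>a\<in>#?A. a - b)" by (simp add: prod_mset_minus_swap size)
    finally show ?thesis by (simp add: mult.assoc[symmetric] power_mult_distrib[symmetric])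
  qed
  have prod: "sdet (peval (\<Prod>b\<in>#B. [:-b, 1:]) X) = (\<Prod>a\<in>#?A. poly (\<Prod>b\<in>#B. [:-b, 1:]) a)" for B
  proof (induction B)
    case empty
    then show ?case using const[of 1] by (simp add: one_pCons)
  next
    case (add b B)
    have e: "(\<Prod>b\<in>#add_mset b B. [:-b, 1:]) = [:-b, 1:] * (\<Prod>b\<in>#B. [:-b, 1:])" by simp
    show ?case unfolding e peval_mult sdet_mult lin add poly_mult prod_mset_image_mult ..
  qed
  show ?thesis
  proof (cases "F = 0")
    case True
    then show ?thesis using const[of 0] by simp
  next
    case False
    then obtain B where "F = smult (lead_coeff F) (\<Prod>x\<in>#B. [:-x, 1:])"
      using alg_closed_imp_factorization by blast
    then have "F = [:lead_coeff F:] * (\<Prod>x\<in>#B. [:-x, 1:])" by simp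
    then obtain c where e: "F = [:c:] * (\<Prod>x\<in>#B. [:-x, 1:])" by blast
    show ?thesis unfolding e peval_mult sdet_mult const prod poly_mult prod_mset_image_mult ..
  qed
qed

lemma sdet_peval_ac:
  fixes X :: "('k::{field,finite}, 'n::finite) sq"
  shows "to_ac (sdet (peval F X)) = (\<Prod>a\<in>#proots (ac_poly (charpoly (of_sq X))). poly (ac_poly F) a)"
proof -
  have "to_ac (sdet (peval F X)) = sdet (peval (ac_poly F) (smap to_ac X))"
    by (simp add: sdet_smap[OF is_ring_hom_to_ac] flip: smap_peval[OF is_ring_hom_to_ac])
  also have "\<dots> = (\<Prod>a\<in>#proots (charpoly (of_sq (smap to_ac X))). poly (ac_poly F) a)"
    by (rule sdet_peval_closed)
  also have "charpoly (of_sq (smap to_ac X)) = ac_poly (charpoly (of_sq X))"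
    by (simp add: smap_def charpoly_matmap[OF is_ring_hom_to_ac])
  finally show ?thesis .
qed

text \<open>The roots of \<open>P ^ i\<close> are those of \<open>P\<close> repeated
  \<open>i\<close> times, so the determinant is the \<open>i\<close>-th power of a product over the
  roots of \<open>P\<close>. That product is invariant under the Frobenius and therefore lies in the
  base field.\<close>

lemma sdet_peval_is_power:
  fixes X :: "('k::{field,finite}, 'n::finite) sq"
  assumes "charpoly (of_sq X) = P ^ i" "lead_coeff P = 1"
  obtains z where "sdet (peval F X) = z ^ i"
proof -
  let ?A = "proots (ac_poly P)"
  let ?z = "\<Prod>a\<in>#?A. poly (ac_poly F) a"
  have "?z ^ CARD('k) = (\<Prod>a\<in>#?A. poly (ac_poly F) (a ^ CARD('k)))"
    using poly_ac_poly_frobenius[of F _ 1] by (simp add: prod_mset_image_power)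
  also have "\<dots> = (\<Prod>a\<in>#image_mset (\<lambda>x. x ^ CARD('k)) ?A. poly (ac_poly F) a)"
    by (simp add: image_mset.compositionality o_def)
  also have "\<dots> = ?z" by (simp only: proots_ac_poly_frobenius[OF assms(2)])
  finally obtain c :: 'k where c: "?z = to_ac c" by (rule frobenius_fixed)
  have "to_ac (sdet (peval F X)) = to_ac (c ^ i)"
    unfolding sdet_peval_ac assms(1) ac_poly_simps proots_power prod_mset_repeat c by simp
  then have "sdet (peval F X) = c ^ i" by (simp only: to_ac_eq_iff)
  then show ?thesis by (rule that)
qed

subsection \<open>Norms\<close>

text \<open>\<open>?K\<close> is the field generated by \<open>r\<close>, of size
  \<open>q ^ d\<close>. If \<open>r ^ (q ^ t) = r\<close> with \<open>t > 0\<close>, then all of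
  \<open>?K\<close> is fixed by that power map, so \<open>d \<le> t\<close>; hence the first
  \<open>d\<close> conjugates are distinct and exhaust the roots. Pigeonhole gives
  \<open>r ^ (q ^ d) = r\<close>, and by size the fixed points of that map are exactly
  \<open>?K\<close>.\<close>

lemma frobenius_orbit_proots:
  fixes f :: "'k::{field,finite} poly"
  assumes f: "lead_coeff f = 1" "irreducible f" and r: "poly (ac_poly f) r = 0"
  defines "d \<equiv> degree f"
  shows "proots (ac_poly f) = image_mset (\<lambda>i. r ^ (CARD('k) ^ i)) (mset_set {..<d})"
    and "\<And>x. x ^ (CARD('k) ^ d) = x \<Longrightarrow> \<exists>h. x = poly (ac_poly h) r"
proof -
  let ?q = "CARD('k)"
  have q: "?q \<ge> 2" by (rule card_finite_field_ge_2)
  have f0: "f \<noteq> 0" using f by auto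
  have acf0: "ac_poly f \<noteq> 0" using f0 by (metis degree_ac_poly f(1) lead_coeff_ac_poly leading_coeff_0_iff to_ac_1 zero_neq_one)
  have d0: "d > 0" unfolding d_def by (rule monic_irreducible_degree_pos[OF f])
  let ?S = "{h :: 'k poly. degree h < d}"
  let ?K = "(\<lambda>h. poly (ac_poly h) r) ` ?S"
  have annih: "h = 0" if h: "poly (ac_poly h) r = 0" "degree h < d" for h
  proof (rule ccontr)
    assume "h \<noteq> 0"
    let ?I = "{h :: 'k poly. poly (ac_poly h) r = 0}"
    obtain g where g: "g \<in> ?I" "lead_coeff g = 1" "\<And>a. a \<in> ?I \<Longrightarrow> g dvd a"
      by (rule poly_ideal_principal[of h ?I]) (use h \<open>h \<noteq> 0\<close> in auto)
    have "\<not> is_unit g"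
    proof
      assume "is_unit g"
      then obtain c where c: "g = [:c:]" by (auto simp: is_unit_poly_iff)
      with g(2) have "c = 1" by simp
      then show False using g(1) c by (simp add: one_pCons[symmetric])
    qed
    moreover have "g dvd f" using g(3) r by blast
    ultimately have "f dvd g" using f(2) by (metis irreducibleD')
    then have "f dvd h" using g(3)[of h] h by (auto intro: dvd_trans)
    then show False using h(2) \<open>h \<noteq> 0\<close> d_def by (auto dest: dvd_imp_degree_le)
  qed
  have injK: "inj_on (\<lambda>h. poly (ac_poly h) r) ?S"
  proof (rule inj_onI)
    fix h h' assume hh: "h \<in> ?S" "h' \<in> ?S" "poly (ac_poly h) r = poly (ac_poly h') r"
    have "ac_poly (h - h') = ac_poly h - ac_poly h'"
      by (rule is_ring_homD(6)[OF is_ring_hom_map_poly[OF is_ring_hom_to_ac]])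
    then have "poly (ac_poly (h - h')) r = 0" using hh by simp
    moreover have "degree (h - h') < d" using hh by (auto intro: degree_diff_less)
    ultimately show "h = h'" using annih by force
  qed
  have cardK: "card ?K = ?q ^ d" using card_image[OF injK] card_polys_degree_less(1)[OF d0] by simp
  have fixK: "x ^ (?q ^ t) = x" if "r ^ (?q ^ t) = r" "x \<in> ?K" for t x
    using that by (auto simp flip: poly_ac_poly_frobenius)
  have qt: "?q ^ t > 1" if "t > 0" for t by (rule one_less_power) (use q that in auto)
  have period: "d \<le> t" if t: "t > 0" "r ^ (?q ^ t) = r" for t
  proof -
    have "card ?K \<le> ?q ^ t" using fixed_points_card(2)[OF qt[OF t(1)]] fixK[OF t(2)] by blast
    then have "?q ^ d \<le> ?q ^ t" unfolding cardK .
    then show ?thesis using q by (simp add: power_increasing_iff)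
  qed
  let ?o = "\<lambda>i. r ^ (?q ^ i)"
  have diff: "r ^ (?q ^ (j - i)) = r" if "i < j" "?o i = ?o j" for i j
  proof (rule frobenius_inj[where i = i])
    have "?q ^ j = ?q ^ (j - i) * ?q ^ i" using that(1) by (simp flip: power_add)
    then have "?o j = (r ^ (?q ^ (j - i))) ^ (?q ^ i)" by (simp only: power_mult)
    then show "(r ^ (?q ^ (j - i))) ^ (?q ^ i) = r ^ (?q ^ i)" using that(2) by simp
  qed
  have inj: "inj_on ?o {..<d}"
  proof (rule linorder_inj_onI)
    fix i j assume "i < j" "i \<in> {..<d}" "j \<in> {..<d}"
    then show "?o i \<noteq> ?o j" using diff[of i j] period[of "j - i"] by auto
  qed auto
  have root: "?o i \<in># proots (ac_poly f)" for i
  proof -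
    have "poly (ac_poly f) (?o i) = 0" unfolding poly_ac_poly_frobenius using r by simp
    then show ?thesis using acf0 by simp
  qed
  have size: "size (proots (ac_poly f)) = d"
    using poly_eq_prod_proots(2)[of "ac_poly f"] f(1) by (simp add: d_def coeff_map_poly)
  let ?M = "image_mset ?o (mset_set {..<d})"
  have M: "?M = mset_set (?o ` {..<d})" by (rule image_mset_mset_set[OF inj])
  have "?M \<subseteq># proots (ac_poly f)"
  proof (unfold M, rule mset_subset_eqI)
    fix x
    show "count (mset_set (?o ` {..<d})) x \<le> count (proots (ac_poly f)) x"
    proof (cases "x \<in> ?o ` {..<d}")
      case True
      then have "x \<in># proots (ac_poly f)" using root by blast
      then have "1 \<le> count (proots (ac_poly f)) x" by (simp only: count_greater_eq_one_iff)
      then show ?thesis using True by (simp only: count_mset_set finite_imageI finite_lessThan)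
    next
      case False
      then show ?thesis by (simp only: count_mset_set le0 simp_thms)
    qed
  qed
  moreover have "size ?M = size (proots (ac_poly f))" using size by simp
  ultimately show "proots (ac_poly f) = ?M" by (metis mset_subset_size subset_mset.le_neq_trans less_irrefl)
  have rd: "r ^ (?q ^ d) = r"
  proof -
    have "\<not> inj_on ?o {..d}"
    proof
      assume i: "inj_on ?o {..d}"
      have "?o ` {..d} \<subseteq> set_mset (proots (ac_poly f))" using root by auto
      then have "card {..d} \<le> card (set_mset (proots (ac_poly f)))" using card_inj_on_le[OF i] by simp
      also have "\<dots> \<le> d" using size_mset_mono[OF mset_set_set_mset_msubset[of "proots (ac_poly f)"]] size by simp
      finally show False by simp
    qed
    then obtain i j where ij: "i < j" "j \<le> d" "?o i = ?o j"
      by (metis (no_types, lifting) atMost_iff inj_onI linorder_neqE_nat)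
    with diff have e: "r ^ (?q ^ (j - i)) = r" by blast
    then have "j - i = d" using period[of "j - i"] ij by auto
    with e show ?thesis by simp
  qed
  show "\<exists>h. x = poly (ac_poly h) r" if x: "x ^ (?q ^ d) = x" for x
  proof -
    let ?L = "insert x ?K"
    have "card ?L \<le> ?q ^ d" and "finite ?L"
      using fixed_points_card[OF qt[OF d0], of ?L] fixK[OF rd] x by auto
    then have "x \<in> ?K" using cardK by (metis card_insert_disjoint finite_insert not_less_eq_eq order_refl)
    then show ?thesis by blast
  qed
qed

text \<open>The norm is \<open>z \<mapsto> z^E\<close> with \<open>E = 1 + q + \<dots> + q^(d-1)\<close>, and every root of \<open>z^E = u\<close> is fixed by the
  \<open>d\<close>-th power of the Frobenius, hence already lies in the extension of degree \<open>d\<close>.\<close>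

lemma norm_surjective:
  fixes f :: "'k::{field,finite} poly"
  assumes f: "lead_coeff f = 1" "irreducible f" and u: "u \<noteq> 0"
  obtains h where "(\<Prod>a\<in>#proots (ac_poly f). poly (ac_poly h) a) = to_ac u"
proof -
  let ?q = "CARD('k)"
  let ?d = "degree f"
  have q: "?q \<ge> 2" by (rule card_finite_field_ge_2)
  have d: "?d > 0" by (rule monic_irreducible_degree_pos[OF f])
  then have "degree (ac_poly f) > 0" by simp
  then obtain r where r: "poly (ac_poly f) r = 0" using alg_closed_imp_poly_has_root by blast
  let ?E = "\<Sum>i<?d. ?q ^ i"
  have E: "?E * (?q - 1) + 1 = ?q ^ ?d"
  proof -
    have "(\<Sum>i<n. ?q ^ i) * (?q - 1) + 1 = ?q ^ n" for n
    proof (induction n)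
      case (Suc n)
      have "(\<Sum>i<Suc n. ?q ^ i) * (?q - 1) + 1 = ?q ^ n + ?q ^ n * (?q - 1)"
        using Suc by (simp add: distrib_right)
      also have "\<dots> = ?q ^ n * (1 + (?q - 1))" by (simp only: distrib_left mult_1_right)
      also have "1 + (?q - 1) = ?q" using q by simp
      finally show ?case by (simp add: mult.commute)
    qed simp
    then show ?thesis .
  qed
  have "?E > 0" using d by (auto intro!: sum_pos2[of _ 0])
  then obtain z where z: "z ^ ?E = to_ac u" using nth_root_exists by blast
  have "z ^ (?q ^ ?d) = z"
  proof -
    have "z ^ (?q ^ ?d) = (z ^ ?E) ^ (?q - 1) * z" unfolding E[symmetric] by (simp add: power_mult)
    also have "(z ^ ?E) ^ (?q - 1) = to_ac (u ^ (?q - 1))" by (simp add: z)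
    also have "u ^ (?q - 1) = 1" using u by (rule finite_field_power_card(1))
    finally show ?thesis by simp
  qed
  then obtain h where h: "z = poly (ac_poly h) r" using frobenius_orbit_proots(2)[OF f r] by blast
  have "(\<Prod>a\<in>#proots (ac_poly f). poly (ac_poly h) a) = (\<Prod>i<?d. poly (ac_poly h) (r ^ (?q ^ i)))"
    unfolding frobenius_orbit_proots(1)[OF f r]
    by (simp add: image_mset.compositionality o_def prod_unfold_prod_mset)
  also have "\<dots> = (\<Prod>i<?d. z ^ (?q ^ i))" by (simp add: poly_ac_poly_frobenius h)
  also have "\<dots> = z ^ ?E" by (simp add: power_sum)
  finally show ?thesis using z that by simp
qed

text \<open>By the Chinese remainder theorem \<open>F\<close> may be congruent to \<open>h\<close>
  modulo \<open>f\<close> and to 1 modulo \<open>Q\<close>, where \<open>h\<close> has norm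
  \<open>u\<close>. The roots of \<open>f ^ e\<close> then contribute \<open>u ^ e\<close>, and
  those of \<open>Q\<close> contribute 1.\<close>

lemma sdet_peval_prime_power:
  fixes X :: "('k::{field,finite}, 'n::finite) sq"
  assumes f: "lead_coeff f = 1" "irreducible f" and Q: "\<not> f dvd Q"
    and cp: "charpoly (of_sq X) = f ^ e * Q" and u: "u \<noteq> 0"
  obtains F where "sdet (peval F X) = u ^ e"
proof -
  obtain h where h: "(\<Prod>a\<in>#proots (ac_poly f). poly (ac_poly h) a) = to_ac u"
    using norm_surjective[OF f u] by blast
  let ?I = "{p. \<exists>a b. p = a * f + b * Q}"
  have mem: "f \<in> ?I" "Q \<in> ?I" by (force intro: exI[of _ 1] exI[of _ 0])+
  have f0: "f \<noteq> 0" using f(1) by auto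
  obtain g where g: "g \<in> ?I" "lead_coeff g = 1" "\<And>a. a \<in> ?I \<Longrightarrow> g dvd a"
  proof (rule poly_ideal_principal[of f ?I])
    fix x y assume "x \<in> ?I" "y \<in> ?I"
    then obtain a b a' b' where "x = a * f + b * Q" "y = a' * f + b' * Q" by blast
    then have "x + y = (a + a') * f + (b + b') * Q" by (simp add: algebra_simps)
    then show "x + y \<in> ?I" by blast
  next
    fix x c assume "x \<in> ?I"
    then obtain a b where "x = a * f + b * Q" by blast
    then have "c * x = (c * a) * f + (c * b) * Q" by (simp add: algebra_simps)
    then show "c * x \<in> ?I" by blast
  qed (use mem f0 in auto)
  have "is_unit g"
  proof (rule ccontr)
    assume "\<not> is_unit g"
    then have "f dvd g" using f(2) g(3)[OF mem(1)] by (metis irreducibleD')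
    then show False using g(3)[OF mem(2)] Q dvd_trans by blast
  qed
  then obtain c where "g = [:c:]" by (auto simp: is_unit_poly_iff)
  with g(2) have "g = 1" by (simp add: one_pCons)
  then obtain a b where ab: "a * f + b * Q = 1" using g(1) by auto
  have "ac_poly (a * f + b * Q) = ac_poly 1" using ab by simp
  then have ab': "ac_poly a * ac_poly f + ac_poly b * ac_poly Q = 1" by simp
  have ab'': "poly (ac_poly a) x * poly (ac_poly f) x + poly (ac_poly b) x * poly (ac_poly Q) x = 1" for x
    using arg_cong[OF ab', of "\<lambda>p. poly p x"] by simp
  let ?F = "h * b * Q + a * f"
  have "Q \<noteq> 0" using Q by auto
  then have nz: "ac_poly f \<noteq> 0" "ac_poly Q \<noteq> 0"
    using f0 by (metis degree_ac_poly lead_coeff_ac_poly leading_coeff_0_iff to_ac_eq_0_iff)+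
  have "(\<Prod>x\<in>#proots (ac_poly f). poly (ac_poly ?F) x) = (\<Prod>x\<in>#proots (ac_poly f). poly (ac_poly h) x)"
  proof (rule arg_cong[where f = prod_mset], rule image_mset_cong)
    fix x assume "x \<in># proots (ac_poly f)"
    then have "poly (ac_poly f) x = 0" using nz by simp
    then show "poly (ac_poly ?F) x = poly (ac_poly h) x" using ab''[of x] by (simp add: mult.assoc)
  qed
  moreover have "(\<Prod>x\<in>#proots (ac_poly Q). poly (ac_poly ?F) x) = (\<Prod>x\<in>#proots (ac_poly Q). 1)"
  proof (rule arg_cong[where f = prod_mset], rule image_mset_cong)
    fix x assume "x \<in># proots (ac_poly Q)"
    then have "poly (ac_poly Q) x = 0" using nz by simp
    then show "poly (ac_poly ?F) x = 1" using ab''[of x] by simp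
  qed
  ultimately have "to_ac (sdet (peval ?F X)) = to_ac (u ^ e)"
    using nz by (simp only: sdet_peval_ac cp ac_poly_simps) (simp add: proots_mult proots_power prod_mset_repeat h)
  then have "sdet (peval ?F X) = u ^ e" by (simp only: to_ac_eq_iff)
  then show ?thesis using that by blast
qed

subsection \<open>The type of a regular matrix\<close>

lemma finite_mtype_set:
  "finite {f :: 'k::{field,finite} poly. lead_coeff f = 1 \<and> irreducible f \<and> degree f = d \<and> R f}"
  by (rule finite_subset[OF _ card_polys_degree_less(2)[of "Suc d"]]) auto

text \<open>Every exponent in the factorization into distinct monic irreducibles shows up as a
  nonzero entry of \<open>mtype\<close>, so \<open>i\<close> divides all of them.\<close>

lemma charpoly_iota_power:
  fixes A :: "'k::{field,finite} ^ 'n ^ 'n"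
  assumes "\<And>d e. d \<ge> 1 \<Longrightarrow> e \<ge> 1 \<Longrightarrow> mtype A d e \<noteq> 0 \<Longrightarrow> i dvd e"
  obtains P where "charpoly A = P ^ i" "lead_coeff P = 1"
proof -
  have mon: "lead_coeff (charpoly A) = 1" using charpoly_monic[of A] by (rule conjunct2)
  obtain F e where F: "finite F" "\<And>f. f \<in> F \<Longrightarrow> lead_coeff f = 1 \<and> irreducible f \<and> e f > 0"
    and cp: "charpoly A = (\<Prod>f\<in>F. f ^ e f)"
    using monic_poly_factorization[OF mon] by metis
  have div: "i dvd e f" if f: "f \<in> F" for f
  proof -
    have cpf: "charpoly A = f ^ e f * (\<Prod>g\<in>F - {f}. g ^ e g)"
      unfolding cp using F(1) f by (rule prod.remove)
    have nd: "\<not> f dvd (\<Prod>g\<in>F - {f}. g ^ e g)"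
      using F f by (intro monic_irreducible_dvd_prod) auto
    have f0: "f \<noteq> 0" using F(2)[OF f] by auto
    have "\<not> f ^ Suc (e f) dvd charpoly A"
    proof
      assume "f ^ Suc (e f) dvd charpoly A"
      then have "f ^ e f * f dvd f ^ e f * (\<Prod>g\<in>F - {f}. g ^ e g)" unfolding cpf by (simp add: mult.commute)
      then show False using nd f0 by (metis dvd_times_left_cancel_iff power_not_zero)
    qed
    then have mem: "f \<in> {g. lead_coeff g = 1 \<and> irreducible g \<and> degree g = degree f \<and> g ^ e f dvd charpoly A \<and> \<not> g ^ Suc (e f) dvd charpoly A}"
      (is "_ \<in> ?S") using F(2)[OF f] cpf by auto
    have "finite ?S" by (rule finite_mtype_set)
    then have "mtype A (degree f) (e f) \<noteq> 0"
      unfolding mtype_def using mem card_0_eq by blast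
    moreover have "degree f \<ge> 1" using F(2)[OF f] by (simp add: monic_irreducible_degree_pos Suc_leI)
    ultimately show ?thesis using assms F(2)[OF f] by (simp add: Suc_leI)
  qed
  let ?P = "\<Prod>f\<in>F. f ^ (e f div i)"
  have "?P ^ i = (\<Prod>f\<in>F. (f ^ (e f div i)) ^ i)" by (rule prod_power_distrib)
  also have "\<dots> = charpoly A" unfolding cp
    by (rule prod.cong) (use div in \<open>auto simp flip: power_mult\<close>)
  finally have "charpoly A = ?P ^ i" ..
  moreover have "lead_coeff ?P = 1"
    using F(2) by (simp add: lead_coeff_prod lead_coeff_power)
  ultimately show ?thesis using that by blast
qed

lemma mtype_nonzero_factor:
  fixes A :: "'k::{field,finite} ^ 'n ^ 'n"
  assumes "mtype A d e \<noteq> 0"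
  obtains f Q where "lead_coeff f = 1" "irreducible f" "\<not> f dvd Q" "charpoly A = f ^ e * Q"
proof -
  have "{f. lead_coeff f = 1 \<and> irreducible f \<and> degree f = d \<and> f ^ e dvd charpoly A \<and> \<not> f ^ Suc e dvd charpoly A} \<noteq> {}"
    using assms unfolding mtype_def by (metis card.empty)
  then obtain f where f: "lead_coeff f = 1" "irreducible f" "f ^ e dvd charpoly A" "\<not> f ^ Suc e dvd charpoly A"
    by blast
  then obtain Q where Q: "charpoly A = f ^ e * Q" by (auto simp: dvd_def)
  have "\<not> f dvd Q"
  proof
    assume "f dvd Q"
    then have "f ^ e * f dvd f ^ e * Q" by (rule mult_dvd_mono[OF dvd_refl])
    then show False using f(4) Q by (simp add: mult.commute)
  qed
  then show ?thesis using that f Q by blast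
qed

section \<open>Matrices over a finite chain ring\<close>

locale chain_ring =
  fixes w :: "'o::idom" and l :: nat
    and pr :: "'o \<Rightarrow> 'r::{comm_ring_1,finite}" and red :: "'o \<Rightarrow> 'k::{field,finite}"
  assumes unif: "is_uniformizer w" and qred: "quotient_map w 1 red" and qpr: "quotient_map w l pr"
    and l_ge: "l \<ge> 2"
begin

lemma hom_pr: "is_ring_hom pr" and surj_pr: "surj pr" and pr_0: "pr x = 0 \<longleftrightarrow> w ^ l dvd x"
  using qpr by (auto simp: quotient_map_def)

lemma hom_red: "is_ring_hom red" and surj_red: "surj red" and red_0: "red x = 0 \<longleftrightarrow> w dvd x"
  using qred by (auto simp: quotient_map_def)

lemma w_nonzero: "w \<noteq> 0"
  using unif by (simp add: is_uniformizer_def)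

text \<open>The residue map of the truncated ring, through an arbitrary lift to \<open>'o\<close>;
  two lifts differ by a multiple of \<open>w ^ l\<close>, hence of \<open>w\<close>.\<close>

definition rd :: "'r \<Rightarrow> 'k" where "rd x = red (SOME y. pr y = x)"

lemma rd_pr [simp]: "rd (pr x) = red x"
proof -
  let ?y = "SOME y. pr y = pr x"
  have "pr ?y = pr x" by (rule someI[of _ x]) simp
  then have "pr (?y - x) = 0" by (simp add: is_ring_homD[OF hom_pr])
  then have "w ^ l dvd ?y - x" by (simp add: pr_0)
  then have "w dvd ?y - x" using l_ge by (metis dvd_power dvd_trans not_numeral_le_zero not_gr_zero)
  then have "red (?y - x) = 0" by (simp add: red_0)
  then show ?thesis by (simp add: rd_def is_ring_homD[OF hom_red])
qed

lemma pr_cases: obtains x where "c = pr x"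
  using surj_pr by (metis surjD)

lemma hom_rd: "is_ring_hom rd"
proof -
  have "rd (a + b) = rd a + rd b \<and> rd (a * b) = rd a * rd b" for a b
  proof -
    obtain x y where "a = pr x" "b = pr y" by (metis pr_cases)
    then show ?thesis by (simp add: is_ring_homD[OF hom_red] flip: is_ring_homD[OF hom_pr])
  qed
  moreover have "rd 1 = 1" using rd_pr[of 1] by (simp add: is_ring_homD[OF hom_red] is_ring_homD[OF hom_pr])
  ultimately show ?thesis by (simp add: is_ring_hom_def)
qed

lemma surj_rd: "surj rd"
  using surj_red by (metis rd_pr surj_def)

definition W :: 'r where "W = pr w"

lemma pr_w_power: "pr (w ^ j) = W ^ j"
  by (simp add: W_def is_ring_hom_power[OF hom_pr])

lemma W_nil: "W ^ l = 0"
  by (simp add: pr_0 flip: pr_w_power)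

lemma W_annihilator:
  assumes "W ^ j * c = 0" "j \<le> l"
  obtains d where "c = W ^ (l - j) * d"
proof -
  obtain x where x: "c = pr x" by (rule pr_cases)
  have "pr (w ^ j * x) = 0" using assms(1) by (simp add: x pr_w_power is_ring_homD[OF hom_pr])
  then have "w ^ j * w ^ (l - j) dvd w ^ j * x" using assms(2) by (simp add: pr_0 flip: power_add)
  then have "w ^ (l - j) dvd x" using w_nonzero by simp
  then obtain y where "x = w ^ (l - j) * y" by (auto simp: dvd_def)
  then have "c = W ^ (l - j) * pr y" by (simp add: x pr_w_power is_ring_homD[OF hom_pr])
  then show ?thesis by (rule that)
qed

text \<open>Every nonzero ideal contains the minimal one, generated by \<open>W ^ (l - 1)\<close>,
  and there the additive character is known to be nontrivial.\<close>

lemma chain_ring_socle: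
  assumes "c \<noteq> 0"
  obtains d where "c * d = W ^ (l - 1)"
proof -
  obtain x where x: "c = pr x" by (rule pr_cases)
  have "x \<noteq> 0" using assms x by (auto simp: is_ring_homD[OF hom_pr])
  then obtain u k where uk: "u dvd 1" "x = u * w ^ k" using unif by (auto simp: is_uniformizer_def)
  have "k < l"
  proof (rule ccontr)
    assume "\<not> k < l"
    then have "w ^ l dvd x" unfolding uk by (simp add: le_imp_power_dvd)
    then show False using assms x pr_0 by simp
  qed
  obtain v where v: "1 = u * v" using uk(1) by (rule dvdE)
  have "x * (v * w ^ (l - 1 - k)) = (u * v) * (w ^ k * w ^ (l - 1 - k))" by (simp add: uk mult_ac)
  also have "\<dots> = w ^ (l - 1)" using v \<open>k < l\<close> by (simp flip: power_add)
  finally have "c * pr (v * w ^ (l - 1 - k)) = W ^ (l - 1)"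
    by (simp add: x flip: is_ring_homD[OF hom_pr] pr_w_power)
  then show ?thesis by (rule that)
qed

lemma rd_0: "rd c = 0 \<longleftrightarrow> (\<exists>d. c = W * d)"
proof -
  obtain x where x: "c = pr x" by (rule pr_cases)
  show ?thesis
  proof
    assume "rd c = 0"
    then obtain y where "x = w * y" by (auto simp: x red_0 dvd_def)
    then show "\<exists>d. c = W * d" by (auto simp: x W_def is_ring_homD[OF hom_pr])
  next
    assume "\<exists>d. c = W * d"
    then obtain d where "c = W * d" by blast
    moreover have "red w = 0" by (simp add: red_0)
    ultimately show "rd c = 0" by (simp add: W_def is_ring_homD[OF hom_rd])
  qed
qed

lemma unit_iff_rd: "c dvd 1 \<longleftrightarrow> rd c \<noteq> 0"
proof
  assume "c dvd 1"
  then obtain d where "1 = c * d" by (rule dvdE)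
  then have "rd c * rd d = 1" by (metis is_ring_homD(2,3)[OF hom_rd])
  then show "rd c \<noteq> 0" by auto
next
  assume c: "rd c \<noteq> 0"
  obtain x where x: "c = pr x" by (rule pr_cases)
  have "x \<noteq> 0" using c x by (auto simp: is_ring_homD[OF hom_red])
  then obtain u k where uk: "u dvd 1" "x = u * w ^ k" using unif by (auto simp: is_uniformizer_def)
  have "k = 0"
  proof (rule ccontr)
    assume "k \<noteq> 0"
    then have "w dvd x" unfolding uk by (simp add: dvd_power)
    then show False using c x red_0 by simp
  qed
  then obtain v where "1 = x * v" using uk by (auto simp: dvd_def)
  then have "c * pr v = 1" by (metis x is_ring_homD(2,3)[OF hom_pr])
  then show "c dvd 1" by (metis dvd_triv_left)
qed

definition wm :: "('r, 'n::finite) sq" where "wm = smat W"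

lemma wm_central: "wm * Y = Y * wm"
  by (simp add: wm_def smat_central)

lemma wm_power: "wm ^ j = smat (W ^ j)"
  by (simp add: wm_def smat_power)

lemma wm_nil: "wm ^ l = 0"
  by (simp add: wm_power W_nil)

lemma wm_annihilator:
  assumes "wm ^ j * Y = 0" "j \<le> l"
  obtains V where "Y = wm ^ (l - j) * V"
proof -
  have "\<exists>d. of_sq Y $ a $ b = W ^ (l - j) * d" for a b
  proof -
    have "of_sq (wm ^ j * Y) $ a $ b = 0" using assms(1) by simp
    then have "W ^ j * of_sq Y $ a $ b = 0" by (simp add: wm_power del: of_sq_simps)
    then show ?thesis using W_annihilator assms(2) by metis
  qed
  then obtain f where f: "of_sq Y $ a $ b = W ^ (l - j) * f a b" for a b by metis
  have "Y = wm ^ (l - j) * to_sq (\<chi> a b. f a b)"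
    by (rule sq_eqI) (simp add: f wm_power del: of_sq_simps)
  then show ?thesis by (rule that)
qed

lemma smap_rd_0: "smap rd A = 0 \<longleftrightarrow> (\<exists>V. A = wm * V)"
proof
  assume z: "smap rd A = 0"
  have "\<exists>d. of_sq A $ a $ b = W * d" for a b
  proof -
    have "of_sq (smap rd A) $ a $ b = 0" using z by simp
    then show ?thesis by (simp add: rd_0)
  qed
  then obtain f where f: "of_sq A $ a $ b = W * f a b" for a b by metis
  have "A = wm * to_sq (\<chi> a b. f a b)"
    by (rule sq_eqI) (simp add: f wm_def del: of_sq_simps)
  then show "\<exists>V. A = wm * V" ..
next
  assume "\<exists>V. A = wm * V"
  then obtain V where "A = wm * V" by blast
  moreover have "rd W = 0" using rd_0[of W] by (metis mult.right_neutral)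
  ultimately show "smap rd A = 0" by (simp add: smap_hom[OF hom_rd] wm_def)
qed

lemma smap_surj:
  assumes "surj f"
  obtains A where "B = smap f A"
proof
  show "B = smap f (to_sq (\<chi> i j. inv_into UNIV f (of_sq B $ i $ j)))"
    by (rule sq_eqI) (simp add: surj_f_inv_f[OF assms])
qed

lemma one_plus_wm_unit: "1 + wm * V \<in> unit_set"
proof (rule one_plus_nilpotent_unit)
  have "(wm * V) ^ n = wm ^ n * V ^ n" for n
  proof (induction n)
    case (Suc n)
    have "(wm * V) ^ Suc n = wm * (V * wm ^ n) * V ^ n" using Suc by (simp add: mult.assoc)
    also have "V * wm ^ n = wm ^ n * V" by (simp add: wm_power smat_central)
    finally show ?case by (simp add: mult.assoc)
  qed simp
  then show "(wm * V) ^ l = 0" by (simp add: wm_nil)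
qed

text \<open>The inverse of the residual matrix lifts to some \<open>B\<close>; both
  \<open>A * B\<close> and \<open>B * A\<close> are 1 modulo the uniformizer, hence units, and the
  one-sided inverses they yield coincide.\<close>

lemma unit_set_iff:
  fixes A :: "('r, 'n::finite) sq"
  shows "A \<in> unit_set \<longleftrightarrow> sdet A dvd 1"
proof
  assume "A \<in> unit_set"
  then have "sdet A * sdet (uinv A) = 1" by (metis sdet_1 sdet_mult uinv_right)
  then show "sdet A dvd 1" by (metis dvd_triv_left)
next
  assume "sdet A dvd 1"
  then have "sdet (smap rd A) \<noteq> 0" by (simp add: unit_iff_rd sdet_smap[OF hom_rd])
  then have "invertible (of_sq (smap rd A))" by (simp add: sdet_def invertible_det_nz)
  then obtain B' where "of_sq (smap rd A) ** B' = mat 1" "B' ** of_sq (smap rd A) = mat 1"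
    by (auto simp: invertible_def)
  then have B': "smap rd A * to_sq B' = 1" "to_sq B' * smap rd A = 1" by (simp_all add: sq_eq_iff)
  obtain B where B: "to_sq B' = smap rd B" by (rule smap_surj[OF surj_rd])
  have "smap rd (A * B - 1) = 0" "smap rd (B * A - 1) = 0"
    using B' by (simp_all add: smap_hom[OF hom_rd] B)
  then obtain V V' where "A * B - 1 = wm * V" "B * A - 1 = wm * V'" by (auto simp: smap_rd_0)
  then have V: "A * B = 1 + wm * V" "B * A = 1 + wm * V'" by (auto simp: algebra_simps)
  have u: "A * B \<in> unit_set" "B * A \<in> unit_set" unfolding V by (rule one_plus_wm_unit)+
  let ?C = "B * uinv (A * B)" and ?C' = "uinv (B * A) * B"
  have r: "A * ?C = 1" using u(1) by (simp flip: mult.assoc)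
  have l: "?C' * A = 1" using u(2) by (simp add: mult.assoc)
  have "?C' = ?C' * (A * ?C)" using r by simp
  also have "\<dots> = ?C" using l by (simp flip: mult.assoc)
  finally show "A \<in> unit_set" using r l by (intro unit_setI[of _ ?C]) simp_all
qed

lemma unit_set_rd:
  fixes A :: "('r, 'n::finite) sq"
  shows "A \<in> unit_set \<longleftrightarrow> rd (sdet A) \<noteq> 0"
  by (simp add: unit_set_iff unit_iff_rd)

lemma lift_poly:
  obtains p where "map_poly rd p = q"
proof
  let ?s = "\<lambda>c. if c = 0 then 0 else inv_into UNIV rd c"
  show "map_poly rd (map_poly ?s q) = q"
    by (rule poly_eqI) (simp add: coeff_map_poly is_ring_homD[OF hom_rd] surj_f_inv_f[OF surj_rd])
qed

text \<open>Modulo the uniformizer \<open>g\<close> is a polynomial in the regular residual matrix.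
  Subtracting a lift of that polynomial leaves a multiple of \<open>wm\<close>, and the cofactor
  commutes with \<open>Z\<close> modulo one power less, so the induction hypothesis applies to
  it.\<close>

lemma centralizer_mod:
  fixes Z :: "('r, 'n::finite) sq"
  assumes reg: "regular_mat (of_sq (smap rd Z))"
    and "i \<le> l" "g * Z - Z * g = wm ^ i * V"
  shows "\<exists>p Y. g = peval p Z + wm ^ i * Y"
  using assms(2,3)
proof (induction i arbitrary: g V)
  case 0
  show ?case by (rule exI[of _ 0], rule exI[of _ g]) simp
next
  case (Suc i)
  have "smap rd (g * Z - Z * g) = 0"
    unfolding smap_rd_0 Suc.prems(2) by (auto simp: mult.assoc)
  then have "smap rd g * smap rd Z = smap rd Z * smap rd g" by (simp add: smap_hom[OF hom_rd])
  then obtain q where q: "smap rd g = peval q (smap rd Z)" using regular_centralizer[OF reg] by blast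
  obtain q' where q': "map_poly rd q' = q" by (rule lift_poly)
  have "smap rd (g - peval q' Z) = 0"
    by (simp add: smap_hom[OF hom_rd] smap_peval[OF hom_rd] q q')
  then obtain g' where "g - peval q' Z = wm * g'" by (auto simp: smap_rd_0)
  then have g': "g = peval q' Z + wm * g'" by (simp add: algebra_simps)
  have "wm * (g' * Z - Z * g') = g * Z - Z * g"
  proof -
    have "Z * (wm * g') = wm * (Z * g')" by (simp add: wm_def smat_left_commute)
    then show ?thesis
      unfolding g' by (simp add: distrib_left distrib_right right_diff_distrib mult.assoc peval_commute_base)
  qed
  then have "wm ^ 1 * (g' * Z - Z * g' - wm ^ i * V) = 0"
    using Suc.prems(2) by (simp add: right_diff_distrib mult.assoc)
  \<comment> \<open>Cancelling \<open>wm\<close> determines the commutator only up to level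
    \<open>l - 1\<close>; this is harmless because \<open>i \<le> l - 1\<close>.\<close>
  then obtain V' where V': "g' * Z - Z * g' - wm ^ i * V = wm ^ (l - 1) * V'"
    using wm_annihilator l_ge by (metis one_le_numeral order_trans)
  have "(wm :: ('r, 'n) sq) ^ (l - 1) = wm ^ i * wm ^ (l - 1 - i)" using Suc.prems(1) by (simp flip: power_add)
  with V' have "g' * Z - Z * g' - wm ^ i * V = wm ^ i * (wm ^ (l - 1 - i) * V')"
    by (simp only: mult.assoc)
  then have "g' * Z - Z * g' = wm ^ i * (V + wm ^ (l - 1 - i) * V')"
    by (simp add: algebra_simps)
  then obtain p Y where pY: "g' = peval p Z + wm ^ i * Y" using Suc.IH Suc.prems(1) by (metis Suc_leD)
  have "g = peval (q' + smult W p) Z + wm ^ Suc i * Y"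
    unfolding g' pY peval_add peval_smult wm_def by (simp add: distrib_left mult.assoc)
  then show ?case by blast
qed

lemma centralizer_annihilated:
  fixes Z :: "('r, 'n::finite) sq"
  assumes reg: "regular_mat (of_sq (smap rd Z))"
    and "j \<le> l" "wm ^ j * (g * Z - Z * g) = 0"
  shows "\<exists>p Y. g = peval p Z + wm ^ (l - j) * Y"
proof -
  obtain V where "g * Z - Z * g = wm ^ (l - j) * V" using wm_annihilator assms(2,3) by blast
  then show ?thesis using centralizer_mod[OF reg] by (metis diff_le_self)
qed

lemma of_nat_residue_char:
  assumes "prime p" "p dvd CARD('k)"
  obtains c where "(of_nat p :: ('r, 'n::finite) sq) = wm * c" and "p = CHAR('k)"
proof -
  obtain s where s: "CARD('k) = CHAR('k) ^ s" by (rule card_finite_field_power_CHAR)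
  then have "p dvd CHAR('k)" using assms prime_dvd_power by metis
  then have p: "p = CHAR('k)" using assms(1) prime_CHAR_finite[where 'k = 'k] by (simp add: primes_dvd_imp_eq)
  then have "rd (of_nat p) = 0" by (simp add: is_ring_hom_of_nat[OF hom_rd])
  then obtain d where "of_nat p = W * d" by (auto simp: rd_0)
  then have "(of_nat p :: ('r, 'n) sq) = wm * smat d" by (simp add: of_nat_sq wm_def smat_mult)
  then show ?thesis using p by (rule that)
qed

end

section \<open>The matrix character and Schur's lemma\<close>

definition mat_char :: "('r::comm_ring_1 \<Rightarrow> complex) \<Rightarrow> ('r, 'n::finite) sq \<Rightarrow> complex" where
  "mat_char ps Y = ps (trace (of_sq Y))"

context chain_ring
begin

text \<open>A nonzero entry of \<open>X\<close> can be multiplied into the minimal ideal, and a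
  matrix with a single nonzero entry picks it out of the trace.\<close>

lemma mat_char_nondeg:
  assumes add: "\<And>a b. ps (a + b) = ps a * ps b" and nt: "ps (pr (w ^ (l - 1) * a)) \<noteq> 1"
    and triv: "\<And>Y. mat_char ps (X * Y) = 1"
  shows "X = (0 :: ('r, 'n::finite) sq)"
proof (rule ccontr)
  assume "X \<noteq> 0"
  then obtain i j where "of_sq X $ i $ j \<noteq> 0" using sq_eqI[of X 0] by auto
  then obtain d where d: "of_sq X $ i $ j * d = W ^ (l - 1)" by (rule chain_ring_socle)
  let ?Y = "to_sq (\<chi> b c. if b = j \<and> c = i then d * pr a else 0)"
  have "trace (of_sq (X * ?Y)) = (\<Sum>c\<in>UNIV. if c = i then \<Sum>b\<in>UNIV. if b = j then of_sq X $ c $ b * (d * pr a) else 0 else 0)"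
    unfolding trace_def of_sq_mult_nth by (intro sum.cong refl) (auto intro!: sum.cong simp del: sum.delta sum.delta')
  also have "\<dots> = of_sq X $ i $ j * d * pr a"
    by (simp add: mult.assoc if_distrib[of "\<lambda>x. _ * x"] cong: if_cong)
  also have "\<dots> = pr (w ^ (l - 1) * a)" unfolding d by (simp add: pr_w_power is_ring_homD[OF hom_pr])
  finally show False using triv[of ?Y] nt by (simp add: mat_char_def)
qed

end

lemma kernel_subspace: "vec.subspace {v. A *v v = (0 :: complex ^ 'm)}"
  by (simp add: vec.subspace_def matrix_vector_right_distrib vector_scalar_commute)

text \<open>Stated through invariance of the kernel, so that it also applies to operators commuting
  with \<open>\<rho>\<close> only up to a character.\<close>

lemma irreducible_kernel:
  fixes \<rho> :: "'r::comm_ring_1 ^ 'n ^ 'n \<Rightarrow> complex ^ 'm ^ 'm"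
    and A :: "complex ^ 'm ^ 'm"
  assumes irr: "irreducible_rep \<rho>" and inv: "\<And>g v. g \<in> GLn \<Longrightarrow> A *v v = 0 \<Longrightarrow> A *v (\<rho> g *v v) = 0"
  shows "A = 0 \<or> invertible A"
proof -
  let ?K = "{v. A *v v = 0}"
  have "?K = {0} \<or> ?K = UNIV"
    using irr kernel_subspace[of A] inv unfolding irreducible_rep_def by blast
  then show ?thesis
  proof
    assume "?K = {0}"
    then have "\<exists>B. B ** A = mat 1" by (auto simp: matrix_left_invertible_ker)
    then show ?thesis by (meson invertible_left_inverse)
  next
    assume "?K = UNIV"
    then have "A *v v = 0 *v v" for v by auto
    then show ?thesis by (auto simp: matrix_eq)
  qed
qed

lemma irreducible_schur:
  fixes \<rho> :: "'r::comm_ring_1 ^ 'n ^ 'n \<Rightarrow> complex ^ 'm ^ 'm"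
  assumes irr: "irreducible_rep \<rho>" and comm: "\<And>g. g \<in> GLn \<Longrightarrow> B ** \<rho> g = \<rho> g ** B"
  obtains c where "B = mat c"
proof -
  have "degree (charpoly B) > 0" using charpoly_monic[of B] by simp
  then obtain c where "poly (charpoly B) c = 0" using alg_closed_imp_poly_has_root by blast
  then have d: "det (mat c - B) = 0" using sdet_linear[of c "to_sq B"] by (simp add: sdet_def)
  have "mat c - B = 0 \<or> invertible (mat c - B)"
  proof (rule irreducible_kernel[OF irr])
    fix g :: "'r ^ 'n ^ 'n" and v assume g: "g \<in> GLn" "(mat c - B) *v v = 0"
    have "mat c ** \<rho> g = \<rho> g ** mat c"
      using smat_central[of c "to_sq (\<rho> g)"] by (simp add: sq_eq_iff)
    then have "(mat c - B) ** \<rho> g = \<rho> g ** (mat c - B)"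
      using comm[OF g(1)] right_diff_distrib[of "to_sq (\<rho> g)" "smat c" "to_sq B"]
        left_diff_distrib[of "smat c" "to_sq B" "to_sq (\<rho> g)"] by (simp add: sq_eq_iff)
    then show "(mat c - B) *v (\<rho> g *v v) = 0"
      using g(2) by (simp add: matrix_vector_mul_assoc) (simp flip: matrix_vector_mul_assoc)
  qed
  then have "mat c = B" using d by (auto simp: invertible_det_nz)
  then show ?thesis using that by blast
qed

definition srep :: "('r::comm_ring_1 ^ 'n ^ 'n \<Rightarrow> complex ^ 'm ^ 'm) \<Rightarrow> ('r, 'n::finite) sq \<Rightarrow> (complex, 'm::finite) sq" where
  "srep \<rho> A = to_sq (\<rho> (of_sq A))"

definition cscl :: "complex \<Rightarrow> (complex, 'm::finite) sq \<Rightarrow> (complex, 'm) sq" where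
  "cscl c A = smat c * A"

context chain_ring
begin

lemma unit_set_GLn:
  fixes A :: "('r, 'n::finite) sq"
  shows "A \<in> unit_set \<longleftrightarrow> of_sq A \<in> GLn"
  by (simp add: unit_set_iff GLn_def sdet_def)

lemma unit_rep_srep:
  fixes \<rho> :: "'r ^ 'n ^ 'n \<Rightarrow> complex ^ 'm ^ 'm"
  assumes irr: "irreducible_rep \<rho>" and add: "\<And>a b. ps (a + b) = ps a * ps b" and ps0: "ps 0 = 1"
    and nt: "ps (pr (w ^ (l - 1) * a)) \<noteq> 1"
  shows "unit_rep (srep \<rho>) cscl (mat_char ps) (wm :: ('r, 'n) sq) l"
proof
  have rep: "is_rep \<rho>" using irr by (simp add: irreducible_rep_def)
  show "srep \<rho> 1 = 1" using rep by (simp add: srep_def is_rep_def one_sq_def)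
  show "srep \<rho> (g * h) = srep \<rho> g * srep \<rho> h" if "g \<in> unit_set" "h \<in> unit_set" for g h
    using rep that by (simp add: srep_def is_rep_def unit_set_GLn sq_eq_iff)
  show "\<exists>c. B = cscl c 1" if "\<And>g. g \<in> unit_set \<Longrightarrow> B * srep \<rho> g = srep \<rho> g * B" for B
  proof -
    have "of_sq B ** \<rho> g = \<rho> g ** of_sq B" if "g \<in> GLn" for g
      using \<open>\<And>g. g \<in> unit_set \<Longrightarrow> _\<close>[of "to_sq g"] that by (simp add: unit_set_GLn srep_def sq_eq_iff)
    then obtain c where "of_sq B = mat c" using irreducible_schur[OF irr] by blast
    then show ?thesis by (auto simp: cscl_def sq_eq_iff)
  qed
  show "mat_char ps (X + Y) = mat_char ps X * mat_char ps Y" for X Y :: "('r, 'n) sq"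
    by (simp add: mat_char_def trace_add add)
  show "mat_char ps 0 = 1" by (simp add: mat_char_def trace_def ps0)
  show "mat_char ps (X * Y) = mat_char ps (Y * X)" for X Y :: "('r, 'n) sq"
    unfolding mat_char_def of_sq_simps by (subst trace_mul_sym) (rule refl)
  show "X = 0" if "\<And>Y. mat_char ps (X * Y) = 1" for X :: "('r, 'n) sq"
    using mat_char_nondeg[OF add nt that] .
  show "wm * X = X * wm" for X :: "('r, 'n) sq" by (rule wm_central)
  show "(wm :: ('r, 'n) sq) ^ l = 0" by (rule wm_nil)
  fix c d :: complex and A B :: "(complex, 'm) sq"
  show "A * cscl c B = cscl c (A * B)" unfolding cscl_def by (rule smat_left_commute)
  show "cscl c A * B = cscl c (A * B)" unfolding cscl_def by (rule mult.assoc)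
  show "cscl c (cscl d A) = cscl (c * d) A" unfolding cscl_def smat_mult by (rule mult.assoc[symmetric])
  show "cscl 1 A = A" by (simp add: cscl_def)
  show "cscl (c + d) A = cscl c A + cscl d A" unfolding cscl_def smat_add by (rule distrib_right)
  show "cscl c (A + B) = cscl c A + cscl c B" unfolding cscl_def by (rule distrib_left)
qed

end

section \<open>Cyclic gradings\<close>

text \<open>The multiplicative order of \<open>z\<close> is exactly \<open>n\<close>, in the form
  that orthogonality sums consume.\<close>

definition primitive_root :: "nat \<Rightarrow> complex \<Rightarrow> bool" where
  "primitive_root n z \<longleftrightarrow> (\<forall>k. z ^ k = 1 \<longleftrightarrow> n dvd k)"

lemma primitive_root_cis:
  assumes "n > 0"
  shows "primitive_root n (cis (2 * pi / n))"
  unfolding primitive_root_def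
proof (intro allI)
  fix k
  let ?z = "cis (2 * pi / n)"
  have pow: "?z ^ j = cis (2 * pi * real j / real n)" for j
    by (subst Complex.DeMoivre) (simp add: field_simps)
  have "?z ^ n = 1" unfolding pow using assms by simp
  then have "?z ^ k = ?z ^ (k mod n)"
    by (metis mod_mult_div_eq mult.right_neutral power_add power_mult power_one)
  then have "?z ^ k = 1 \<longleftrightarrow> cis (2 * pi * real (k mod n) / real n) = cis (2 * pi * real 0 / real n)"
    unfolding pow by simp
  also have "\<dots> \<longleftrightarrow> k mod n = 0"
    using Complex.bij_betw_roots_unity[OF assms] assms
    by (auto simp: bij_betw_def inj_on_def)
  finally show "?z ^ k = 1 \<longleftrightarrow> n dvd k" by (simp add: mod_eq_0_iff_dvd)
qed

lemma primitive_root_inverse: "primitive_root n z \<Longrightarrow> primitive_root n (inverse z)"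
  by (simp add: primitive_root_def power_inverse)

lemma primitive_root_power_self: "primitive_root n z \<Longrightarrow> z ^ n = 1"
  by (simp add: primitive_root_def)

lemma primitive_root_nonzero: "primitive_root n z \<Longrightarrow> n > 0 \<Longrightarrow> z \<noteq> 0"
  using primitive_root_power_self[of n z] by (cases "z = 0") (auto simp: power_0_left)

lemma primitive_root_inj:
  assumes z: "primitive_root n z"
  shows "inj_on (\<lambda>j. z ^ j) {..<n}"
proof (rule linorder_inj_onI)
  fix a b assume ab: "a < b" "a \<in> {..<n}" "b \<in> {..<n}"
  show "z ^ a \<noteq> z ^ b"
  proof
    assume "z ^ a = z ^ b"
    moreover have "z ^ a * z ^ (b - a) = z ^ b" using ab(1) by (simp flip: power_add)
    moreover have "z \<noteq> 0" using primitive_root_nonzero[OF z] ab by auto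
    ultimately have "z ^ (b - a) = 1" by simp
    then have "n dvd b - a" using z by (simp add: primitive_root_def)
    then show False using ab by (auto dest: dvd_imp_le)
  qed
qed auto

lemma sum_primitive_root:
  assumes "primitive_root n z"
  shows "(\<Sum>i<n. z ^ (k * i)) = (if n dvd k then of_nat n else 0)"
proof (cases "n dvd k")
  case True
  then have "z ^ k = 1" using assms by (simp add: primitive_root_def)
  then show ?thesis using True by (simp add: power_mult)
next
  case False
  then have ne: "z ^ k \<noteq> 1" using assms by (simp add: primitive_root_def)
  have "(\<Sum>i<n. z ^ (k * i)) = (\<Sum>i<n. (z ^ k) ^ i)" by (simp add: power_mult)
  also have "\<dots> = ((z ^ k) ^ n - 1) / (z ^ k - 1)" by (rule geometric_sum[OF ne])
  also have "(z ^ k) ^ n = 1"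
    using primitive_root_power_self[OF assms] by (metis mult.commute power_mult power_one)
  finally show ?thesis using False by simp
qed

lemma sum_shift_periodic:
  fixes g :: "nat \<Rightarrow> 'a::ab_group_add"
  assumes "g n = g 0"
  shows "(\<Sum>i<n. g (Suc i)) = (\<Sum>i<n. g i)"
  using sum.lessThan_Suc_shift[of g n] assms by simp

text \<open>\<open>ES\<close> is graded by the eigenvalues of \<open>gm\<close>. The last three
  assumptions say that degree 1 consists of scalars, that only m-th roots of unity occur as degrees,
  and that a primitive one occurs with an invertible element; so \<open>ES\<close> is spanned by the
  powers of one element.\<close>

locale cyclic_grading = complex_scalars scl
  for scl :: "complex \<Rightarrow> 'e::ring_1 \<Rightarrow> 'e" (infixr "\<odot>" 75) +
  fixes ES :: "'e set" and gm :: "'e \<Rightarrow> 'e" and N m :: nat and z :: complex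
  assumes ES_add: "S \<in> ES \<Longrightarrow> T \<in> ES \<Longrightarrow> S + T \<in> ES" and ES_scl: "T \<in> ES \<Longrightarrow> c \<odot> T \<in> ES"
    and ES_mult: "S \<in> ES \<Longrightarrow> T \<in> ES \<Longrightarrow> S * T \<in> ES" and ES_one: "1 \<in> ES"
    and gm_add: "gm (S + T) = gm S + gm T" and gm_mult: "gm (S * T) = gm S * gm T"
    and gm_scl: "gm (c \<odot> T) = c \<odot> gm T" and gm_one: "gm 1 = 1"
    and gm_ES: "T \<in> ES \<Longrightarrow> gm T \<in> ES" and gm_N: "T \<in> ES \<Longrightarrow> (gm ^^ N) T = T"
    and N_pos: "N > 0" and m_pos: "m > 0" and z: "primitive_root m z"
    and fixed_scalar: "T \<in> ES \<Longrightarrow> gm T = T \<Longrightarrow> \<exists>c. T = c \<odot> 1"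
    and eigenvalue: "T \<in> ES \<Longrightarrow> T \<noteq> 0 \<Longrightarrow> gm T = c \<odot> T \<Longrightarrow> c ^ m = 1"
    and eigenvector: "\<exists>U V. U \<in> ES \<and> U * V = 1 \<and> V * U = 1 \<and> gm U = z \<odot> U"
begin

lemma ES_sum: "(\<And>i. i \<in> I \<Longrightarrow> f i \<in> ES) \<Longrightarrow> sum f I \<in> ES"
proof (induction I rule: infinite_finite_induct)
  case empty
  show ?case using ES_scl[OF ES_one, of 0] by simp
next
  case (infinite I)
  show ?case using ES_scl[OF ES_one, of 0] infinite by simp
qed (simp add: ES_add)

lemma ES_power: "T \<in> ES \<Longrightarrow> T ^ n \<in> ES"
  by (induction n) (simp_all add: ES_one ES_mult)

lemma gm_zero: "gm 0 = 0"
  using gm_scl[of 0 0] by simp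

lemma gm_sum: "gm (sum f I) = (\<Sum>i\<in>I. gm (f i))"
  by (induction I rule: infinite_finite_induct) (simp_all add: gm_zero gm_add)

lemma gm_power: "gm (T ^ n) = gm T ^ n"
  by (induction n) (simp_all add: gm_one gm_mult)

lemma gm_funpow_ES: "T \<in> ES \<Longrightarrow> (gm ^^ n) T \<in> ES"
  by (induction n) (simp_all add: gm_ES)

text \<open>\<open>U ^ m\<close> has eigenvalue \<open>z ^ m = 1\<close>, so it is a scalar, nonzero
  because \<open>U\<close> is invertible; an m-th root of it is divided out. This is where a
  possible twist of the group algebra disappears.\<close>

lemma normalized_eigenvector:
  obtains U where "U \<in> ES" "gm U = z \<odot> U" "U ^ m = 1"
proof -
  obtain U V where U: "U \<in> ES" "U * V = 1" "V * U = 1" "gm U = z \<odot> U" using eigenvector by blast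
  have "gm (U ^ m) = U ^ m" using U(4) by (simp add: gm_power scl_power primitive_root_power_self[OF z])
  then obtain c where c: "U ^ m = c \<odot> 1" using fixed_scalar ES_power U(1) by blast
  have "U ^ n * V ^ n = 1" for n
  proof (induction n)
    case (Suc n)
    have "U ^ Suc n * V ^ Suc n = U * (U ^ n * V ^ n) * V" by (simp add: mult.assoc power_commutes)
    then show ?case using Suc U(2) by simp
  qed simp
  then have "c \<noteq> 0" using c by (metis mult_zero_left scl_zero_left zero_neq_one)
  obtain r where r: "r ^ m = c" using nth_root_exists[OF m_pos] by blast
  have "r \<noteq> 0" using r \<open>c \<noteq> 0\<close> m_pos by auto
  show ?thesis
  proof (rule that)
    show "inverse r \<odot> U \<in> ES" using U(1) by (rule ES_scl)
    show "gm (inverse r \<odot> U) = z \<odot> inverse r \<odot> U" by (simp add: gm_scl U(4) mult.commute)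
    show "(inverse r \<odot> U) ^ m = 1" using r \<open>c \<noteq> 0\<close> by (simp add: scl_power c power_inverse)
  qed
qed

text \<open>Discrete Fourier transform over the cyclic group generated by \<open>gm\<close>:
  \<open>S k\<close> is the component of \<open>T\<close> of eigenvalue
  \<open>y ^ k\<close>.\<close>

lemma eigen_decomposition:
  assumes T: "T \<in> ES"
  obtains y S where "primitive_root N y" "T = (\<Sum>k<N. S k)"
    "\<And>k. S k \<in> ES" "\<And>k. gm (S k) = y ^ k \<odot> S k"
proof -
  define y where "y = cis (2 * pi / N)"
  have y: "primitive_root N y" unfolding y_def by (rule primitive_root_cis[OF N_pos])
  note y' = primitive_root_inverse[OF y]
  have y0: "y \<noteq> 0" by (rule primitive_root_nonzero[OF y N_pos])
  define S where "S k = (1 / of_nat N) \<odot> (\<Sum>i<N. inverse y ^ (i * k) \<odot> (gm ^^ i) T)" for k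
  have 1: "T = (\<Sum>k<N. S k)"
  proof -
    have "(\<Sum>k<N. S k) = (1 / of_nat N) \<odot> (\<Sum>i<N. (\<Sum>k<N. inverse y ^ (i * k)) \<odot> (gm ^^ i) T)"
      unfolding S_def scl_sum_right[symmetric] scl_sum_left by (subst sum.swap) (rule refl)
    also have "(\<Sum>i<N. (\<Sum>k<N. inverse y ^ (i * k)) \<odot> (gm ^^ i) T) = (\<Sum>i<N. if i = 0 then of_nat N \<odot> T else 0)"
      unfolding sum_primitive_root[OF y'] by (rule sum.cong) (auto dest: dvd_imp_le)
    also have "\<dots> = of_nat N \<odot> T" using N_pos by simp
    finally show ?thesis using N_pos by simp
  qed
  have 2: "S k \<in> ES" for k
    unfolding S_def by (intro ES_scl ES_sum gm_funpow_ES T)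
  have 3: "gm (S k) = y ^ k \<odot> S k" for k
  proof -
    let ?g = "\<lambda>i. inverse y ^ (i * k) \<odot> (gm ^^ i) T"
    have "?g N = ?g 0" using gm_N[OF T] primitive_root_power_self[OF y'] by (simp add: power_mult)
    then have sh: "(\<Sum>i<N. ?g (Suc i)) = (\<Sum>i<N. ?g i)" by (rule sum_shift_periodic)
    have "gm (?g i) = y ^ k \<odot> ?g (Suc i)" for i
      using y0 by (simp add: gm_scl power_add power_inverse mult.assoc[symmetric])
    then have "gm (S k) = (1 / of_nat N) \<odot> y ^ k \<odot> (\<Sum>i<N. ?g (Suc i))"
      unfolding S_def gm_scl gm_sum scl_sum_right by simp
    then show ?thesis unfolding sh S_def by (simp add: mult.commute)
  qed
  show ?thesis using that[OF y 1 2 3] .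
qed

text \<open>The \<open>e j\<close> are the projections onto the eigenspaces of multiplication by
  \<open>U\<close>, with eigenvalue \<open>z ^ j\<close>; they are the primitive idempotents of the
  group algebra of the cyclic group of order \<open>m\<close>.\<close>

theorem idempotent_decomposition:
  obtains e where "\<And>i j. i < m \<Longrightarrow> j < m \<Longrightarrow> e i * e j = (if i = j then e i else 0)"
    "(\<Sum>i<m. e i) = 1" "\<And>i. i < m \<Longrightarrow> e i \<noteq> 0" "ES = {\<Sum>i<m. f i \<odot> e i | f. True}"
proof -
  obtain U where U: "U \<in> ES" "gm U = z \<odot> U" "U ^ m = 1" by (rule normalized_eigenvector)
  note z' = primitive_root_inverse[OF z]
  have z0: "z \<noteq> 0" by (rule primitive_root_nonzero[OF z m_pos])
  define e where "e j = (1 / of_nat m) \<odot> (\<Sum>i<m. inverse z ^ (i * j) \<odot> U ^ i)" for j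
  have sum1: "(\<Sum>j<m. e j) = 1"
  proof -
    have "(\<Sum>j<m. e j) = (1 / of_nat m) \<odot> (\<Sum>i<m. (\<Sum>j<m. inverse z ^ (i * j)) \<odot> U ^ i)"
      unfolding e_def scl_sum_right[symmetric] scl_sum_left by (subst sum.swap) (rule refl)
    also have "(\<Sum>i<m. (\<Sum>j<m. inverse z ^ (i * j)) \<odot> U ^ i) = (\<Sum>i<m. if i = 0 then of_nat m \<odot> 1 else 0)"
      unfolding sum_primitive_root[OF z'] by (rule sum.cong) (auto dest: dvd_imp_le)
    also have "\<dots> = of_nat m \<odot> 1" using m_pos by simp
    finally show ?thesis using m_pos by simp
  qed
  have Ue: "U * e j = z ^ j \<odot> e j" for j
  proof -
    let ?g = "\<lambda>i. inverse z ^ (i * j) \<odot> U ^ i"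
    have "?g m = ?g 0" using U(3) primitive_root_power_self[OF z'] by (simp add: power_mult)
    then have sh: "(\<Sum>i<m. ?g (Suc i)) = (\<Sum>i<m. ?g i)" by (rule sum_shift_periodic)
    have "U * ?g i = z ^ j \<odot> ?g (Suc i)" for i
      using z0 by (simp add: power_add power_inverse mult.assoc[symmetric])
    then have "U * e j = (1 / of_nat m) \<odot> z ^ j \<odot> (\<Sum>i<m. ?g (Suc i))"
      unfolding e_def scl_mult_right sum_distrib_left scl_sum_right by simp
    then show ?thesis unfolding sh e_def by (simp add: mult.commute)
  qed
  have Ue': "U ^ i * e j = z ^ (i * j) \<odot> e j" for i j
    by (induction i) (simp_all add: Ue mult.assoc power_add mult.commute)
  have orth: "e i * e j = (if i = j then e i else 0)" if ij: "i < m" "j < m" for i j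
  proof -
    have "e i * e j = (1 / of_nat m) \<odot> (\<Sum>k<m. inverse z ^ (k * i) * z ^ (k * j)) \<odot> e j"
      unfolding e_def[of i] scl_mult_left sum_distrib_right Ue' scl_sum_left by (simp add: Ue')
    also have "(\<Sum>k<m. inverse z ^ (k * i) * z ^ (k * j)) = (if i = j then of_nat m else 0)"
    proof (cases "i = j")
      case True
      then show ?thesis using z0 by (simp add: power_inverse)
    next
      case False
      let ?r = "inverse z ^ i * z ^ j"
      have "?r \<noteq> 1"
      proof
        assume "?r = 1"
        then have "z ^ i = z ^ j" using z0 by (simp add: power_inverse field_simps)
        then show False using primitive_root_inj[OF z] ij False by (auto simp: inj_on_def)
      qed
      have "?r ^ m = (inverse z ^ m) ^ i * (z ^ m) ^ j"
        by (simp add: power_mult_distrib mult.commute flip: power_mult)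
      then have rm: "?r ^ m = 1" by (simp only: primitive_root_power_self[OF z] primitive_root_power_self[OF z']) simp
      have "(\<Sum>k<m. inverse z ^ (k * i) * z ^ (k * j)) = (\<Sum>k<m. ?r ^ k)"
        by (simp add: power_mult_distrib mult.commute flip: power_mult)
      also have "\<dots> = (?r ^ m - 1) / (?r - 1)" by (rule geometric_sum[OF \<open>?r \<noteq> 1\<close>])
      finally show ?thesis using rm False by simp
    qed
    finally show ?thesis using m_pos by simp
  qed
  have nonzero: "e j \<noteq> 0" if "j < m" for j
  proof
    assume "e j = 0"
    \<comment> \<open>\<open>gm\<close> shifts the index of \<open>e j\<close> cyclically, so the
      orbit of each \<open>e j\<close> sums to 1 and none can vanish.\<close>
    have gk: "(gm ^^ k) (e j) = (1 / of_nat m) \<odot> (\<Sum>i<m. (inverse z ^ (i * j) * z ^ (i * k)) \<odot> U ^ i)" for k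
    proof (induction k)
      case (Suc k)
      then show ?case
        by (simp add: gm_scl gm_sum gm_power U(2) scl_power power_add mult_ac)
    qed (simp add: e_def)
    have "(\<Sum>k<m. (gm ^^ k) (e j)) =
        (1 / of_nat m) \<odot> (\<Sum>i<m. (inverse z ^ (i * j) * (\<Sum>k<m. z ^ (i * k))) \<odot> U ^ i)"
      unfolding gk scl_sum_right[symmetric] sum_distrib_left scl_sum_left by (subst sum.swap) (rule refl)
    also have "(\<Sum>i<m. (inverse z ^ (i * j) * (\<Sum>k<m. z ^ (i * k))) \<odot> U ^ i)
        = (\<Sum>i<m. if i = 0 then of_nat m \<odot> 1 else 0)"
      unfolding sum_primitive_root[OF z] by (rule sum.cong) (auto dest: dvd_imp_le)
    also have "\<dots> = of_nat m \<odot> 1" using m_pos by simp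
    finally have "(\<Sum>k<m. (gm ^^ k) (e j)) = 1" using m_pos by simp
    moreover have "(gm ^^ k) 0 = 0" for k by (induction k) (simp_all add: gm_zero)
    ultimately show False using \<open>e j = 0\<close> by simp
  qed
  let ?S = "{\<Sum>i<m. f i \<odot> e i | f. True}"
  have S_add: "A + B \<in> ?S" if AB: "A \<in> ?S" "B \<in> ?S" for A B
  proof -
    obtain f g where "A = (\<Sum>i<m. f i \<odot> e i)" "B = (\<Sum>i<m. g i \<odot> e i)" using AB by blast
    then have "A + B = (\<Sum>i<m. (f i + g i) \<odot> e i)" by (simp add: scl_add_left sum.distrib)
    then show ?thesis by (auto intro!: exI[of _ "\<lambda>i. f i + g i"])
  qed
  have S_zero: "0 \<in> ?S" by (auto intro!: exI[of _ "\<lambda>_. 0"])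
  have S_sum: "sum F I \<in> ?S" if "finite I" "\<And>i. i \<in> I \<Longrightarrow> F i \<in> ?S" for F and I :: "nat set"
    using that
  proof (induction I rule: finite_induct)
    case (insert i I)
    then have "F i + sum F I \<in> ?S" by (intro S_add) blast+
    then show ?case using insert.hyps by simp
  qed (use S_zero in simp)
  have S_U: "c \<odot> U ^ i \<in> ?S" for c i
  proof -
    have "U ^ i = U ^ i * (\<Sum>j<m. e j)" by (simp add: sum1)
    also have "\<dots> = (\<Sum>j<m. z ^ (i * j) \<odot> e j)" by (simp add: sum_distrib_left Ue')
    finally have "c \<odot> U ^ i = (\<Sum>j<m. (c * z ^ (i * j)) \<odot> e j)" by (simp add: scl_sum_right)
    then show ?thesis by (auto intro!: exI[of _ "\<lambda>j. c * z ^ (i * j)"])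
  qed
  have "T \<in> ?S" if T: "T \<in> ES" for T
  proof -
    obtain y S where y: "primitive_root N y" and S: "T = (\<Sum>k<N. S k)"
      "\<And>k. S k \<in> ES" "\<And>k. gm (S k) = y ^ k \<odot> S k" using eigen_decomposition[OF T] by metis
    have "S k \<in> ?S" for k
    proof (cases "S k = 0")
      case True
      then show ?thesis using S_zero by simp
    next
      case False
      then have "(y ^ k) ^ m = 1" using eigenvalue S by blast
      have "\<exists>j<m. y ^ k = z ^ j"
      proof -
        have "(\<lambda>j. z ^ j) ` {..<m} \<subseteq> {x. x ^ m = 1}"
          using primitive_root_power_self[OF z] by (auto simp: mult.commute power_mult[symmetric]) (metis mult.commute power_mult power_one)
        moreover have "card ((\<lambda>j. z ^ j) ` {..<m}) = card {x :: complex. x ^ m = 1}"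
          using card_image[OF primitive_root_inj[OF z]] card_roots_unity_eq[OF m_pos] by simp
        ultimately have "(\<lambda>j. z ^ j) ` {..<m} = {x. x ^ m = 1}"
          using finite_roots_unity[of m] m_pos by (intro card_subset_eq) auto
        then show ?thesis using \<open>(y ^ k) ^ m = 1\<close> by (metis (mono_tags, lifting) imageE lessThan_iff mem_Collect_eq)
      qed
      then obtain j where j: "j < m" "y ^ k = z ^ j" by blast
      \<comment> \<open>Multiplication by this power of \<open>U\<close> moves the component to
        eigenvalue 1, where only scalars live.\<close>
      let ?R = "S k * U ^ (m - j)"
      have "gm ?R = (z ^ j * z ^ (m - j)) \<odot> ?R"
        by (simp add: gm_mult gm_power S(3) U(2) scl_power j(2) mult.commute)
      also have "z ^ j * z ^ (m - j) = 1"
        using j(1) primitive_root_power_self[OF z] by (simp flip: power_add)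
      finally have "gm ?R = ?R" by simp
      then obtain c where c: "?R = c \<odot> 1" using fixed_scalar ES_mult S(2) ES_power U(1) by blast
      have "U ^ (m - j) * U ^ j = 1" using j(1) U(3) by (simp flip: power_add)
      then have "S k = ?R * U ^ j" by (simp add: mult.assoc)
      then have "S k = c \<odot> U ^ j" unfolding c by simp
      then show ?thesis using S_U by simp
    qed
    then show ?thesis unfolding S(1) by (intro S_sum) auto
  qed
  moreover have "T \<in> ES" if TS: "T \<in> ?S" for T
  proof -
    have "e j \<in> ES" for j unfolding e_def by (intro ES_scl ES_sum ES_power U(1))
    moreover obtain f where "T = (\<Sum>i<m. f i \<odot> e i)" using TS by blast
    ultimately show ?thesis by (auto intro: ES_sum ES_scl)
  qed
  ultimately have "ES = ?S" by blast
  then show ?thesis using that orth sum1 nonzero by blast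
qed

end

text \<open>\<open>Ph\<close> combines the idempotents with given coordinates; multiplying by the
  nonzero \<open>e j\<close> reads the j-th coordinate off again, and the isomorphism is the inverse
  of \<open>Ph\<close>.\<close>

lemma alg_iso_Cpow_idempotents:
  fixes E :: "(complex ^ 'm ^ 'm) set" and e :: "nat \<Rightarrow> (complex, 'm::finite) sq"
  assumes orth: "\<And>i j. i < n \<Longrightarrow> j < n \<Longrightarrow> e i * e j = (if i = j then e i else 0)"
    and sum1: "(\<Sum>i<n. e i) = 1" and nz: "\<And>i. i < n \<Longrightarrow> e i \<noteq> 0"
    and E: "to_sq ` E = {\<Sum>i<n. cscl (f i) (e i) | f. True}"
  shows "alg_iso_Cpow E n"
proof -
  let ?F = "{f :: nat \<Rightarrow> complex. \<forall>i\<ge>n. f i = 0}"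
  define Ph where "Ph f = of_sq (\<Sum>i<n. cscl (f i) (e i))" for f
  have proj: "to_sq (Ph f) * e j = cscl (f j) (e j)" if "j < n" for f j
  proof -
    have "to_sq (Ph f) * e j = (\<Sum>i<n. smat (f i) * (e i * e j))"
      by (simp add: Ph_def cscl_def sum_distrib_right mult.assoc)
    also have "\<dots> = (\<Sum>i<n. if i = j then smat (f i) * e i else 0)"
      by (rule sum.cong) (use orth that in auto)
    also have "\<dots> = cscl (f j) (e j)" using that by (simp add: cscl_def)
    finally show ?thesis .
  qed
  have cancel: "c = d" if cd: "cscl c (e j) = cscl d (e j)" "j < n" for c d j
  proof -
    obtain a b where ab: "of_sq (e j) $ a $ b \<noteq> 0" using nz[OF cd(2)] sq_eqI[of "e j" 0] by auto
    have "of_sq (cscl c (e j)) $ a $ b = of_sq (cscl d (e j)) $ a $ b" using cd(1) by simp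
    then show ?thesis using ab by (simp add: cscl_def del: of_sq_simps)
  qed
  have inj: "inj_on Ph ?F"
  proof (rule inj_onI)
    fix f g assume fg: "f \<in> ?F" "g \<in> ?F" "Ph f = Ph g"
    show "f = g"
    proof
      fix i show "f i = g i"
      proof (cases "i < n")
        case True
        then show ?thesis using proj[OF True, of f] proj[OF True, of g] fg(3) cancel by metis
      next
        case False
        then show ?thesis using fg by simp
      qed
    qed
  qed
  have img: "Ph ` ?F = E"
  proof (intro equalityI subsetI)
    fix T assume "T \<in> Ph ` ?F"
    then obtain f where "T = Ph f" by blast
    then have "to_sq T \<in> to_sq ` E" unfolding E Ph_def by auto
    then show "T \<in> E" by (metis image_iff of_sq_to_sq)
  next
    fix T assume "T \<in> E"
    then obtain f where f: "to_sq T = (\<Sum>i<n. cscl (f i) (e i))" using E by blast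
    let ?f = "\<lambda>i. if i < n then f i else 0"
    have "to_sq T = (\<Sum>i<n. cscl (?f i) (e i))" unfolding f by (rule sum.cong) auto
    then have "T = Ph ?f" unfolding Ph_def by (metis of_sq_to_sq)
    moreover have "?f \<in> ?F" by simp
    ultimately show "T \<in> Ph ` ?F" by blast
  qed
  define ph where "ph = inv_into ?F Ph"
  have ph: "ph (Ph f) = f" if "f \<in> ?F" for f unfolding ph_def by (rule inv_into_f_f[OF inj that])
  have Ph_add: "Ph f + Ph g = Ph (\<lambda>i. f i + g i)" for f g
  proof -
    have "(\<Sum>i<n. cscl (f i) (e i)) + (\<Sum>i<n. cscl (g i) (e i)) = (\<Sum>i<n. cscl (f i + g i) (e i))"
      unfolding cscl_def smat_add distrib_right sum.distrib ..
    then show ?thesis unfolding Ph_def of_sq_simps(3)[symmetric] by (rule arg_cong)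
  qed
  have Ph_mult: "Ph f ** Ph g = Ph (\<lambda>i. f i * g i)" for f g
  proof -
    have "to_sq (Ph f) * to_sq (Ph g) = (\<Sum>i<n. smat (g i) * (to_sq (Ph f) * e i))"
      by (simp only: Ph_def[of g] to_sq_of_sq cscl_def sum_distrib_left smat_left_commute[of "to_sq (Ph f)"])
    also have "\<dots> = (\<Sum>i<n. cscl (f i * g i) (e i))"
    proof (rule sum.cong[OF refl])
      fix i assume "i \<in> {..<n}"
      then have "smat (g i) * (to_sq (Ph f) * e i) = smat (g i) * (smat (f i) * e i)"
        using proj[of i f] by (simp add: cscl_def)
      also have "\<dots> = cscl (f i * g i) (e i)"
        unfolding cscl_def by (simp only: mult.assoc[symmetric] smat_mult[symmetric] mult.commute[of "f i"])
      finally show "smat (g i) * (to_sq (Ph f) * e i) = cscl (f i * g i) (e i)" .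
    qed
    finally have "to_sq (Ph f) * to_sq (Ph g) = to_sq (Ph (\<lambda>i. f i * g i))" by (simp add: Ph_def)
    then show ?thesis by (simp add: sq_eq_iff)
  qed
  have Ph_scl: "mat c ** Ph f = Ph (\<lambda>i. c * f i)" for c f
  proof -
    have "smat c * (\<Sum>i<n. cscl (f i) (e i)) = (\<Sum>i<n. cscl (c * f i) (e i))"
      by (simp add: cscl_def smat_mult sum_distrib_left mult.assoc)
    then show ?thesis unfolding Ph_def by (metis of_sq_simps(6) of_sq_smat)
  qed
  have Ph_one: "Ph (\<lambda>i. if i < n then 1 else 0) = mat 1"
  proof -
    have "(\<Sum>i<n. cscl (if i < n then 1 else 0) (e i)) = 1"
      unfolding sum1[symmetric] by (rule sum.cong) (auto simp: cscl_def)
    then show ?thesis by (simp add: Ph_def)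
  qed
  show ?thesis
    unfolding alg_iso_Cpow_def
  proof (intro exI[of _ ph] conjI ballI allI)
    show "bij_betw ph E ?F"
      unfolding ph_def using inj img by (intro bij_betw_inv_into) (simp add: bij_betw_def)
    show "ph (mat 1) = (\<lambda>i. if i < n then 1 else 0)"
      unfolding Ph_one[symmetric] by (rule ph) simp
  next
    fix S T assume "S \<in> E" "T \<in> E"
    then obtain f g where fg: "f \<in> ?F" "g \<in> ?F" "S = Ph f" "T = Ph g" using img by blast
    show "ph (S + T) = (\<lambda>i. ph S i + ph T i)" "ph (S ** T) = (\<lambda>i. ph S i * ph T i)"
      using fg by (simp_all add: ph Ph_add Ph_mult)
  next
    fix c T assume "T \<in> E"
    then obtain f where "f \<in> ?F" "T = Ph f" using img by blast
    then show "ph (mat c ** T) = (\<lambda>i. c * ph T i)" by (simp add: ph Ph_scl)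
  qed
qed

section \<open>Twists of a regular representation\<close>

lemma finite_field_generator:
  obtains u :: "'k::{field,finite}" where "u \<noteq> 0" "\<And>x. x \<noteq> 0 \<Longrightarrow> \<exists>i. x = u ^ i"
proof -
  let ?R = "ring_of_type_algebra :: 'k ring"
  interpret R: Ring.field ?R by (rule field_from_type_algebra)
  have ops: "x \<otimes>\<^bsub>?R\<^esub> y = x * y" "\<one>\<^bsub>?R\<^esub> = (1 :: 'k)" "\<zero>\<^bsub>?R\<^esub> = (0 :: 'k)" "carrier ?R = UNIV" for x y :: 'k
    by (simp_all add: ring_of_type_algebra_def)
  have pw: "x [^]\<^bsub>?R\<^esub> (i::nat) = x ^ i" for x i
  proof (induction i)
    case (Suc i)
    then show ?case unfolding R.nat_pow_Suc ops power_Suc2 by (rule arg_cong)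
  qed (simp only: R.nat_pow_0 ops power_0)
  have "finite (carrier ?R)" unfolding ops by (rule finite_class.finite_UNIV)
  from R.finite_field_mult_group_has_gen[OF this] obtain a where
    a: "a \<in> carrier (Multiplicative_Group.mult_of ?R)" "carrier (Multiplicative_Group.mult_of ?R) = {a [^]\<^bsub>?R\<^esub> i | i::nat. i \<in> UNIV}"
    by (elim bexE) (rule that; assumption)
  have c: "carrier (Multiplicative_Group.mult_of ?R) = UNIV - {0 :: 'k}" by (simp add: ops)
  show ?thesis
  proof (rule that)
    show "a \<noteq> 0" using a(1) unfolding c by blast
    show "\<exists>i. x = a ^ i" if "x \<noteq> 0" for x
      using a(2) that unfolding c pw by blast
  qed
qed

text \<open>The powers of \<open>u\<close> exhaust the \<open>q - 1\<close> nonzero elements, so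
  \<open>u ^ i\<close> determines \<open>i\<close> modulo \<open>q - 1\<close> and with it
  \<open>y ^ i\<close>. The value at 0 is arbitrary.\<close>

lemma exists_field_character:
  fixes u :: "'k::{field,finite}" and y :: complex
  assumes u: "u \<noteq> 0" "\<And>x. x \<noteq> 0 \<Longrightarrow> \<exists>i. x = u ^ i" and y: "y ^ (CARD('k) - 1) = 1"
  obtains ch where "\<And>i. ch (u ^ i) = y ^ i"
proof -
  let ?n = "CARD('k) - 1"
  have n: "?n > 0" using card_finite_field_ge_2[where 'k = 'k] by simp
  have un: "u ^ ?n = 1" using u(1) by (rule finite_field_power_card(1))
  have red: "x ^ i = x ^ (i mod ?n)" if "x ^ ?n = 1" for x :: "'z::monoid_mult" and i
    by (metis mod_mult_div_eq mult.right_neutral power_add power_mult power_one that)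
  have "UNIV - {0} \<subseteq> (\<lambda>i. u ^ i) ` {..<?n}"
  proof
    fix x assume "x \<in> UNIV - {0 :: 'k}"
    then obtain i where "x = u ^ i" using u(2) by blast
    then have "x = u ^ (i mod ?n)" using red[OF un] by metis
    then show "x \<in> (\<lambda>i. u ^ i) ` {..<?n}" using n by auto
  qed
  then have "card (UNIV - {0 :: 'k}) \<le> card ((\<lambda>i. u ^ i) ` {..<?n})" by (intro card_mono) auto
  then have "card ((\<lambda>i. u ^ i) ` {..<?n}) = card {..<?n}"
    using card_image_le[of "{..<?n}" "\<lambda>i. u ^ i"] by (simp add: card_Diff_singleton)
  then have inj: "inj_on (\<lambda>i. u ^ i) {..<?n}" by (intro eq_card_imp_inj_on) auto
  define ch where "ch x = y ^ (SOME i. x = u ^ i)" for x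
  have "ch (u ^ i) = y ^ i" for i
  proof -
    let ?j = "SOME j. u ^ i = u ^ j"
    have "u ^ i = u ^ ?j" by (rule someI[of "\<lambda>j. u ^ i = u ^ j" i]) simp
    then have "u ^ (i mod ?n) = u ^ (?j mod ?n)" using red[OF un] by metis
    then have "i mod ?n = ?j mod ?n" using inj n by (auto simp: inj_on_def)
    then have "y ^ ?j = y ^ i" using red[OF y] by metis
    then show ?thesis by (simp add: ch_def)
  qed
  then show ?thesis using that by blast
qed

lemma power_eq_one_dvd: "a dvd b \<Longrightarrow> y ^ a = 1 \<Longrightarrow> y ^ b = (1 :: complex)"
  by (auto simp: dvd_def power_mult)

text \<open>The exponents sending \<open>y\<close> to 1 are the multiples of a single
  \<open>d\<close>, with \<open>d = 0\<close> when 0 is the only one; so the set \<open>A\<close>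
  may be infinite.\<close>

lemma power_one_Gcd:
  fixes y :: complex
  assumes "\<And>n. n \<in> A \<Longrightarrow> y ^ n = 1"
  shows "y ^ Gcd A = 1"
proof -
  have "\<exists>d. \<forall>n. y ^ n = 1 \<longleftrightarrow> d dvd n"
  proof (cases "\<exists>n>0. y ^ n = 1")
    case True
    define d where "d = (LEAST n. n > 0 \<and> y ^ n = 1)"
    have d: "d > 0" "y ^ d = 1" using LeastI_ex[OF True] unfolding d_def by auto
    have "d dvd n" if "y ^ n = 1" for n
    proof (rule ccontr)
      assume nd: "\<not> d dvd n"
      have "y ^ n = (y ^ d) ^ (n div d) * y ^ (n mod d)"
        by (metis mult_div_mod_eq power_add power_mult)
      then have "y ^ (n mod d) = 1" using that d(2) by simp
      moreover have "n mod d > 0" using nd by (simp add: mod_greater_zero_iff_not_dvd)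
      ultimately have "d \<le> n mod d" unfolding d_def by (intro Least_le) simp
      then show False using mod_less_divisor[OF d(1), of n] by simp
    qed
    moreover have "y ^ n = 1" if "d dvd n" for n
      using that d(2) by (auto simp: dvd_def power_mult)
    ultimately show ?thesis by blast
  next
    case False
    then have "y ^ n = 1 \<longleftrightarrow> 0 dvd n" for n by (metis dvd_0_left_iff neq0_conv power_0)
    then show ?thesis by blast
  qed
  then obtain d where d: "\<And>n. y ^ n = 1 \<longleftrightarrow> d dvd n" by blast
  then have "d dvd Gcd A" using assms by (intro Gcd_greatest) auto
  then show ?thesis using d by blast
qed

lemma exists_sdet:
  obtains A :: "('a::comm_ring_1, 'n::finite) sq" where "sdet A = c"
proof
  let ?k = "undefined :: 'n"
  let ?A = "(\<chi> i j. if i = j then if i = ?k then c else 1 else 0) :: 'a ^ 'n ^ 'n"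
  have "det ?A = (\<Prod>i\<in>UNIV. ?A $ i $ i)" by (rule det_diagonal) simp
  also have "\<dots> = (\<Prod>i\<in>UNIV. if i = ?k then c else 1)" by simp
  also have "\<dots> = c" by simp
  finally show "sdet (to_sq ?A) = c" by (simp add: sdet_def)
qed

locale tau_regular_setup = chain_ring w l pr red
  for w :: "'o::idom" and l :: nat
    and pr :: "'o \<Rightarrow> 'r::{comm_ring_1,finite}" and red :: "'o \<Rightarrow> 'k::{field,finite}" +
  fixes \<rho> :: "'r ^ 'n ^ 'n \<Rightarrow> complex ^ 'm ^ 'm" and ps :: "'r \<Rightarrow> complex"
    and \<tau> :: "nat \<Rightarrow> nat \<Rightarrow> nat" and p :: nat and x :: "('k, 'n) sq"
  assumes p: "prime p" "p dvd CARD('k)" "\<not> p dvd CARD('n)"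
    and irr: "irreducible_rep \<rho>"
    and good: "good_add_char w l pr ps"
    and tau_typ: "typical CARD('n) \<tau>"
    and x_reg: "tau_regular_mat \<tau> (of_sq x)"
    and x_in: "contains_phi w l pr red ps \<rho> (of_sq x)"
begin

lemma ps_add: "ps (a + b) = ps a * ps b"
  using good by (simp add: good_add_char_def)

lemma x_vector:
  obtains xh v where "smap red xh = x" "v \<noteq> 0"
    "\<And>y. \<rho> (matmap pr (mat 1 + matmap (\<lambda>t. w ^ (l - 1) * t) y)) *v v = ps (pr (w ^ (l - 1) * trace (of_sq xh ** y))) *s v"
proof -
  obtain xh where xh: "x = smap red xh" by (rule smap_surj[OF surj_red])
  then have "matmap red (of_sq xh) = of_sq x" by (simp add: smap_def)
  then show ?thesis using x_in that[OF xh[symmetric]] unfolding contains_phi_def by blast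
qed

text \<open>Multiplicativity alone also admits the zero function; the nonzero eigenvector, on which
  the identity matrix acts by \<open>ps 0\<close>, excludes it.\<close>

lemma ps_zero: "ps 0 = 1"
proof -
  obtain xh v where v: "v \<noteq> 0"
    "\<And>y. \<rho> (matmap pr (mat 1 + matmap (\<lambda>t. w ^ (l - 1) * t) y)) *v v = ps (pr (w ^ (l - 1) * trace (of_sq xh ** y))) *s v"
    using x_vector by metis
  have "matmap pr (mat 1 + matmap (\<lambda>t. w ^ (l - 1) * t) (0 :: 'o ^ 'n ^ 'n)) = mat 1"
    by (simp add: vec_eq_iff matmap_def mat_def is_ring_homD[OF hom_pr])
  moreover have "\<rho> (mat 1) = mat 1" using irr by (simp add: irreducible_rep_def is_rep_def)
  moreover have "trace (of_sq xh ** 0) = 0" by (simp add: trace_def matrix_matrix_mult_def)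
  ultimately have "v = ps 0 *s v" using v(2)[of 0] by (simp add: is_ring_homD[OF hom_pr])
  moreover obtain i where "v $ i \<noteq> 0" using v(1) by (auto simp: vec_eq_iff)
  ultimately show ?thesis by (metis mult_cancel_right1 vector_smult_component)
qed

sublocale unit_rep "srep \<rho>" cscl "mat_char ps" "wm :: ('r, 'n) sq" l
proof -
  obtain a where "ps (pr (w ^ (l - 1) * a)) \<noteq> 1" using good by (auto simp: good_add_char_def)
  then show "unit_rep (srep \<rho>) cscl (mat_char ps) (wm :: ('r, 'n) sq) l"
    using unit_rep_srep[OF irr ps_add ps_zero] by blast
qed

lemma l_bound: "l \<le> 2 * (l - 1)" "l - 1 \<ge> 1"
  using l_ge by auto

text \<open>The abstract argument works with elements of the endomorphism ring, so the eigenvector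
  is replaced by the matrix all of whose columns equal it.\<close>

lemma eigen_matrix:
  obtains X V where "smap rd X = x" "V \<noteq> 0"
    "\<And>Y. srep \<rho> (1 + wm ^ (l - 1) * Y) * V = cscl (mat_char ps (wm ^ (l - 1) * X * Y)) V"
proof -
  obtain xh v where xh: "smap red xh = x" and v: "v \<noteq> 0"
    "\<And>y. \<rho> (matmap pr (mat 1 + matmap (\<lambda>t. w ^ (l - 1) * t) y)) *v v = ps (pr (w ^ (l - 1) * trace (of_sq xh ** y))) *s v"
    using x_vector by metis
  let ?X = "smap pr xh"
  let ?V = "to_sq (\<chi> i j. v $ i)"
  have 1: "smap rd ?X = x" unfolding xh[symmetric] by (rule sq_eqI) simp
  obtain i where "v $ i \<noteq> 0" using v(1) by (auto simp: vec_eq_iff)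
  then have 2: "?V \<noteq> 0" by (auto simp: sq_eq_iff vec_eq_iff)
  have col: "A ** (\<chi> i j. u $ i) = (\<chi> i j. (A *v u) $ i)" for A :: "complex ^ 'm ^ 'm" and u
    by (simp add: vec_eq_iff matrix_matrix_mult_def matrix_vector_mult_def)
  have 3: "srep \<rho> (1 + wm ^ (l - 1) * Y) * ?V = cscl (mat_char ps (wm ^ (l - 1) * ?X * Y)) ?V" for Y
  proof -
    obtain yh where yh: "Y = smap pr yh" by (rule smap_surj[OF surj_pr])
    have e: "of_sq (1 + wm ^ (l - 1) * Y) = matmap pr (mat 1 + matmap (\<lambda>t. w ^ (l - 1) * t) (of_sq yh))"
    proof -
      have "of_sq (1 + wm ^ (l - 1) * Y) $ i $ j = pr ((mat 1 + matmap (\<lambda>t. w ^ (l - 1) * t) (of_sq yh)) $ i $ j)" for i j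
        by (simp add: wm_power yh mat_def matmap_def is_ring_homD[OF hom_pr] pr_w_power del: of_sq_simps(6))
      then show ?thesis by (simp add: vec_eq_iff matmap_def)
    qed
    have t: "mat_char ps (wm ^ (l - 1) * ?X * Y) = ps (pr (w ^ (l - 1) * trace (of_sq xh ** of_sq yh)))"
    proof -
      have "trace (of_sq (smat c * B)) = c * trace (of_sq B)" for c :: 'r and B :: "('r, 'n) sq"
        unfolding trace_def by (simp add: sum_distrib_left del: of_sq_simps)
      moreover have "trace (of_sq (smap pr B)) = pr (trace (of_sq B))" for B :: "('o, 'n) sq"
        unfolding trace_def by (simp add: is_ring_hom_sum[OF hom_pr])
      ultimately show ?thesis
        unfolding mat_char_def yh mult.assoc wm_power
        by (simp add: pr_w_power is_ring_homD[OF hom_pr] flip: smap_hom(2)[OF hom_pr])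
    qed
    have "of_sq (srep \<rho> (1 + wm ^ (l - 1) * Y) * ?V) = (\<chi> i j. (ps (pr (w ^ (l - 1) * trace (of_sq xh ** of_sq yh))) *s v) $ i)"
      unfolding srep_def of_sq_simps(6) of_sq_to_sq col e v(2) ..
    also have "\<dots> = of_sq (cscl (mat_char ps (wm ^ (l - 1) * ?X * Y)) ?V)"
      unfolding t cscl_def by (simp add: vec_eq_iff del: of_sq_simps)
    finally show ?thesis by (simp add: sq_eq_iff)
  qed
  show ?thesis by (rule that[OF 1 2 3])
qed

lemma regular_x: "regular_mat (of_sq x)"
  using x_reg by (simp add: tau_regular_mat_def)

lemma iota_dvd: "iota \<tau> (CARD('k) - 1) dvd (CARD('k) - 1)" "iota \<tau> (CARD('k) - 1) > 0"
proof -
  show 1: "iota \<tau> (CARD('k) - 1) dvd (CARD('k) - 1)" unfolding iota_def by (rule Gcd_dvd) simp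
  have "(CARD('k) - 1) > 0" using card_finite_field_ge_2[where 'k = 'k] by simp
  with 1 show "iota \<tau> (CARD('k) - 1) > 0" by (metis dvd_0_left_iff neq0_conv)
qed

text \<open>Every unit commuting with \<open>X\<close> modulo the uniformizer has residual determinant an
  \<open>\<iota>\<close>-th power, so that characters of order dividing \<open>\<iota>\<close> twist \<open>\<rho>\<close> into itself.\<close>

lemma exists_intertwiner:
  assumes u: "u \<noteq> 0" "\<And>c :: 'k. c \<noteq> 0 \<Longrightarrow> \<exists>i. c = u ^ i" and y: "y ^ iota \<tau> (CARD('k) - 1) = 1"
  obtains M where "M \<noteq> 0"
    "\<And>g i. g \<in> unit_set \<Longrightarrow> rd (sdet g) = u ^ i \<Longrightarrow> cscl (y ^ i) (srep \<rho> g * M) = M * srep \<rho> g"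
proof -
  let ?\<iota> = "iota \<tau> (CARD('k) - 1)"
  obtain X V where X: "smap rd X = x" and V: "V \<noteq> 0"
    "\<And>Y. srep \<rho> (1 + wm ^ (l - 1) * Y) * V = cscl (mat_char ps (wm ^ (l - 1) * X * Y)) V"
    using eigen_matrix by metis
  have "iso_proj (l - 1) X * V = V" by (rule iso_proj_fixed) (rule V(2))
  then have nz: "iso_proj (l - 1) X \<noteq> 0" using V(1) by auto
  have yq: "y ^ (CARD('k) - 1) = 1" using power_eq_one_dvd[OF iota_dvd(1) y] .
  obtain ch where ch: "\<And>i. ch (u ^ i) = y ^ i" using exists_field_character[OF u yq] by blast
  have ch_mult: "ch (rd (sdet (g * h))) = ch (rd (sdet g)) * ch (rd (sdet h))"
    if "g \<in> unit_set" "h \<in> unit_set" for g h :: "('r, 'n) sq"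
  proof -
    obtain i j where "rd (sdet g) = u ^ i" "rd (sdet h) = u ^ j" using u(2) \<open>g \<in> _\<close> \<open>h \<in> _\<close> unit_set_rd by metis
    moreover from this have gh: "rd (sdet (g * h)) = u ^ (i + j)"
      by (simp add: sdet_mult is_ring_homD[OF hom_rd] power_add)
    have "ch (rd (sdet (g * h))) = y ^ i * y ^ j" unfolding gh ch by (rule power_add)
    ultimately show ?thesis by (simp only: ch)
  qed
  have triv: "ch (rd (sdet g)) = 1" if g: "g \<in> unit_set" "wm ^ (l - 1) * (g * X - X * g) = 0" for g
  proof -
    obtain f Y where f: "g = peval f X + wm ^ (l - (l - 1)) * Y"
      using centralizer_annihilated[of X "l - 1" g] regular_x X g(2) by auto
    have "l - (l - 1) = 1" using l_ge by simp
    then have "smap rd g = smap rd (peval f X) + smap rd (wm * Y)" using f by (simp add: smap_hom[OF hom_rd])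
    also have "smap rd (wm * Y) = 0" by (auto simp: smap_rd_0)
    finally have g': "smap rd g = peval (map_poly rd f) x" by (simp add: smap_peval[OF hom_rd] X)
    obtain P where P: "charpoly (of_sq x) = P ^ ?\<iota>" "lead_coeff P = 1"
    proof (rule charpoly_iota_power)
      fix d e assume de: "d \<ge> 1" "e \<ge> 1" "mtype (of_sq x) d e \<noteq> 0"
      then have "\<tau> d e \<noteq> 0" using x_reg by (simp add: tau_regular_mat_def)
      then show "?\<iota> dvd e" unfolding iota_def by (intro Gcd_dvd) auto
    qed
    obtain z where z: "sdet (peval (map_poly rd f) x) = z ^ ?\<iota>" by (rule sdet_peval_is_power[OF P])
    have rz: "rd (sdet g) = z ^ ?\<iota>" using g' z by (simp flip: sdet_smap[OF hom_rd])
    then have "z \<noteq> 0" using g(1) unit_set_rd iota_dvd(2) by (metis power_0_left neq0_conv)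
    then obtain j where "z = u ^ j" using u(2) by blast
    then have "rd (sdet g) = u ^ (j * ?\<iota>)" using rz by (simp add: power_mult)
    then have "ch (rd (sdet g)) = (y ^ ?\<iota>) ^ j" by (simp add: ch mult.commute flip: power_mult)
    then show ?thesis using y by simp
  qed
  from twisted_intertwiner[where ch = "\<lambda>g. ch (rd (sdet g))", OF l_bound nz ch_mult triv]
  obtain M where M: "M \<noteq> 0" "\<And>g. g \<in> unit_set \<Longrightarrow> cscl (ch (rd (sdet g))) (srep \<rho> g * M) = M * srep \<rho> g"
    by blast
  show ?thesis by (rule that[OF M(1)]) (use M(2) ch in metis)
qed

text \<open>For every exponent \<open>n\<close> occurring in \<open>\<tau>\<close> there is a
  polynomial in \<open>Z\<close> with residual determinant \<open>u ^ n\<close>. A suitable power of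
  it has order prime to \<open>p\<close>, so the twisting character is trivial on its determinant,
  which yields \<open>y ^ n = 1\<close> and then the claim for the gcd.\<close>

lemma intertwiner_imp_power:
  assumes u: "u \<noteq> 0" "\<And>c :: 'k. c \<noteq> 0 \<Longrightarrow> \<exists>i. c = u ^ i" and y: "y ^ (CARD('k) - 1) = 1"
    and M: "M \<noteq> 0"
    "\<And>g i. g \<in> unit_set \<Longrightarrow> rd (sdet g) = u ^ i \<Longrightarrow> M * srep \<rho> g = cscl (y ^ i) (srep \<rho> g * M)"
  shows "y ^ iota \<tau> (CARD('k) - 1) = 1"
proof -
  obtain X V where X: "smap rd X = x" and V: "V \<noteq> 0"
    "\<And>Y. srep \<rho> (1 + wm ^ (l - 1) * Y) * V = cscl (mat_char ps (wm ^ (l - 1) * X * Y)) V"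
    using eigen_matrix by metis
  obtain ch where ch: "\<And>i. ch (u ^ i) = y ^ i" using exists_field_character[OF u y] by blast
  define b where "b = l div 2"
  define a where "a = l - b"
  have ab: "a + b = l" "b \<le> a" "a \<le> b + 1" "b \<ge> 1" using l_ge by (auto simp: a_def b_def)
  then have al: "a \<le> l - 1" "l \<le> 2 * a" "a \<ge> 1" by auto
  \<comment> \<open>The character of level \<open>l - 1\<close> is extended to level
    \<open>a\<close>; its parameter \<open>Z\<close> still reduces to \<open>x\<close>, hence has
    regular residue.\<close>
  obtain Z where Z: "wm ^ (l - 1) * (Z - X) = 0" and Znz: "iso_proj a Z \<noteq> 0"
    using iso_proj_refine[OF al(1) V al(2,3)] by blast
  have "l - 1 \<le> l" "l - (l - 1) = 1" using l_ge by auto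
  then obtain Y where "Z - X = wm * Y" using wm_annihilator[OF Z] by (metis power_one_right)
  then have "smap rd (Z - X) = 0" by (auto simp: smap_rd_0)
  then have rZ: "smap rd Z = x" using X by (simp add: smap_hom[OF hom_rd])
  let ?D = "{d. \<exists>f. d = peval f Z}"
  have D1: "d * e = e * d" if "d \<in> ?D" "e \<in> ?D" for d e using that by (auto simp: peval_commute)
  have D2: "d * Z = Z * d" if "d \<in> ?D" for d using that by (auto simp: peval_commute_base)
  have cent: "\<exists>d\<in>?D. \<exists>Y. g = d + wm ^ (l - j) * Y" if "j \<le> l" "wm ^ j * (g * Z - Z * g) = 0" for g j
    using centralizer_annihilated[of Z j g] regular_x rZ that by auto
  obtain c0 where c0: "(of_nat p :: ('r, 'n) sq) = wm * c0" and pc: "p = CHAR('k)" by (rule of_nat_residue_char[OF p(1,2)])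
  have "y ^ n = 1" if n: "n \<in> {e. \<exists>d. \<tau> d e \<noteq> 0} \<union> {(CARD('k) - 1)}" for n
  proof (cases "n = (CARD('k) - 1)")
    case False
    then obtain d where d: "\<tau> d n \<noteq> 0" using n by blast
    have "\<forall>d e. d = 0 \<or> e = 0 \<longrightarrow> \<tau> d e = 0" using tau_typ unfolding typical_def by (rule conjunct1)
    then have "d = 0 \<or> n = 0 \<longrightarrow> \<tau> d n = 0" by (elim allE)
    then have dn: "d \<ge> 1" "n \<ge> 1" using d by linarith+
    then have "mtype (of_sq x) d n \<noteq> 0" using d x_reg by (simp add: tau_regular_mat_def)
    then obtain f Q where fQ: "lead_coeff f = 1" "irreducible f" "\<not> f dvd Q" "charpoly (of_sq x) = f ^ n * Q"
      by (rule mtype_nonzero_factor)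
    obtain F where F: "sdet (peval F x) = u ^ n" by (rule sdet_peval_prime_power[OF fQ u(1)])
    obtain F' where F': "map_poly rd F' = F" by (rule lift_poly)
    let ?d = "peval F' Z"
    have rd: "rd (sdet ?d) = u ^ n"
      by (simp add: smap_peval[OF hom_rd] F' rZ F flip: sdet_smap[OF hom_rd])
    then have du: "?d \<in> unit_set" using u(1) by (simp add: unit_set_rd rd)
    then obtain o' where o': "o' > 0" "?d ^ o' = 1" by (rule finite_unit_order)
    have "p > 1" using p(1) prime_gt_1_nat by blast
    \<comment> \<open>The p-part of the order of \<open>?d\<close> is split off; the
      \<open>p ^ s\<close>-th power of \<open>?d\<close> has order prime to \<open>p\<close> and is
      still a polynomial in \<open>Z\<close>.\<close>
    then obtain s N where sN: "o' = p ^ s * N" "\<not> p dvd N"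
    proof -
      have "o' \<noteq> 0" "\<not> is_unit p" using o'(1) \<open>p > 1\<close> by auto
      from multiplicity_decompose'[OF this] that show ?thesis by blast
    qed
    have cop: "coprime N (p ^ l)" using sN(2) p(1) by (metis coprime_commute coprime_power_right_iff prime_imp_coprime)
    let ?t = "?d ^ (p ^ s)"
    have t: "?t \<in> ?D" "?t \<in> unit_set" "?t ^ N = 1"
    proof -
      have "?t = peval (F' ^ (p ^ s)) Z" by (simp add: peval_power)
      then show "?t \<in> ?D" by blast
      show "?t \<in> unit_set" using du by simp
      show "?t ^ N = 1" using o'(2) unfolding sN(1) power_mult .
    qed
    have M': "M * srep \<rho> g = cscl (ch (rd (sdet g))) (srep \<rho> g * M)" if gu: "g \<in> unit_set" for g
    proof -
      obtain i where i: "rd (sdet g) = u ^ i" using u(2)[of "rd (sdet g)"] gu by (auto simp: unit_set_rd)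
      show ?thesis unfolding i ch by (rule M(2)[OF gu i])
    qed
    have chW: "ch (rd (sdet (1 + wm * Y))) = 1" for Y :: "('r, 'n) sq"
    proof -
      have "smap rd (wm * Y) = 0" by (auto simp: smap_rd_0)
      then have "smap rd (1 + wm * Y) = 1" by (simp add: smap_hom[OF hom_rd])
      then have "rd (sdet (1 + wm * Y)) = u ^ 0" by (simp flip: sdet_smap[OF hom_rd])
      then show ?thesis by (simp only: ch) simp
    qed
    have "ch (rd (sdet ?t)) = 1"
      by (rule commuting_character_trivial[OF ab Znz D1 D2 cent c0 cop t M(1), where ch = "\<lambda>g. ch (rd (sdet g))"])
        (use M' chW in auto)
    moreover have "rd (sdet ?t) = u ^ (n * p ^ s)"
      by (simp add: sdet_power is_ring_hom_power[OF hom_rd] rd power_mult)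
    ultimately have yps: "y ^ (n * p ^ s) = 1" using ch by metis
    \<comment> \<open>As \<open>p\<close> divides \<open>q\<close>, it does not divide
      \<open>q - 1\<close>, so the factor \<open>p ^ s\<close> can be removed from the
      exponent.\<close>
    have "coprime (p ^ s) (CARD('k) - 1)"
    proof -
      have "\<not> p dvd (CARD('k) - 1)"
      proof
        assume "p dvd (CARD('k) - 1)"
        moreover have "CARD('k) = (CARD('k) - 1) + 1" using card_finite_field_ge_2[where 'k = 'k] by simp
        ultimately have "p dvd 1" using p(2) by (metis dvd_add_right_iff)
        then show False using \<open>p > 1\<close> by simp
      qed
      then show ?thesis using p(1) by (simp add: prime_imp_coprime)
    qed
    have "(y ^ n) ^ Gcd {p ^ s, (CARD('k) - 1)} = 1"
    proof (rule power_one_Gcd)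
      fix j assume "j \<in> {p ^ s, (CARD('k) - 1)}"
      then show "(y ^ n) ^ j = 1" using yps y by (auto simp: mult.commute simp flip: power_mult) (metis power_mult power_one mult.commute)
    qed
    moreover have "Gcd {p ^ s, (CARD('k) - 1)} = 1" using \<open>coprime (p ^ s) (CARD('k) - 1)\<close> by (simp add: coprime_iff_gcd_eq_1)
    ultimately show ?thesis by simp
  qed (use y in simp)
  then show ?thesis unfolding iota_def by (rule power_one_Gcd)
qed

section \<open>The commutant of SL_n, graded by conjugation with an element of generating
  determinant\<close>

definition ES :: "(complex, 'm) sq set" where
  "ES = {T. \<forall>g. sdet g = 1 \<longrightarrow> T * srep \<rho> g = srep \<rho> g * T}"

lemma to_sq_End_SL: "to_sq ` End_SL \<rho> = ES"
proof (intro equalityI subsetI)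
  fix T assume "T \<in> to_sq ` End_SL \<rho>"
  then show "T \<in> ES" by (auto simp: ES_def End_SL_def SLn_def sdet_def srep_def sq_eq_iff)
next
  fix T assume T: "T \<in> ES"
  have "of_sq T ** \<rho> g = \<rho> g ** of_sq T" if "g \<in> SLn" for g
  proof -
    have "sdet (to_sq g) = 1" using that by (simp add: SLn_def sdet_def)
    then have "T * srep \<rho> (to_sq g) = srep \<rho> (to_sq g) * T" using T by (simp add: ES_def)
    then show ?thesis by (simp add: srep_def sq_eq_iff)
  qed
  then have "of_sq T \<in> End_SL \<rho>" by (simp add: End_SL_def)
  then show "T \<in> to_sq ` End_SL \<rho>" by (metis image_eqI to_sq_of_sq)
qed

text \<open>Principal units are thus determinants of scalar matrices, which act by scalars.\<close>

lemma principal_unit_root: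
  assumes "rd c = 1"
  obtains y where "y ^ CARD('n) = c" "y dvd 1"
proof -
  have "rd (c - 1) = 0" using assms by (simp add: is_ring_homD[OF hom_rd])
  then obtain d where "c - 1 = W * d" by (auto simp: rd_0)
  then have c: "c = 1 + W * d" by (simp add: algebra_simps)
  have "rd (of_nat p) = 0"
  proof -
    obtain c0 where "p = CHAR('k)" using of_nat_residue_char[where 'n = 'n, OF p(1,2)] by blast
    then show ?thesis by (simp add: is_ring_hom_of_nat[OF hom_rd])
  qed
  then obtain e where "of_nat p = W * e" by (auto simp: rd_0)
  \<comment> \<open>Principal units have exponent dividing \<open>p ^ l\<close>, which is prime to
    n, so an n-th root is itself a power.\<close>
  then have cp: "c ^ (p ^ l) = 1"
    unfolding c by (intro one_plus_prime_power[where c = e]) (simp_all add: mult.commute W_nil)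
  have "coprime CARD('n) (p ^ l)" using p by (metis coprime_commute coprime_power_right_iff prime_imp_coprime)
  moreover have "CARD('n) \<noteq> 0" by simp
  ultimately obtain a b where ab: "CARD('n) * a = p ^ l * b + 1"
    using bezout_nat[of "CARD('n)" "p ^ l"] by (auto simp: coprime_iff_gcd_eq_1)
  have "(c ^ a) ^ CARD('n) = c ^ (p ^ l * b + 1)" unfolding ab[symmetric] by (metis mult.commute power_mult)
  also have "\<dots> = c" using cp by (simp add: power_add power_mult)
  finally have 1: "(c ^ a) ^ CARD('n) = c" .
  have "rd (c ^ a) \<noteq> 0" using assms by (simp add: is_ring_hom_power[OF hom_rd])
  then have "c ^ a dvd 1" by (simp add: unit_iff_rd)
  with 1 show ?thesis by (rule that)
qed

text \<open>\<open>g\<close> is a scalar matrix times an element of SL_n, and the scalar matrix acts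
  by a scalar by Schur's lemma. So conjugation on \<open>ES\<close> depends only on the residual
  determinant.\<close>

lemma ES_commute:
  assumes T: "T \<in> ES" and g: "rd (sdet g) = 1"
  shows "srep \<rho> g * T = T * srep \<rho> g"
proof -
  obtain y where y: "y ^ CARD('n) = sdet g" "y dvd 1" using principal_unit_root[OF g] by blast
  let ?s = "smat y :: ('r, 'n) sq"
  have gu: "g \<in> unit_set" by (simp add: unit_set_rd g)
  have su: "?s \<in> unit_set" using gu y(1) by (simp add: unit_set_iff sdet_smat)
  let ?h = "uinv ?s * g"
  have g': "g = ?s * ?h" using su by simp
  have "sdet g * sdet ?h = sdet g * 1" using g' y(1) by (metis mult.right_neutral sdet_mult sdet_smat)
  moreover obtain c where "sdet g * c = 1" using gu by (metis dvdE unit_set_iff)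
  ultimately have "sdet ?h = 1" by (metis mult.assoc mult.commute mult.left_neutral)
  then have hT: "T * srep \<rho> ?h = srep \<rho> ?h * T" using T by (simp add: ES_def)
  have hu: "?h \<in> unit_set" using su gu by simp
  have "srep \<rho> ?s * srep \<rho> k = srep \<rho> k * srep \<rho> ?s" if "k \<in> unit_set" for k
    using su that by (metis rho_mult smat_central)
  then obtain c where c: "srep \<rho> ?s = cscl c 1" using schur by blast
  have "srep \<rho> g = cscl c (srep \<rho> ?h)" using rho_mult[OF su hu] g' c by simp
  then show ?thesis using hT by simp
qed

theorem alg_iso_End_SL: "alg_iso_Cpow (End_SL \<rho>) (iota \<tau> (CARD('k) - 1))"
proof -
  let ?m = "iota \<tau> (CARD('k) - 1)"
  obtain u :: 'k where u: "u \<noteq> 0" "\<And>c. c \<noteq> 0 \<Longrightarrow> \<exists>i. c = u ^ i" using finite_field_generator by metis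
  obtain u' where u': "rd u' = u" using surj_rd by (metis surjD)
  obtain g0 :: "('r, 'n) sq" where g0: "sdet g0 = u'" by (rule exists_sdet)
  have rg0: "rd (sdet (g0 ^ i)) = u ^ i" for i
    by (simp add: sdet_power g0 is_ring_hom_power[OF hom_rd] u')
  have g0u: "g0 \<in> unit_set" using rg0[of 1] u(1) by (simp add: unit_set_rd)
  \<comment> \<open>\<open>g0\<close> has a generator of the residual multiplicative group as
    residual determinant, so this one conjugation describes the whole action on
    \<open>ES\<close>.\<close>
  define gm where "gm T = srep \<rho> g0 * T * srep \<rho> (uinv g0)" for T
  have gm_eig: "gm T = cscl c T \<longleftrightarrow> srep \<rho> g0 * T = cscl c (T * srep \<rho> g0)" for c T
  proof
    assume "gm T = cscl c T"
    then have "gm T * srep \<rho> g0 = cscl c T * srep \<rho> g0" by simp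
    then show "srep \<rho> g0 * T = cscl c (T * srep \<rho> g0)" using g0u by (simp add: gm_def mult.assoc)
  next
    assume "srep \<rho> g0 * T = cscl c (T * srep \<rho> g0)"
    then show "gm T = cscl c T" using g0u by (simp add: gm_def mult.assoc)
  qed
  have eig_pow: "srep \<rho> (g0 ^ i) * T = cscl (c ^ i) (T * srep \<rho> (g0 ^ i))" if "gm T = cscl c T" for T c i
  proof (induction i)
    case (Suc i)
    have "srep \<rho> (g0 ^ Suc i) * T = srep \<rho> g0 * (srep \<rho> (g0 ^ i) * T)"
      using g0u by (simp add: rho_mult mult.assoc)
    also have "\<dots> = cscl (c ^ i) (srep \<rho> g0 * T * srep \<rho> (g0 ^ i))" by (simp add: Suc mult.assoc)
    also have "srep \<rho> g0 * T = cscl c (T * srep \<rho> g0)" using that gm_eig by blast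
    finally show ?case using g0u by (simp add: rho_mult mult.assoc mult.commute)
  qed simp
  \<comment> \<open>\<open>g\<close> differs from \<open>g0 ^ i\<close> by a factor of residual
    determinant 1, which commutes with \<open>T\<close>.\<close>
  have eig_all: "srep \<rho> g * T = cscl (c ^ i) (T * srep \<rho> g)"
    if T: "T \<in> ES" "gm T = cscl c T" and g: "g \<in> unit_set" "rd (sdet g) = u ^ i" for T c g i
  proof -
    let ?h = "uinv (g0 ^ i) * g"
    have giu: "g0 ^ i \<in> unit_set" using g0u by simp
    have g': "g = g0 ^ i * ?h" using giu by simp
    have "u ^ i * rd (sdet ?h) = u ^ i * 1"
      using g(2) rg0[of i] g' by (metis is_ring_homD(2)[OF hom_rd] mult.right_neutral sdet_mult)
    then have "rd (sdet ?h) = 1" using u(1) by simp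
    then have hT: "srep \<rho> ?h * T = T * srep \<rho> ?h" by (rule ES_commute[OF T(1)])
    have hu: "?h \<in> unit_set" using giu g(1) by simp
    have gr: "srep \<rho> g = srep \<rho> (g0 ^ i) * srep \<rho> ?h" using rho_mult[OF giu hu] g' by simp
    have "srep \<rho> g * T = srep \<rho> (g0 ^ i) * T * srep \<rho> ?h" unfolding gr by (simp add: mult.assoc hT)
    also have "\<dots> = cscl (c ^ i) (T * srep \<rho> g)" unfolding eig_pow[OF T(2)] gr by (simp add: mult.assoc)
    finally show ?thesis .
  qed
  let ?z = "cis (2 * pi / ?m)"
  have z: "primitive_root ?m ?z" by (rule primitive_root_cis[OF iota_dvd(2)])
  have SL_unit: "g \<in> unit_set" if "sdet g = 1" for g :: "('r, 'n) sq" using that by (simp add: unit_set_iff)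
  have gm_pow: "(gm ^^ i) T = srep \<rho> (g0 ^ i) * T * srep \<rho> (uinv (g0 ^ i))" for i T
  proof (induction i)
    case (Suc i)
    have "uinv (g0 ^ Suc i) = uinv (g0 ^ i) * uinv g0" using g0u by (simp add: uinv_mult)
    then show ?case using Suc g0u by (simp add: gm_def rho_mult mult.assoc)
  qed simp
  interpret cg: cyclic_grading cscl ES gm "CARD('k) - 1" ?m ?z
  proof unfold_locales
    show "S + T \<in> ES" "S * T \<in> ES" if "S \<in> ES" "T \<in> ES" for S T
    proof -
      show "S + T \<in> ES" using that by (simp add: ES_def distrib_left distrib_right)
      show "S * T \<in> ES"
        unfolding ES_def
      proof (intro CollectI allI impI)
        fix g :: "('r, 'n) sq" assume "sdet g = 1"
        then have S: "S * srep \<rho> g = srep \<rho> g * S" and T: "T * srep \<rho> g = srep \<rho> g * T"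
          using \<open>S \<in> ES\<close> \<open>T \<in> ES\<close> by (simp_all add: ES_def)
        show "S * T * srep \<rho> g = srep \<rho> g * (S * T)"
          unfolding mult.assoc T by (simp only: mult.assoc[symmetric] S)
      qed
    qed
    show "cscl c T \<in> ES" if "T \<in> ES" for c T using that by (simp add: ES_def)
    show "1 \<in> ES" by (simp add: ES_def)
    show "gm (S + T) = gm S + gm T" for S T by (simp add: gm_def distrib_left distrib_right)
    show "gm (S * T) = gm S * gm T" for S T using g0u by (simp add: gm_def mult.assoc)
    show "gm (cscl c T) = cscl c (gm T)" for c T by (simp add: gm_def)
    show "gm 1 = 1" using g0u by (simp add: gm_def)
    show "gm T \<in> ES" if T: "T \<in> ES" for T
      unfolding ES_def
    proof (intro CollectI allI impI)
      fix g :: "('r, 'n) sq" assume g: "sdet g = 1"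
      let ?h = "uinv g0 * g * g0"
      have gu: "g \<in> unit_set" using g by (rule SL_unit)
      have "sdet (uinv g0) * sdet g0 = 1" using g0u by (metis sdet_1 sdet_mult uinv_left)
      then have "sdet ?h = 1" using g by (simp add: sdet_mult mult.commute)
      then have hT: "T * srep \<rho> ?h = srep \<rho> ?h * T" using T by (simp add: ES_def)
      have e1: "srep \<rho> (uinv g0) * srep \<rho> g = srep \<rho> ?h * srep \<rho> (uinv g0)"
        using g0u gu by (simp add: mult.assoc flip: rho_mult)
      have e2: "srep \<rho> g * srep \<rho> g0 = srep \<rho> g0 * srep \<rho> ?h"
        using g0u gu by (simp add: mult.assoc flip: rho_mult)
      have "gm T * srep \<rho> g = srep \<rho> g0 * (T * srep \<rho> ?h) * srep \<rho> (uinv g0)"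
        unfolding gm_def mult.assoc e1 ..
      also have "\<dots> = (srep \<rho> g0 * srep \<rho> ?h) * T * srep \<rho> (uinv g0)" unfolding hT by (simp only: mult.assoc)
      also have "\<dots> = srep \<rho> g * gm T" unfolding e2[symmetric] gm_def by (simp only: mult.assoc)
      finally show "gm T * srep \<rho> g = srep \<rho> g * gm T" .
    qed
    show "(gm ^^ (CARD('k) - 1)) T = T" if T: "T \<in> ES" for T
    proof -
      have "rd (sdet (g0 ^ (CARD('k) - 1))) = 1" unfolding rg0 using u(1) by (rule finite_field_power_card(1))
      then have "srep \<rho> (g0 ^ (CARD('k) - 1)) * T = T * srep \<rho> (g0 ^ (CARD('k) - 1))" by (rule ES_commute[OF T])
      then show ?thesis unfolding gm_pow using g0u by (simp add: mult.assoc)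
    qed
    show "(CARD('k) - 1) > 0" using card_finite_field_ge_2[where 'k = 'k] by simp
    show "?m > 0" by (rule iota_dvd(2))
    show "primitive_root ?m ?z" by (rule z)
    show "\<exists>c. T = cscl c 1" if T: "T \<in> ES" "gm T = T" for T
    proof (rule schur)
      fix g :: "('r, 'n) sq" assume g: "g \<in> unit_set"
      then obtain i where i: "rd (sdet g) = u ^ i" using u(2) unit_set_rd by metis
      have "gm T = cscl 1 T" using T(2) by simp
      from eig_all[OF T(1) this g i] show "T * srep \<rho> g = srep \<rho> g * T" by simp
    qed
    show "c ^ ?m = 1" if T: "T \<in> ES" "T \<noteq> 0" "gm T = cscl c T" for c T
    proof -
      have "rd (sdet (g0 ^ (CARD('k) - 1))) = 1" unfolding rg0 using u(1) by (rule finite_field_power_card(1))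
      then have "srep \<rho> (g0 ^ (CARD('k) - 1)) * T = T * srep \<rho> (g0 ^ (CARD('k) - 1))" by (rule ES_commute[OF T(1)])
      then have "cscl 1 (T * srep \<rho> (g0 ^ (CARD('k) - 1))) = cscl (c ^ (CARD('k) - 1)) (T * srep \<rho> (g0 ^ (CARD('k) - 1)))"
        using eig_pow[OF T(3), of "CARD('k) - 1"] by simp
      moreover have "T * srep \<rho> (g0 ^ (CARD('k) - 1)) \<noteq> 0"
      proof
        assume "T * srep \<rho> (g0 ^ (CARD('k) - 1)) = 0"
        then have "T * srep \<rho> (g0 ^ (CARD('k) - 1)) * srep \<rho> (uinv (g0 ^ (CARD('k) - 1))) = 0" by simp
        then show False using g0u T(2) by (simp add: mult.assoc)
      qed
      ultimately have cq: "c ^ (CARD('k) - 1) = 1" using scl_eq_imp by metis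
      then have c0: "c \<noteq> 0" using card_finite_field_ge_2[where 'k = 'k] by (auto simp: power_0_left)
      \<comment> \<open>Moving \<open>T\<close> to the other side inverts the eigenvalue:
        \<open>T\<close> is an intertwiner for the character sending \<open>u\<close> to
        \<open>inverse c\<close>.\<close>
      have "inverse c ^ ?m = 1"
      proof (rule intertwiner_imp_power[OF u _ T(2)])
        show "inverse c ^ (CARD('k) - 1) = 1" using cq by (simp add: power_inverse)
        fix g :: "('r, 'n) sq" and i assume "g \<in> unit_set" "rd (sdet g) = u ^ i"
        from eig_all[OF T(1,3) this] show "T * srep \<rho> g = cscl (inverse c ^ i) (srep \<rho> g * T)"
          using c0 by (simp add: power_inverse)
      qed
      then show ?thesis by (simp add: power_inverse)
    qed
    show "\<exists>U V. U \<in> ES \<and> U * V = 1 \<and> V * U = 1 \<and> gm U = cscl ?z U"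
    proof -
      let ?y = "inverse ?z"
      have z0: "?z \<noteq> 0" by simp
      have "?y ^ ?m = 1" using primitive_root_power_self[OF primitive_root_inverse[OF z]] .
      from exists_intertwiner[OF u this] obtain M where M: "M \<noteq> 0"
        "\<And>g i. g \<in> unit_set \<Longrightarrow> rd (sdet g) = u ^ i \<Longrightarrow> cscl (?y ^ i) (srep \<rho> g * M) = M * srep \<rho> g" by blast
      have "M \<in> ES"
        unfolding ES_def
      proof (intro CollectI allI impI)
        fix g :: "('r, 'n) sq" assume g: "sdet g = 1"
        then have "rd (sdet g) = u ^ 0" by (simp add: is_ring_homD[OF hom_rd])
        from M(2)[OF SL_unit[OF g] this] show "M * srep \<rho> g = srep \<rho> g * M" by simp
      qed
      moreover have "gm M = cscl ?z M"
      proof -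
        have "cscl ?y (srep \<rho> g0 * M) = M * srep \<rho> g0" using M(2)[OF g0u, of 1] rg0[of 1] by simp
        then have "cscl ?z (cscl ?y (srep \<rho> g0 * M)) = cscl ?z (M * srep \<rho> g0)" by simp
        then have "srep \<rho> g0 * M = cscl ?z (M * srep \<rho> g0)"
          by (simp only: scl_scl right_inverse[OF z0] scl_one)
        then show ?thesis using gm_eig by blast
      qed
      \<comment> \<open>\<open>M\<close> commutes with \<open>\<rho>\<close> up to scalars, so its
        kernel is invariant; being nonzero, \<open>M\<close> is invertible.\<close>
      moreover have "\<exists>V. M * V = 1 \<and> V * M = 1"
      proof -
        have "of_sq M = 0 \<or> invertible (of_sq M)"
        proof (rule irreducible_kernel[OF irr])
          fix g :: "'r ^ 'n ^ 'n" and v assume gv: "g \<in> GLn" "of_sq M *v v = 0"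
          let ?g = "to_sq g"
          have gu: "?g \<in> unit_set" using gv(1) by (simp add: unit_set_GLn)
          then obtain i where "rd (sdet ?g) = u ^ i" using u(2) unit_set_rd by metis
          from M(2)[OF gu this] have "M * srep \<rho> ?g = smat (?y ^ i) * srep \<rho> ?g * M"
            by (simp add: cscl_def mult.assoc)
          then have "of_sq M ** \<rho> g = (mat (?y ^ i) ** \<rho> g) ** of_sq M" by (simp add: srep_def sq_eq_iff)
          then have "of_sq M *v (\<rho> g *v v) = (mat (?y ^ i) ** \<rho> g) *v (of_sq M *v v)"
            by (simp add: matrix_vector_mul_assoc)
          then show "of_sq M *v (\<rho> g *v v) = 0" by (simp add: gv(2))
        qed
        then have "invertible (of_sq M)" using M(1) by (simp add: sq_eq_iff)
        then obtain V where "of_sq M ** V = mat 1" "V ** of_sq M = mat 1" by (auto simp: invertible_def)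
        then have "M * to_sq V = 1" "to_sq V * M = 1" by (simp_all add: sq_eq_iff)
        then show ?thesis by blast
      qed
      ultimately show ?thesis by blast
    qed
  qed
  show ?thesis
  proof (rule cg.idempotent_decomposition)
    fix e :: "nat \<Rightarrow> (complex, 'm) sq"
    assume e: "\<And>i j. i < ?m \<Longrightarrow> j < ?m \<Longrightarrow> e i * e j = (if i = j then e i else 0)"
      "(\<Sum>i<?m. e i) = 1" "\<And>i. i < ?m \<Longrightarrow> e i \<noteq> 0" "ES = {\<Sum>i<?m. cscl (f i) (e i) | f. True}"
    show ?thesis
      by (rule alg_iso_Cpow_idempotents[OF e(1,2,3)]) (simp_all add: to_sq_End_SL e(4))
  qed
qed

end

theorem theorem6p8:
  fixes w :: "'o::idom"
    and l :: nat and p :: nat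
    and \<pi> :: "'o \<Rightarrow> 'r::{comm_ring_1,finite}"
    and red :: "'o \<Rightarrow> 'k::{field,finite}"
    and \<psi> :: "'r \<Rightarrow> complex"
    and \<tau> :: "nat \<Rightarrow> nat \<Rightarrow> nat"
    and \<rho> :: "'r^'n^'n \<Rightarrow> complex^'m^'m"
  assumes "is_uniformizer w" and "adically_complete w"
    and "quotient_map w 1 red"
    and "quotient_map w l \<pi>"
    and "prime p" and "p dvd CARD('k)" and "odd p" and "\<not> p dvd CARD('n)"
    and "l \<ge> 2"
    and "good_add_char w l \<pi> \<psi>"
    and "typical CARD('n) \<tau>"
    and "tau_regular_rep w l \<pi> red \<psi> \<tau> \<rho>"
  shows "alg_iso_Cpow (End_SL \<rho>) (iota \<tau> (CARD('k) - 1))"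
proof -
  obtain x where x: "tau_regular_mat \<tau> x" "contains_phi w l \<pi> red \<psi> \<rho> x"
    using assms(12) by (auto simp: tau_regular_rep_def)
  interpret tau_regular_setup w l \<pi> red \<rho> \<psi> \<tau> p "to_sq x"
    by unfold_locales (use assms x in \<open>auto simp: tau_regular_rep_def\<close>)
  show ?thesis by (rule alg_iso_End_SL)
qed

end
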